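(* Let $\mathcal{A}$ be a $C^*$-category and let $E$ be a right Hilbert $\mathcal{A}$-module. Then there is a collection of bounded adjointable operators $\phi_\lambda:\bigoplus_{x\in S_\lambda}h_x\rightarrow E$, indexed by a directed set $\Lambda$, where each $S_\lambda$ ($\lambda\in\Lambda$) is a finite list of $\mathcal{A}$-objects, such that the net of operators $\phi_\lambda\phi_\lambda^*$ converges strongly to $\mathrm{id}_E$.
   Context: A "category" need not have identities (semicategory). A $C^*$-category is a category $\mathcal{A}$ whose hom-sets are complex Banach spaces, with bilinear composition satisfying $\|fg\|\le\|f\|\|g\|$, and with a conjugate-linear contravariant involution $*$, identity on objects, $f^{**}=f$, such that for every $a\in\mathcal{A}(x,y)$, $\|a^*a\|=\|a\|^2$ and $a^*a$ has spectrum in $[0,\infty)$ in the minimal unitization of $\mathcal{A}(x,x)$. A right Hilbert $\mathcal{A}$-module is a $\mathbb{C}$-linear functor $E:\mathcal{A}^{op}\to\mathrm{Vect}_{\mathbb{C}}$ (write $e\cdot a:=E(a)(e)$) with sesquilinear maps $\langle-,-\rangle:E(y)\times E(x)\to\mathcal{A}(x,y)$ (linear in the second, conjugate-linear in the first argument) such that $\langle e,f\rangle=\langle f,e\rangle^*$, $\langle e,f\rangle\circ g=\langle e,f\cdot g\rangle$, $\langle e,e\rangle$ is positive, $\langle e,e\rangle=0$ only if $e=0$, and each $E(x)$ is complete in the norm $\|e\|=\|\langle e,e\rangle\|^{1/2}$. A bounded adjointable operator $T:E\to F$ is a natural transformation with $\|T\|:=\sup\{\|T(e)\|:x\in\mathrm{Ob}\,\mathcal{A},e\in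 E(x),\|e\|=1\}<\infty$ having an adjoint $T^*:F\to E$ with $\langle Te,f\rangle=\langle e,T^*f\rangle$. The representable module $h_x$ is $h_x(y)=\mathcal{A}(y,x)$ with action by composition and $\langle a,b\rangle=a^*b$. Finite direct sums of Hilbert modules are formed objectwise, with $\langle(e_i),(f_i)\rangle=\sum_i\langle e_i,f_i\rangle$. Strong convergence $T_\lambda\to T$ of operators $E\to F$ means $\|T_\lambda(e)-T(e)\|\to0$ and $\|T_\lambda^*(f)-T^*(f)\|\to0$ for all $x\in\mathrm{Ob}\,\mathcal{A}$, $e\in E(x)$, $f\in F(x)$. *)

theory Defs
  imports
    "HOL-Analysis.Abstract_Metric_Spaces"
    "HOL-Library.Extended_Nonnegative_Real"
    "HOL-Algebra.Algebraic_Closure_Type"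
begin

section \<open>Complex vector spaces with carrier\<close>

text \<open>
  Hom-sets and fibres of modules are vector spaces that vary with the objects, so they are
  modelled as modules over the field of complex numbers in the sense of HOL-Algebra.  The record
  type \<^verbatim>\<open>module\<close> inherits the ring fields \<^verbatim>\<open>mult\<close> and \<^verbatim>\<open>one\<close>; for vector spaces these carry no
  meaning and are never inspected.
\<close>

abbreviation complex_field :: "complex ring" where
  "complex_field \<equiv> ring_of_type_algebra"

abbreviation complex_vector_space :: "(complex, 'v) module \<Rightarrow> bool" where
  "complex_vector_space V \<equiv> Module.module complex_field V"

definition semilinear ::
    "(complex \<Rightarrow> complex) \<Rightarrow> (complex, 'v) module \<Rightarrow> (complex, 'w) module \<Rightarrow> ('v \<Rightarrow> 'w) \<Rightarrow> bool"
  where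
    "semilinear \<sigma> V W f \<longleftrightarrow>
       f \<in> carrier V \<rightarrow> carrier W \<and>
       (\<forall>u\<in>carrier V. \<forall>v\<in>carrier V. f (u \<oplus>\<^bsub>V\<^esub> v) = f u \<oplus>\<^bsub>W\<^esub> f v) \<and>
       (\<forall>c. \<forall>v\<in>carrier V. f (c \<odot>\<^bsub>V\<^esub> v) = \<sigma> c \<odot>\<^bsub>W\<^esub> f v)"

abbreviation linear_map where "linear_map \<equiv> semilinear (\<lambda>c. c)"
abbreviation conj_linear_map where "conj_linear_map \<equiv> semilinear cnj"

definition complete_wrt :: "(complex, 'v) module \<Rightarrow> ('v \<Rightarrow> real) \<Rightarrow> bool" where
  "complete_wrt V nrm \<longleftrightarrow> Metric_space.mcomplete (carrier V) (\<lambda>u v. nrm (u \<ominus>\<^bsub>V\<^esub> v))"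

definition complex_banach_space :: "(complex, 'v) module \<Rightarrow> ('v \<Rightarrow> real) \<Rightarrow> bool" where
  "complex_banach_space V nrm \<longleftrightarrow>
     complex_vector_space V \<and>
     (\<forall>v\<in>carrier V. 0 \<le> nrm v \<and> (nrm v = 0 \<longleftrightarrow> v = \<zero>\<^bsub>V\<^esub>)) \<and>
     (\<forall>u\<in>carrier V. \<forall>v\<in>carrier V. nrm (u \<oplus>\<^bsub>V\<^esub> v) \<le> nrm u + nrm v) \<and>
     (\<forall>c. \<forall>v\<in>carrier V. nrm (c \<odot>\<^bsub>V\<^esub> v) = cmod c * nrm v) \<and>
     complete_wrt V nrm"


section \<open>\<open>C\<^sup>*\<close>-categories\<close>

text \<open>
  \<^verbatim>\<open>Hom A x y\<close> is the space of arrows from \<open>x\<close> to \<open>y\<close>; for \<open>f\<close> in \<^verbatim>\<open>Hom A y z\<close> and \<open>g\<close> in \<^verbatim>\<open>Hom A x y\<close>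
  the composite \<open>f \<circ> g\<close> is \<^verbatim>\<open>cmp A x y z f g\<close>; for \<open>f\<close> in \<^verbatim>\<open>Hom A x y\<close> its adjoint, which lies in
  \<^verbatim>\<open>Hom A y x\<close>, is \<^verbatim>\<open>star A x y f\<close>.  All operations are indexed by the objects, so that the hom-sets
  need not be disjoint.
\<close>

record ('o, 'a) star_category =
  Ob :: "'o set"
  Hom :: "'o \<Rightarrow> 'o \<Rightarrow> (complex, 'a) module"
  hnorm :: "'o \<Rightarrow> 'o \<Rightarrow> 'a \<Rightarrow> real"
  cmp :: "'o \<Rightarrow> 'o \<Rightarrow> 'o \<Rightarrow> 'a \<Rightarrow> 'a \<Rightarrow> 'a"
  star :: "'o \<Rightarrow> 'o \<Rightarrow> 'a \<Rightarrow> 'a"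

definition is_unit_of :: "('o, 'a) star_category \<Rightarrow> 'o \<Rightarrow> 'a \<Rightarrow> bool" where
  "is_unit_of A x u \<longleftrightarrow>
     u \<in> carrier (Hom A x x) \<and>
     (\<forall>a\<in>carrier (Hom A x x). cmp A x x x u a = a \<and> cmp A x x x a u = a)"

text \<open>
  The minimal unitization of the endomorphism algebra \<open>B\<close> of \<open>x\<close>: it is \<open>B\<close> itself if \<open>B\<close> has a unit,
  and \<open>B \<oplus> \<complex>\<close> otherwise.  Both cases are realised on pairs; in the unital case the scalar
  component is always \<open>0\<close>.  An element \<open>a\<close> of \<open>B\<close> is identified with \<open>(a, 0)\<close>.
\<close>

definition min_unitization :: "('o, 'a) star_category \<Rightarrow> 'o \<Rightarrow> (complex, 'a \<times> complex) module" where
  "min_unitization A x =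
     (let B = Hom A x x; unital = (\<exists>u. is_unit_of A x u) in
      \<lparr>carrier = carrier B \<times> (if unital then {0} else UNIV),
       monoid.mult = (\<lambda>(a, s) (b, t).
          (cmp A x x x a b \<oplus>\<^bsub>B\<^esub> (s \<odot>\<^bsub>B\<^esub> b \<oplus>\<^bsub>B\<^esub> t \<odot>\<^bsub>B\<^esub> a), s * t)),
       one = (if unital then (THE u. is_unit_of A x u, 0) else (\<zero>\<^bsub>B\<^esub>, 1)),
       ring.zero = (\<zero>\<^bsub>B\<^esub>, 0),
       add = (\<lambda>(a, s) (b, t). (a \<oplus>\<^bsub>B\<^esub> b, s + t)),
       module.smult = (\<lambda>c (a, s). (c \<odot>\<^bsub>B\<^esub> a, c * s))\<rparr>)"

definition alg_spectrum :: "(complex, 'b) module \<Rightarrow> 'b \<Rightarrow> complex set" where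
  "alg_spectrum U b = {c. b \<ominus>\<^bsub>U\<^esub> (c \<odot>\<^bsub>U\<^esub> \<one>\<^bsub>U\<^esub>) \<notin> Units U}"

definition endo_spectrum :: "('o, 'a) star_category \<Rightarrow> 'o \<Rightarrow> 'a \<Rightarrow> complex set" where
  "endo_spectrum A x a = alg_spectrum (min_unitization A x) (a, 0)"

definition positive_arrow :: "('o, 'a) star_category \<Rightarrow> 'o \<Rightarrow> 'a \<Rightarrow> bool" where
  "positive_arrow A x a \<longleftrightarrow>
     a \<in> carrier (Hom A x x) \<and> star A x x a = a \<and> endo_spectrum A x a \<subseteq> complex_of_real ` {0..}"

locale cstar_category =
  fixes A :: "('o, 'a) star_category"
  assumes hom_banach:
      "\<lbrakk>x \<in> Ob A; y \<in> Ob A\<rbrakk> \<Longrightarrow> complex_banach_space (Hom A x y) (hnorm A x y)"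
    and cmp_linear_right:
      "\<lbrakk>x \<in> Ob A; y \<in> Ob A; z \<in> Ob A; f \<in> carrier (Hom A y z)\<rbrakk>
       \<Longrightarrow> linear_map (Hom A x y) (Hom A x z) (\<lambda>g. cmp A x y z f g)"
    and cmp_linear_left:
      "\<lbrakk>x \<in> Ob A; y \<in> Ob A; z \<in> Ob A; g \<in> carrier (Hom A x y)\<rbrakk>
       \<Longrightarrow> linear_map (Hom A y z) (Hom A x z) (\<lambda>f. cmp A x y z f g)"
    and cmp_assoc:
      "\<lbrakk>w \<in> Ob A; x \<in> Ob A; y \<in> Ob A; z \<in> Ob A;
        f \<in> carrier (Hom A y z); g \<in> carrier (Hom A x y); h \<in> carrier (Hom A w x)\<rbrakk>
       \<Longrightarrow> cmp A w x z (cmp A x y z f g) h = cmp A w y z f (cmp A w x y g h)"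
    and cmp_norm:
      "\<lbrakk>x \<in> Ob A; y \<in> Ob A; z \<in> Ob A; f \<in> carrier (Hom A y z); g \<in> carrier (Hom A x y)\<rbrakk>
       \<Longrightarrow> hnorm A x z (cmp A x y z f g) \<le> hnorm A y z f * hnorm A x y g"
    and star_conj_linear:
      "\<lbrakk>x \<in> Ob A; y \<in> Ob A\<rbrakk> \<Longrightarrow> conj_linear_map (Hom A x y) (Hom A y x) (star A x y)"
    and star_cmp:
      "\<lbrakk>x \<in> Ob A; y \<in> Ob A; z \<in> Ob A; f \<in> carrier (Hom A y z); g \<in> carrier (Hom A x y)\<rbrakk>
       \<Longrightarrow> star A x z (cmp A x y z f g) = cmp A z y x (star A x y g) (star A y z f)"
    and star_star:
      "\<lbrakk>x \<in> Ob A; y \<in> Ob A; f \<in> carrier (Hom A x y)\<rbrakk> \<Longrightarrow> star A y x (star A x y f) = f"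
    and cstar_identity:
      "\<lbrakk>x \<in> Ob A; y \<in> Ob A; a \<in> carrier (Hom A x y)\<rbrakk>
       \<Longrightarrow> hnorm A x x (cmp A x y x (star A x y a) a) = (hnorm A x y a)\<^sup>2"
    and star_self_spectrum:
      "\<lbrakk>x \<in> Ob A; y \<in> Ob A; a \<in> carrier (Hom A x y)\<rbrakk>
       \<Longrightarrow> endo_spectrum A x (cmp A x y x (star A x y a) a) \<subseteq> complex_of_real ` {0..}"


section \<open>Right Hilbert modules\<close>

text \<open>
  \<^verbatim>\<open>Fib E x\<close> is the space \<open>E(x)\<close>.  For \<open>e\<close> in \<open>E(x)\<close> and \<open>a\<close> in \<^verbatim>\<open>Hom A y x\<close>, the element \<open>e \<cdot> a\<close> of \<open>E(y)\<close> is
  \<^verbatim>\<open>act E x y e a\<close>.  For \<open>e\<close> in \<open>E(y)\<close> and \<open>f\<close> in \<open>E(x)\<close>, the inner product \<open>\<langle>e, f\<rangle>\<close>, an arrow from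
  \<open>x\<close> to \<open>y\<close>, is \<^verbatim>\<open>ip E y x e f\<close>.
\<close>

record ('o, 'a, 'm) hilbert_module_data =
  Fib :: "'o \<Rightarrow> (complex, 'm) module"
  act :: "'o \<Rightarrow> 'o \<Rightarrow> 'm \<Rightarrow> 'a \<Rightarrow> 'm"
  ip :: "'o \<Rightarrow> 'o \<Rightarrow> 'm \<Rightarrow> 'm \<Rightarrow> 'a"

definition mnorm ::
    "('o, 'a) star_category \<Rightarrow> ('o, 'a, 'm) hilbert_module_data \<Rightarrow> 'o \<Rightarrow> 'm \<Rightarrow> real" where
  "mnorm A E x e = sqrt (hnorm A x x (ip E x x e e))"

locale hilbert_module = cstar_category A
  for A :: "('o, 'a) star_category" +
  fixes E :: "('o, 'a, 'm) hilbert_module_data"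
  assumes fib_vector_space: "x \<in> Ob A \<Longrightarrow> complex_vector_space (Fib E x)"
    and act_linear_left:
      "\<lbrakk>x \<in> Ob A; y \<in> Ob A; a \<in> carrier (Hom A y x)\<rbrakk>
       \<Longrightarrow> linear_map (Fib E x) (Fib E y) (\<lambda>e. act E x y e a)"
    and act_linear_right:
      "\<lbrakk>x \<in> Ob A; y \<in> Ob A; e \<in> carrier (Fib E x)\<rbrakk>
       \<Longrightarrow> linear_map (Hom A y x) (Fib E y) (\<lambda>a. act E x y e a)"
    and act_cmp:
      "\<lbrakk>x \<in> Ob A; y \<in> Ob A; z \<in> Ob A;
        e \<in> carrier (Fib E x); a \<in> carrier (Hom A y x); b \<in> carrier (Hom A z y)\<rbrakk>
       \<Longrightarrow> act E x z e (cmp A z y x a b) = act E y z (act E x y e a) b"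
    and ip_linear_right:
      "\<lbrakk>x \<in> Ob A; y \<in> Ob A; e \<in> carrier (Fib E y)\<rbrakk>
       \<Longrightarrow> linear_map (Fib E x) (Hom A x y) (\<lambda>f. ip E y x e f)"
    and ip_conj_linear_left:
      "\<lbrakk>x \<in> Ob A; y \<in> Ob A; f \<in> carrier (Fib E x)\<rbrakk>
       \<Longrightarrow> conj_linear_map (Fib E y) (Hom A x y) (\<lambda>e. ip E y x e f)"
    and ip_star:
      "\<lbrakk>x \<in> Ob A; y \<in> Ob A; e \<in> carrier (Fib E y); f \<in> carrier (Fib E x)\<rbrakk>
       \<Longrightarrow> ip E y x e f = star A y x (ip E x y f e)"
    and ip_act:
      "\<lbrakk>x \<in> Ob A; y \<in> Ob A; z \<in> Ob A;
        e \<in> carrier (Fib E y); f \<in> carrier (Fib E x); g \<in> carrier (Hom A z x)\<rbrakk>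
       \<Longrightarrow> cmp A z x y (ip E y x e f) g = ip E y z e (act E x z f g)"
    and ip_positive:
      "\<lbrakk>x \<in> Ob A; e \<in> carrier (Fib E x)\<rbrakk> \<Longrightarrow> positive_arrow A x (ip E x x e e)"
    and ip_definite:
      "\<lbrakk>x \<in> Ob A; e \<in> carrier (Fib E x); ip E x x e e = \<zero>\<^bsub>Hom A x x\<^esub>\<rbrakk> \<Longrightarrow> e = \<zero>\<^bsub>Fib E x\<^esub>"
    and fib_complete: "x \<in> Ob A \<Longrightarrow> complete_wrt (Fib E x) (mnorm A E x)"

definition representable ::
    "('o, 'a) star_category \<Rightarrow> 'o \<Rightarrow> ('o, 'a, 'a) hilbert_module_data" where
  "representable A x =
     \<lparr>Fib = (\<lambda>y. Hom A y x),
      act = (\<lambda>y z a b. cmp A z y x a b),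
      ip = (\<lambda>y z a b. cmp A z x y (star A y x a) b)\<rparr>"

text \<open>
  Elements of a finite direct sum are lists whose \<open>i\<close>-th entry lies in the \<open>i\<close>-th summand.
\<close>

definition direct_sum ::
    "('o, 'a) star_category \<Rightarrow> ('o, 'a, 'm) hilbert_module_data list
       \<Rightarrow> ('o, 'a, 'm list) hilbert_module_data" where
  "direct_sum A Es =
     (let tuple = (\<lambda>h. map h [0..<length Es]) in
      \<lparr>Fib = (\<lambda>x.
         \<lparr>carrier = {es. length es = length Es \<and> (\<forall>i<length Es. es ! i \<in> carrier (Fib (Es ! i) x))},
          monoid.mult = undefined,
          one = undefined,
          ring.zero = tuple (\<lambda>i. \<zero>\<^bsub>Fib (Es ! i) x\<^esub>),
          add = (\<lambda>es fs. tuple (\<lambda>i. es ! i \<oplus>\<^bsub>Fib (Es ! i) x\<^esub> fs ! i)),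
          module.smult = (\<lambda>c es. tuple (\<lambda>i. c \<odot>\<^bsub>Fib (Es ! i) x\<^esub> (es ! i)))\<rparr>),
       act = (\<lambda>x y es a. tuple (\<lambda>i. act (Es ! i) x y (es ! i) a)),
       ip = (\<lambda>y x es fs. finsum (Hom A x y) (\<lambda>i. ip (Es ! i) y x (es ! i) (fs ! i)) {..<length Es})\<rparr>)"


section \<open>Bounded adjointable operators\<close>

definition natural_transformation ::
    "('o, 'a) star_category \<Rightarrow> ('o, 'a, 'm) hilbert_module_data \<Rightarrow> ('o, 'a, 'n) hilbert_module_data
       \<Rightarrow> ('o \<Rightarrow> 'm \<Rightarrow> 'n) \<Rightarrow> bool" where
  "natural_transformation A E F T \<longleftrightarrow>
     (\<forall>x\<in>Ob A. linear_map (Fib E x) (Fib F x) (T x)) \<and>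
     (\<forall>x\<in>Ob A. \<forall>y\<in>Ob A. \<forall>e\<in>carrier (Fib E x). \<forall>a\<in>carrier (Hom A y x).
        T y (act E x y e a) = act F x y (T x e) a)"

definition op_norm ::
    "('o, 'a) star_category \<Rightarrow> ('o, 'a, 'm) hilbert_module_data \<Rightarrow> ('o, 'a, 'n) hilbert_module_data
       \<Rightarrow> ('o \<Rightarrow> 'm \<Rightarrow> 'n) \<Rightarrow> ennreal" where
  "op_norm A E F T =
     (SUP x\<in>Ob A. SUP e\<in>{e \<in> carrier (Fib E x). mnorm A E x e = 1}. ennreal (mnorm A F x (T x e)))"

definition is_adjoint ::
    "('o, 'a) star_category \<Rightarrow> ('o, 'a, 'm) hilbert_module_data \<Rightarrow> ('o, 'a, 'n) hilbert_module_data
       \<Rightarrow> ('o \<Rightarrow> 'm \<Rightarrow> 'n) \<Rightarrow> ('o \<Rightarrow> 'n \<Rightarrow> 'm) \<Rightarrow> bool" where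
  "is_adjoint A E F T S \<longleftrightarrow>
     natural_transformation A F E S \<and>
     (\<forall>x\<in>Ob A. \<forall>y\<in>Ob A. \<forall>e\<in>carrier (Fib E y). \<forall>f\<in>carrier (Fib F x).
        ip F y x (T y e) f = ip E y x e (S x f))"

definition bounded_adjointable ::
    "('o, 'a) star_category \<Rightarrow> ('o, 'a, 'm) hilbert_module_data \<Rightarrow> ('o, 'a, 'n) hilbert_module_data
       \<Rightarrow> ('o \<Rightarrow> 'm \<Rightarrow> 'n) \<Rightarrow> bool" where
  "bounded_adjointable A E F T \<longleftrightarrow>
     natural_transformation A E F T \<and> op_norm A E F T < \<infinity> \<and> (\<exists>S. is_adjoint A E F T S)"

text \<open>
  Definiteness of the inner product determines the adjoint on the fibres; its values outside them,
  which the choice operator leaves open, are irrelevant.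
\<close>

definition adjoint_op ::
    "('o, 'a) star_category \<Rightarrow> ('o, 'a, 'm) hilbert_module_data \<Rightarrow> ('o, 'a, 'n) hilbert_module_data
       \<Rightarrow> ('o \<Rightarrow> 'm \<Rightarrow> 'n) \<Rightarrow> ('o \<Rightarrow> 'n \<Rightarrow> 'm)" where
  "adjoint_op A E F T = (SOME S. is_adjoint A E F T S)"


section \<open>Nets and strong convergence\<close>

definition directed_set :: "'i set \<Rightarrow> 'i rel \<Rightarrow> bool" where
  "directed_set I r \<longleftrightarrow>
     I \<noteq> {} \<and> preorder_on I r \<and> (\<forall>i\<in>I. \<forall>j\<in>I. \<exists>k\<in>I. (i, k) \<in> r \<and> (j, k) \<in> r)"

definition net_tends_to_zero :: "'i set \<Rightarrow> 'i rel \<Rightarrow> ('i \<Rightarrow> real) \<Rightarrow> bool" where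
  "net_tends_to_zero I r t \<longleftrightarrow> (\<forall>\<epsilon>>0. \<exists>i\<in>I. \<forall>j\<in>I. (i, j) \<in> r \<longrightarrow> \<bar>t j\<bar> < \<epsilon>)"

definition strongly_converges ::
    "('o, 'a) star_category \<Rightarrow> ('o, 'a, 'm) hilbert_module_data \<Rightarrow> ('o, 'a, 'n) hilbert_module_data
       \<Rightarrow> 'i set \<Rightarrow> 'i rel \<Rightarrow> ('i \<Rightarrow> 'o \<Rightarrow> 'm \<Rightarrow> 'n) \<Rightarrow> ('o \<Rightarrow> 'm \<Rightarrow> 'n) \<Rightarrow> bool" where
  "strongly_converges A E F I r Ts T \<longleftrightarrow>
     (\<forall>x\<in>Ob A.
        (\<forall>e\<in>carrier (Fib E x).
           net_tends_to_zero I r (\<lambda>i. mnorm A F x (Ts i x e \<ominus>\<^bsub>Fib F x\<^esub> T x e))) \<and>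
        (\<forall>f\<in>carrier (Fib F x).
           net_tends_to_zero I r
             (\<lambda>i. mnorm A E x (adjoint_op A E F (Ts i) x f \<ominus>\<^bsub>Fib E x\<^esub> adjoint_op A E F T x f))))"

end

theory Submission
  imports Defs
begin

text \<open>
  Vectors \<open>\<psi>\<^sub>j \<in> E(x\<^sub>j)\<close> give an operator \<open>\<phi>(a\<^sub>1, \<dots>, a\<^sub>n) = \<psi>\<^sub>1\<cdot>a\<^sub>1 + \<dots> + \<psi>\<^sub>n\<cdot>a\<^sub>n\<close> from a finite sum of
  representable modules to \<open>E\<close>.  Its adjoint sends \<open>f\<close> to the tuple of the \<open>\<langle>\<psi>\<^sub>j, f\<rangle>\<close>, so \<open>\<phi>\<phi>\<^sup>*\<close> is the
  sum of the rank one operators \<open>\<psi>\<^sub>j\<langle>\<psi>\<^sub>j, \<cdot>\<rangle>\<close>.  It is therefore enough to find, for a finite set \<open>F\<close> of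
  vectors and \<open>\<epsilon> > 0\<close>, finitely many \<open>\<psi>\<^sub>j\<close> for which this sum moves each \<open>e \<in> F\<close> by at most \<open>\<epsilon>\<close>
  (\<open>approximate_frame\<close>); the pairs \<open>(F, n)\<close> with \<open>\<epsilon> = 1/(n + 1)\<close> then index the net.  As \<open>\<phi>\<phi>\<^sup>*\<close> is
  self-adjoint, the two halves of strong convergence coincide.

  The textbook choice \<open>\<theta>(\<theta> + \<epsilon>)\<^sup>-\<^sup>1\<close>, with \<open>\<theta>\<close> the sum of all \<open>e\<langle>e, \<cdot>\<rangle>\<close>, becomes \<open>\<phi>\<phi>\<^sup>*\<close> only through
  the square root of \<open>(\<theta> + \<epsilon>)\<^sup>-\<^sup>1\<close>, hence a functional calculus.  Here the sum has the form
  \<open>1 - v\<^sup>*v\<close> instead, where \<open>v\<close> is a product of Cayley transforms \<open>W = (1 - \<theta>)(1 + \<theta>)\<^sup>-\<^sup>1\<close> of single operators \<open>\<theta> = e\<langle>e, \<cdot>\<rangle>\<close>.  The defect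
  \<open>1 - W\<^sup>2 = 4\<theta>(1 + \<theta>)\<^sup>-\<^sup>2\<close> is exactly the rank one operator of \<open>\<psi> = 2(1 + \<theta>)\<^sup>-\<^sup>1e\<close> (\<open>W_square\<close>), so each
  factor \<open>W\<close> contributes one vector to the list (\<open>complement_factor_reflect\<close>).  The powers \<open>W\<^sup>m e\<close>
  tend to \<open>0\<close> (\<open>W_power_tendsto_zero\<close>), and \<open>W\<close> is a contraction.  Hence the vectors of \<open>F\<close> can be
  made small one after the other, each time with the reflection of the current image of the vector.

  The only analysis behind this is the monotonicity \<open>\<parallel>p\<parallel> \<le> \<parallel>p + q\<parallel>\<close> for positive \<open>p\<close> and sums \<open>q\<close> of
  positive arrows (\<open>norm_positive_le\<close>).  Positivity is given as a condition on the spectrum, and the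
  norm is recovered from the spectrum by the spectral radius formula for self-adjoint operators
  (\<open>operator_bound_of_resolvent\<close>).  The latter is proved by Rickart's averaging argument, which
  rests on bounds for resolvents.
\<close>

section \<open>Linear algebra in spaces with carrier\<close>

locale complex_space =
  fixes V :: "(complex, 'v) module" (structure)
  assumes vector_space: "complex_vector_space V"
begin

lemma abelian_group_space: "abelian_group V"
  using vector_space by (simp add: module_def)

sublocale add_group: abelian_group V by (rule abelian_group_space)

lemma scalar_carrier [simp]: "c \<in> carrier complex_field"
  by (simp add: ring_of_type_algebra_def)

lemma scale_closed [simp]: "v \<in> carrier V \<Longrightarrow> c \<odot> v \<in> carrier V"
  using module.smult_closed[OF vector_space] by simp

lemma scale_add_left: "v \<in> carrier V \<Longrightarrow> (c + d) \<odot> v = c \<odot> v \<oplus> d \<odot> v"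
  using module.smult_l_distr[OF vector_space, of c d v] by (simp add: ring_of_type_algebra_def)

lemma scale_add_right:
  "\<lbrakk>u \<in> carrier V; v \<in> carrier V\<rbrakk> \<Longrightarrow> c \<odot> (u \<oplus> v) = c \<odot> u \<oplus> c \<odot> v"
  using module.smult_r_distr[OF vector_space, of c u v] by simp

lemma scale_scale: "v \<in> carrier V \<Longrightarrow> c \<odot> (d \<odot> v) = (c * d) \<odot> v"
  using module.smult_assoc1[OF vector_space, of c d v] by (simp add: ring_of_type_algebra_def)

lemma scale_one [simp]: "v \<in> carrier V \<Longrightarrow> 1 \<odot> v = v"
  using module.smult_one[OF vector_space, of v] by (simp add: ring_of_type_algebra_def)

lemma scale_zero_left [simp]: "v \<in> carrier V \<Longrightarrow> 0 \<odot> v = \<zero>"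
  using module.smult_l_null[OF vector_space, of v] by (simp add: ring_of_type_algebra_def)

lemma scale_zero_right [simp]: "c \<odot> \<zero> = \<zero>"
  using module.smult_r_null[OF vector_space, of c] by simp

lemma minus_eq_scale: "v \<in> carrier V \<Longrightarrow> \<ominus> v = (- 1) \<odot> v"
  by (metis add.right_inverse add_group.minus_equality add_group.a_comm scale_add_left
      scale_closed scale_one scale_zero_left)

text \<open>
  An equation between linear combinations holds as soon as the coefficients of the occurring
  vectors agree.  The rules \<open>lincomb_intros\<close> read the coefficients off an expression, so that
  \<open>lincomb_eqI\<close> replaces a computation in \<open>V\<close> by one with lists of complex numbers.
\<close>

primrec lincomb :: "'v list \<Rightarrow> complex list \<Rightarrow> 'v" where
  "lincomb [] cs = \<zero>"
| "lincomb (v # vs) cs = hd cs \<odot> v \<oplus> lincomb vs (tl cs)"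

definition is_lincomb :: "'v list \<Rightarrow> 'v \<Rightarrow> complex list \<Rightarrow> bool" where
  "is_lincomb vs u cs \<longleftrightarrow>
     (set vs \<subseteq> carrier V \<longrightarrow> length cs = length vs \<and> u = lincomb vs cs)"

lemma lincomb_closed [simp]: "set vs \<subseteq> carrier V \<Longrightarrow> lincomb vs cs \<in> carrier V"
  by (induction vs arbitrary: cs) auto

lemma lincomb_add:
  "\<lbrakk>set vs \<subseteq> carrier V; length cs = length vs; length ds = length vs\<rbrakk>
   \<Longrightarrow> lincomb vs (map2 (+) cs ds) = lincomb vs cs \<oplus> lincomb vs ds"
proof (induction vs arbitrary: cs ds)
  case (Cons v vs)
  then show ?case
    by (cases cs; cases ds) (simp_all add: scale_add_left add_group.a_ac)
qed simp

lemma lincomb_scale: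
  "\<lbrakk>set vs \<subseteq> carrier V; length cs = length vs\<rbrakk>
   \<Longrightarrow> lincomb vs (map ((*) c) cs) = c \<odot> lincomb vs cs"
proof (induction vs arbitrary: cs)
  case (Cons v vs)
  then show ?case by (cases cs) (simp_all add: scale_add_right scale_scale)
qed simp

lemma is_lincomb_add:
  "\<lbrakk>is_lincomb vs u cs; is_lincomb vs v ds\<rbrakk> \<Longrightarrow> is_lincomb vs (u \<oplus> v) (map2 (+) cs ds)"
  by (simp add: is_lincomb_def lincomb_add)

lemma is_lincomb_scale: "is_lincomb vs u cs \<Longrightarrow> is_lincomb vs (c \<odot> u) (map ((*) c) cs)"
  by (simp add: is_lincomb_def lincomb_scale)

lemma is_lincomb_neg: "is_lincomb vs u cs \<Longrightarrow> is_lincomb vs (\<ominus> u) (map ((*) (- 1)) cs)"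
  using lincomb_scale[of vs cs "-1"] by (auto simp add: is_lincomb_def minus_eq_scale)

lemma is_lincomb_diff:
  "\<lbrakk>is_lincomb vs u cs; is_lincomb vs v ds\<rbrakk>
   \<Longrightarrow> is_lincomb vs (u \<ominus> v) (map2 (+) cs (map ((*) (- 1)) ds))"
  unfolding a_minus_def by (intro is_lincomb_add is_lincomb_neg)

lemma is_lincomb_zero: "is_lincomb vs \<zero> (replicate (length vs) 0)"
proof -
  have "set vs \<subseteq> carrier V \<Longrightarrow> lincomb vs (replicate (length vs) 0) = \<zero>"
    by (induction vs) auto
  then show ?thesis by (auto simp: is_lincomb_def)
qed

lemma is_lincomb_head: "is_lincomb (v # vs) v (1 # replicate (length vs) 0)"
  using is_lincomb_zero[of vs] by (auto simp: is_lincomb_def)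

lemma is_lincomb_tail: "is_lincomb vs u cs \<Longrightarrow> is_lincomb (v # vs) u (0 # cs)"
  by (auto simp: is_lincomb_def)

lemmas lincomb_intros =
  is_lincomb_head is_lincomb_add is_lincomb_scale is_lincomb_neg is_lincomb_diff is_lincomb_zero
  is_lincomb_tail

lemma lincomb_eqI:
  "\<lbrakk>is_lincomb vs u cs; is_lincomb vs v ds; set vs \<subseteq> carrier V; cs = ds\<rbrakk> \<Longrightarrow> u = v"
  by (simp add: is_lincomb_def)

lemma diff_self: "v \<in> carrier V \<Longrightarrow> v \<ominus> v = \<zero>"
  by (rule lincomb_eqI[of "[v]"], (rule lincomb_intros)+) simp_all

lemma add_closed: "\<lbrakk>u \<in> carrier V; v \<in> carrier V\<rbrakk> \<Longrightarrow> u \<oplus> v \<in> carrier V"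
  by simp

lemma eq_if_diff_zero: "\<lbrakk>u \<in> carrier V; v \<in> carrier V; u \<ominus> v = \<zero>\<rbrakk> \<Longrightarrow> u = v"
proof -
  assume uv: "u \<in> carrier V" "v \<in> carrier V" "u \<ominus> v = \<zero>"
  have "u = (u \<ominus> v) \<oplus> v"
    by (rule lincomb_eqI[of "[u,v]"], (rule lincomb_intros)+) (use uv in simp_all)
  then show "u = v" using uv by simp
qed

end

lemma semilinearD:
  assumes "semilinear \<sigma> V W f"
  shows "v \<in> carrier V \<Longrightarrow> f v \<in> carrier W"
    and "\<lbrakk>u \<in> carrier V; v \<in> carrier V\<rbrakk> \<Longrightarrow> f (u \<oplus>\<^bsub>V\<^esub> v) = f u \<oplus>\<^bsub>W\<^esub> f v"
    and "v \<in> carrier V \<Longrightarrow> f (c \<odot>\<^bsub>V\<^esub> v) = \<sigma> c \<odot>\<^bsub>W\<^esub> f v"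
  using assms by (auto simp: semilinear_def)

lemma semilinear_zero:
  assumes "semilinear \<sigma> V W f" "complex_vector_space V" "complex_vector_space W" "\<sigma> 0 = 0"
  shows "f \<zero>\<^bsub>V\<^esub> = \<zero>\<^bsub>W\<^esub>"
proof -
  interpret V: complex_space V by (rule complex_space.intro) (rule assms)
  interpret W: complex_space W by (rule complex_space.intro) (rule assms)
  have "f (0 \<odot>\<^bsub>V\<^esub> \<zero>\<^bsub>V\<^esub>) = 0 \<odot>\<^bsub>W\<^esub> f \<zero>\<^bsub>V\<^esub>"
    using semilinearD(3)[OF assms(1), of "\<zero>\<^bsub>V\<^esub>" 0] assms(4) by simp
  then show ?thesis using semilinearD(1)[OF assms(1), of "\<zero>\<^bsub>V\<^esub>"] by simp
qed

lemma semilinear_minus: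
  assumes "semilinear \<sigma> V W f" "complex_vector_space V" "complex_vector_space W" "\<sigma> (- 1) = - 1"
    and "v \<in> carrier V"
  shows "f (\<ominus>\<^bsub>V\<^esub> v) = \<ominus>\<^bsub>W\<^esub> f v"
proof -
  interpret V: complex_space V by (rule complex_space.intro) (rule assms)
  interpret W: complex_space W by (rule complex_space.intro) (rule assms)
  show ?thesis
    using semilinearD[OF assms(1)] assms(4,5)
    by (simp add: V.minus_eq_scale W.minus_eq_scale)
qed

lemma semilinear_diff:
  assumes "semilinear \<sigma> V W f" "complex_vector_space V" "complex_vector_space W" "\<sigma> (- 1) = - 1"
    and "u \<in> carrier V" "v \<in> carrier V"
  shows "f (u \<ominus>\<^bsub>V\<^esub> v) = f u \<ominus>\<^bsub>W\<^esub> f v"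
proof -
  interpret V: complex_space V by (rule complex_space.intro) (rule assms)
  show ?thesis
    using semilinear_minus[OF assms(1-4,6)] semilinearD(2)[OF assms(1)] assms(5,6)
    by (simp add: a_minus_def)
qed

lemma semilinear_finsum:
  fixes V :: "(complex, 'v) module" and W :: "(complex, 'w) module"
  assumes "semilinear \<sigma> V W f" "complex_vector_space V" "complex_vector_space W" "\<sigma> 0 = 0"
    and "\<And>i. i < (n::nat) \<Longrightarrow> g i \<in> carrier V"
  shows "f (finsum V g {..<n}) = finsum W (\<lambda>i. f (g i)) {..<n}"
proof -
  interpret V: complex_space V by (rule complex_space.intro) (rule assms)
  interpret W: complex_space W by (rule complex_space.intro) (rule assms)
  show ?thesis using assms(5)
  proof (induction n)
    case 0
    then show ?case using semilinear_zero[OF assms(1-4)] by simp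
  next
    case (Suc n)
    then show ?case
      using semilinearD[OF assms(1)]
      by (simp add: lessThan_Suc V.add_group.finsum_insert W.add_group.finsum_insert Pi_def
          V.add_group.finsum_closed)
  qed
qed

locale normed_complex_space = complex_space V
  for V :: "(complex, 'v) module" (structure) +
  fixes nrm :: "'v \<Rightarrow> real"
  assumes nrm_nonneg [simp]: "v \<in> carrier V \<Longrightarrow> 0 \<le> nrm v"
    and nrm_eq_zero: "v \<in> carrier V \<Longrightarrow> nrm v = 0 \<longleftrightarrow> v = \<zero>"
    and nrm_add: "\<lbrakk>u \<in> carrier V; v \<in> carrier V\<rbrakk> \<Longrightarrow> nrm (u \<oplus> v) \<le> nrm u + nrm v"
    and nrm_scale: "v \<in> carrier V \<Longrightarrow> nrm (c \<odot> v) = cmod c * nrm v"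
begin

lemma nrm_minus: "v \<in> carrier V \<Longrightarrow> nrm (\<ominus> v) = nrm v"
  by (simp add: minus_eq_scale nrm_scale)

lemma nrm_diff: "\<lbrakk>u \<in> carrier V; v \<in> carrier V\<rbrakk> \<Longrightarrow> nrm (u \<ominus> v) \<le> nrm u + nrm v"
  using nrm_add[of u "\<ominus> v"] by (simp add: a_minus_def nrm_minus)

lemma nrm_add_ge: "\<lbrakk>u \<in> carrier V; v \<in> carrier V\<rbrakk> \<Longrightarrow> nrm u - nrm v \<le> nrm (u \<oplus> v)"
proof -
  assume uv: "u \<in> carrier V" "v \<in> carrier V"
  have "u = (u \<oplus> v) \<ominus> v"
    by (rule lincomb_eqI[of "[u,v]"], (rule lincomb_intros)+) (use uv in simp_all)
  then show ?thesis using nrm_diff[of "u \<oplus> v" v] uv by simp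
qed


lemma nrm_finsum:
  "(\<And>i. i < (n::nat) \<Longrightarrow> g i \<in> carrier V) \<Longrightarrow> nrm (finsum V g {..<n}) \<le> (\<Sum>i<n. nrm (g i))"
proof (induction n)
  case 0
  then show ?case using nrm_eq_zero[of \<zero>] by simp
next
  case (Suc n)
  then have g: "g \<in> {..<n} \<rightarrow> carrier V" "g n \<in> carrier V" by auto
  have "nrm (finsum V g {..<Suc n}) = nrm (g n \<oplus> finsum V g {..<n})"
    using g by (simp add: lessThan_Suc add_group.finsum_insert)
  also have "\<dots> \<le> nrm (g n) + nrm (finsum V g {..<n})"
    using g by (intro nrm_add add_group.finsum_closed)
  also have "\<dots> \<le> nrm (g n) + (\<Sum>i<n. nrm (g i))" using Suc by simp
  finally show ?case by simp
qed

section \<open>The spectral radius of an operator with real spectrum\<close>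

text \<open>
  The vector \<open>g\<close> is \<open>(1 + \<alpha>qh)\<^sup>-\<^sup>1 (1 + \<alpha>h) c\<close>, so \<open>\<epsilon>\<close> bounds the change of the resolvent of \<open>h\<close>
  between the circles of radius \<open>1/\<rho>\<close> and \<open>1/(\<rho>q)\<close>, relative to \<open>b = (1 + \<alpha>h) c\<close>.  Real \<open>\<alpha>\<close> are
  excluded because the resolvent will only be known to exist off the real axis; this is compatible
  with squaring, as the square roots of a non-real number are non-real.
\<close>

definition shifts :: "('v \<Rightarrow> 'v) \<Rightarrow> real \<Rightarrow> real \<Rightarrow> real \<Rightarrow> bool" where
  "shifts h \<rho> q \<epsilon> \<longleftrightarrow>
     (\<forall>\<alpha>. cmod \<alpha> = \<rho> \<longrightarrow> Im \<alpha> \<noteq> 0 \<longrightarrow> (\<forall>c\<in>carrier V. \<exists>g\<in>carrier V.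
        g \<oplus> (\<alpha> * of_real q) \<odot> h g = c \<oplus> \<alpha> \<odot> h c \<and>
        nrm (c \<ominus> g) \<le> \<epsilon> * nrm (c \<oplus> \<alpha> \<odot> h c)))"

text \<open>
  Rickart's averaging argument: \<open>(1 - \<beta>\<^sup>2h\<^sup>2)\<^sup>-\<^sup>1\<close> is the mean of \<open>(1 + \<beta>h)\<^sup>-\<^sup>1\<close> and \<open>(1 - \<beta>h)\<^sup>-\<^sup>1\<close>, and
  a bound on the change of two resolvents is a bound on the change of their mean.  The constant
  \<open>\<epsilon>\<close> therefore does not deteriorate when \<open>h\<close> is squared repeatedly.
\<close>

lemma shifts_square:
  assumes h: "linear_map V V h" and shifts: "shifts h \<rho> q \<epsilon>" and "0 \<le> \<rho>"
  shows "shifts (h \<circ> h) (\<rho>\<^sup>2) (q\<^sup>2) \<epsilon>"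
  unfolding shifts_def
proof (intro allI impI ballI)
  fix \<alpha> c assume \<alpha>: "cmod \<alpha> = \<rho>\<^sup>2" "Im \<alpha> \<noteq> 0" and c: "c \<in> carrier V"
  note hD = semilinearD[OF h]
  \<comment> \<open>With this choice \<open>(1 + \<beta>h)(1 - \<beta>h) = 1 + \<alpha>h\<^sup>2\<close>.\<close>
  define \<beta> where "\<beta> = csqrt (- \<alpha>)"
  have \<beta>2: "\<beta> * \<beta> = - \<alpha>" using power2_csqrt[of "- \<alpha>"] by (simp add: \<beta>_def power2_eq_square)
  then have "(cmod \<beta>)\<^sup>2 = \<rho>\<^sup>2"
    using \<alpha>(1) by (metis norm_minus_cancel norm_mult power2_eq_square)
  then have \<beta>n: "cmod \<beta> = \<rho>" using \<open>0 \<le> \<rho>\<close> by (simp add: power2_eq_iff_nonneg)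
  have \<beta>i: "Im \<beta> \<noteq> 0"
  proof
    assume "Im \<beta> = 0"
    then have "Im (\<beta> * \<beta>) = 0" by simp
    then show False using \<beta>2 \<alpha>(2) by simp
  qed
  define b where "b = c \<oplus> \<alpha> \<odot> h (h c)"
  have cl: "h c \<in> carrier V" "h (h c) \<in> carrier V" "b \<in> carrier V" "h b \<in> carrier V"
    using c hD by (simp_all add: b_def)
  have half: "\<exists>c'\<in>carrier V. \<exists>g\<in>carrier V. c' = c \<oplus> (- \<gamma>) \<odot> h c \<and> nrm (c' \<ominus> g) \<le> \<epsilon> * nrm b \<and>
      g \<oplus> (\<alpha> * of_real (q\<^sup>2)) \<odot> h (h g) = b \<oplus> (- \<gamma> * of_real q) \<odot> h b"
    if \<gamma>: "\<gamma> * \<gamma> = - \<alpha>" "cmod \<gamma> = \<rho>" "Im \<gamma> \<noteq> 0" for \<gamma>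
  proof -
    define c' where "c' = c \<oplus> (- \<gamma>) \<odot> h c"
    have c': "c' \<in> carrier V" using c cl by (simp add: c'_def)
    have hc': "h c' = h c \<oplus> (- \<gamma>) \<odot> h (h c)" using c cl hD by (simp add: c'_def)
    have eb: "c' \<oplus> \<gamma> \<odot> h c' = b"
      unfolding hc' unfolding c'_def b_def
      by (rule lincomb_eqI[of "[c, h c, h (h c)]"], (rule lincomb_intros)+)
        (use c cl \<gamma> in simp_all)
    obtain g where g: "g \<in> carrier V" and ge: "g \<oplus> (\<gamma> * of_real q) \<odot> h g = b"
      and gn: "nrm (c' \<ominus> g) \<le> \<epsilon> * nrm b"
      using shifts[unfolded shifts_def, rule_format, OF \<gamma>(2,3) c'] eb by auto
    have hg: "h g \<in> carrier V" "h (h g) \<in> carrier V" using g hD by simp_all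
    have hb: "h b = h g \<oplus> (\<gamma> * of_real q) \<odot> h (h g)"
      unfolding ge[symmetric] using g hg hD by simp
    have \<alpha>\<gamma>: "\<alpha> = - (\<gamma> * \<gamma>)" using \<gamma>(1) by simp
    have "g \<oplus> (\<alpha> * of_real (q\<^sup>2)) \<odot> h (h g) =
        (g \<oplus> (\<gamma> * of_real q) \<odot> h g) \<oplus> (- \<gamma> * of_real q) \<odot> (h g \<oplus> (\<gamma> * of_real q) \<odot> h (h g))"
      by (rule lincomb_eqI[of "[g, h g, h (h g)]"], (rule lincomb_intros)+)
        (use g hg \<alpha>\<gamma> in \<open>simp_all add: power2_eq_square\<close>)
    then have "g \<oplus> (\<alpha> * of_real (q\<^sup>2)) \<odot> h (h g) = b \<oplus> (- \<gamma> * of_real q) \<odot> h b"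
      using ge hb by simp
    then show ?thesis using c' g gn c'_def by blast
  qed
  obtain c1 g1 where 1: "c1 \<in> carrier V" "g1 \<in> carrier V" "c1 = c \<oplus> (- \<beta>) \<odot> h c"
      "nrm (c1 \<ominus> g1) \<le> \<epsilon> * nrm b"
      "g1 \<oplus> (\<alpha> * of_real (q\<^sup>2)) \<odot> h (h g1) = b \<oplus> (- \<beta> * of_real q) \<odot> h b"
    using half[OF \<beta>2 \<beta>n \<beta>i] by blast
  obtain c2 g2 where 2: "c2 \<in> carrier V" "g2 \<in> carrier V" "c2 = c \<oplus> \<beta> \<odot> h c"
      "nrm (c2 \<ominus> g2) \<le> \<epsilon> * nrm b"
      "g2 \<oplus> (\<alpha> * of_real (q\<^sup>2)) \<odot> h (h g2) = b \<oplus> (\<beta> * of_real q) \<odot> h b"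
    using half[of "- \<beta>"] \<beta>2 \<beta>n \<beta>i by auto
  define g where "g = (1/2) \<odot> g1 \<oplus> (1/2) \<odot> g2"
  have g: "g \<in> carrier V" using 1 2 by (simp add: g_def)
  have hh: "h g1 \<in> carrier V" "h g2 \<in> carrier V" "h (h g1) \<in> carrier V" "h (h g2) \<in> carrier V"
    using 1 2 hD by simp_all
  have hg: "h (h g) = (1/2) \<odot> h (h g1) \<oplus> (1/2) \<odot> h (h g2)"
    using 1 2 hh hD by (simp add: g_def)
  have "g \<oplus> (\<alpha> * of_real (q\<^sup>2)) \<odot> h (h g) =
     (1/2) \<odot> (g1 \<oplus> (\<alpha> * of_real (q\<^sup>2)) \<odot> h (h g1)) \<oplus>
     (1/2) \<odot> (g2 \<oplus> (\<alpha> * of_real (q\<^sup>2)) \<odot> h (h g2))"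
    unfolding hg unfolding g_def
    by (rule lincomb_eqI[of "[g1, g2, h (h g1), h (h g2)]"], (rule lincomb_intros)+)
      (use 1 2 hh in simp_all)
  also have "\<dots> = b"
    unfolding 1(5) 2(5)
    by (rule lincomb_eqI[of "[b, h b]"], (rule lincomb_intros)+) (use cl in simp_all)
  finally have eq: "g \<oplus> (\<alpha> * of_real (q\<^sup>2)) \<odot> h (h g) = b" .
  have "c \<ominus> g = (1/2) \<odot> (c1 \<ominus> g1) \<oplus> (1/2) \<odot> (c2 \<ominus> g2)"
    unfolding 1(3) 2(3) g_def
    by (rule lincomb_eqI[of "[c, h c, g1, g2]"], (rule lincomb_intros)+)
      (use c cl 1(2) 2(2) in simp_all)
  then have "nrm (c \<ominus> g) \<le> (1/2) * nrm (c1 \<ominus> g1) + (1/2) * nrm (c2 \<ominus> g2)"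
    using nrm_add[of "(1/2) \<odot> (c1 \<ominus> g1)" "(1/2) \<odot> (c2 \<ominus> g2)"] 1 2 by (simp add: nrm_scale)
  then have "nrm (c \<ominus> g) \<le> \<epsilon> * nrm b" using 1(4) 2(4) by linarith
  then show "\<exists>g\<in>carrier V. g \<oplus> (\<alpha> * of_real (q\<^sup>2)) \<odot> (h \<circ> h) g = c \<oplus> \<alpha> \<odot> (h \<circ> h) c \<and>
        nrm (c \<ominus> g) \<le> \<epsilon> * nrm (c \<oplus> \<alpha> \<odot> (h \<circ> h) c)"
    using g eq by (auto simp: b_def)
qed

lemma linear_map_funpow: "linear_map V V h \<Longrightarrow> linear_map V V (h ^^ n)"
  by (induction n) (auto simp: semilinear_def Pi_def)

lemma shifts_power:
  assumes "linear_map V V h" and "shifts h \<rho> q \<epsilon>" and "0 \<le> \<rho>"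
  shows "shifts (h ^^ (2 ^ n)) (\<rho> ^ (2 ^ n)) (q ^ (2 ^ n)) \<epsilon>"
proof (induction n)
  case (Suc n)
  have "h ^^ (2 ^ Suc n) = (h ^^ (2 ^ n)) \<circ> (h ^^ (2 ^ n))"
    by (simp add: mult_2 funpow_add)
  moreover have "x ^ (2 ^ Suc n) = (x ^ (2 ^ n))\<^sup>2" for x :: real
    by (simp add: power_mult[symmetric] mult.commute)
  ultimately show ?case
    using shifts_square[OF linear_map_funpow[OF assms(1)] Suc] assms(3)
    by (simp only: zero_le_power)
qed (use assms in simp)

text \<open>
  The resolvent identity: \<open>(1 + \<alpha>qh)(c - g) = \<alpha>(q - 1) h c\<close>.
\<close>

lemma shifts_of_bounded_below:
  assumes h: "linear_map V V h" and hs: "\<And>c. c \<in> carrier V \<Longrightarrow> nrm (h c) \<le> s * nrm c"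
    and q: "0 < q" "q \<le> 1" and m: "0 < m" and s: "0 \<le> s"
    and surj: "\<And>\<alpha> b. \<lbrakk>Im \<alpha> \<noteq> 0; b \<in> carrier V\<rbrakk> \<Longrightarrow> \<exists>g\<in>carrier V. g \<oplus> \<alpha> \<odot> h g = b"
    and below: "\<And>\<alpha> c. \<lbrakk>cmod \<alpha> = \<rho> \<or> cmod \<alpha> = \<rho> * q; c \<in> carrier V\<rbrakk>
                 \<Longrightarrow> m * nrm c \<le> nrm (c \<oplus> \<alpha> \<odot> h c)"
  shows "shifts h \<rho> q ((1 - q) * \<rho> * s / m\<^sup>2)"
  unfolding shifts_def
proof (intro allI impI ballI)
  fix \<alpha> c assume \<alpha>: "cmod \<alpha> = \<rho>" "Im \<alpha> \<noteq> 0" and c: "c \<in> carrier V"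
  note hD = semilinearD[OF h]
  define b where "b = c \<oplus> \<alpha> \<odot> h c"
  have hc: "h c \<in> carrier V" using c hD by simp
  have b: "b \<in> carrier V" using c hc by (simp add: b_def)
  obtain g where g: "g \<in> carrier V" "g \<oplus> (\<alpha> * of_real q) \<odot> h g = b"
    using surj[of "\<alpha> * of_real q" b] \<alpha> q b by auto
  have hg: "h g \<in> carrier V" using g hD by simp
  have neg: "h (c \<ominus> g) = h c \<ominus> h g"
    using semilinear_diff[OF h vector_space vector_space] c g by simp
  have "(c \<ominus> g) \<oplus> (\<alpha> * of_real q) \<odot> h (c \<ominus> g)
      = (c \<oplus> (\<alpha> * of_real q) \<odot> h c) \<ominus> (g \<oplus> (\<alpha> * of_real q) \<odot> h g)"
    unfolding neg
    by (rule lincomb_eqI[of "[c, g, h c, h g]"], (rule lincomb_intros)+)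
      (use c g(1) hc hg in simp_all)
  also have "\<dots> = (\<alpha> * of_real (q - 1)) \<odot> h c"
    unfolding g(2) b_def
    by (rule lincomb_eqI[of "[c, h c]"], (rule lincomb_intros)+)
      (use c hc in \<open>simp_all add: algebra_simps\<close>)
  finally have "m * nrm (c \<ominus> g) \<le> nrm ((\<alpha> * of_real (q - 1)) \<odot> h c)"
    using below[of "\<alpha> * of_real q" "c \<ominus> g"] \<alpha> q c g by (simp add: norm_mult)
  also have "\<dots> = \<rho> * (1 - q) * nrm (h c)"
    using \<alpha> q hc by (simp add: nrm_scale norm_mult del: of_real_diff)
  also have "\<dots> \<le> \<rho> * (1 - q) * (s * nrm c)"
    using hs[OF c] q \<alpha> by (intro mult_left_mono) auto
  finally have "m * (m * nrm (c \<ominus> g)) \<le> \<rho> * (1 - q) * s * (m * nrm c)"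
    using mult_left_mono[of "m * nrm (c \<ominus> g)" "\<rho> * (1 - q) * (s * nrm c)" m] m
    by (simp add: mult_ac)
  also have "\<dots> \<le> \<rho> * (1 - q) * s * nrm b"
    using below[of \<alpha> c] \<alpha> q c s by (intro mult_left_mono) (auto simp: b_def)
  finally have "nrm (c \<ominus> g) \<le> (1 - q) * \<rho> * s / m\<^sup>2 * nrm b"
    using m by (simp add: field_simps power2_eq_square)
  then show "\<exists>g\<in>carrier V. g \<oplus> (\<alpha> * of_real q) \<odot> h g = c \<oplus> \<alpha> \<odot> h c \<and>
        nrm (c \<ominus> g) \<le> (1 - q) * \<rho> * s / m\<^sup>2 * nrm (c \<oplus> \<alpha> \<odot> h c)"
    using g by (auto simp: b_def)
qed

text \<open>
  A lower bound at \<open>\<alpha>\<close> persists, with half the constant, on a ball around \<open>\<alpha>\<close>.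
\<close>

lemma uniformly_bounded_below:
  assumes h: "linear_map V V h" and hs: "\<And>c. c \<in> carrier V \<Longrightarrow> nrm (h c) \<le> s * nrm c"
    and s: "0 \<le> s" and K: "compact K"
    and below: "\<And>\<alpha>. \<alpha> \<in> K \<Longrightarrow> \<exists>m>0. \<forall>c\<in>carrier V. m * nrm c \<le> nrm (c \<oplus> \<alpha> \<odot> h c)"
  obtains m where "0 < m" "\<And>\<alpha> c. \<lbrakk>\<alpha> \<in> K; c \<in> carrier V\<rbrakk> \<Longrightarrow> m * nrm c \<le> nrm (c \<oplus> \<alpha> \<odot> h c)"
proof -
  note hD = semilinearD[OF h]
  obtain M where M: "\<And>\<alpha>. \<alpha> \<in> K \<Longrightarrow> 0 < M \<alpha>"
    "\<And>\<alpha> c. \<lbrakk>\<alpha> \<in> K; c \<in> carrier V\<rbrakk> \<Longrightarrow> M \<alpha> * nrm c \<le> nrm (c \<oplus> \<alpha> \<odot> h c)"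
    using below by metis
  define r where "r \<alpha> = M \<alpha> / (2 * (s + 1))" for \<alpha>
  have "\<And>\<alpha>. \<alpha> \<in> K \<Longrightarrow> open (ball \<alpha> (r \<alpha>))" by simp
  moreover have "K \<subseteq> (\<Union>\<alpha>\<in>K. ball \<alpha> (r \<alpha>))"
    using M(1) s by (force simp: r_def)
  ultimately obtain C where C: "C \<subseteq> K" "finite C" "K \<subseteq> (\<Union>\<alpha>\<in>C. ball \<alpha> (r \<alpha>))"
    using compactE_image[OF K, of K "\<lambda>\<alpha>. ball \<alpha> (r \<alpha>)"] by metis
  define m where "m = Min (insert 1 (M ` C)) / 2"
  have "0 < m" using C M(1) by (auto simp: m_def)
  moreover have "m * nrm c \<le> nrm (c \<oplus> \<alpha> \<odot> h c)" if \<alpha>: "\<alpha> \<in> K" and c: "c \<in> carrier V" for \<alpha> c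
  proof -
    obtain \<beta> where \<beta>: "\<beta> \<in> C" "dist \<beta> \<alpha> < r \<beta>" using C(3) \<alpha> by auto
    have hc: "h c \<in> carrier V" using c hD by simp
    have "c \<oplus> \<beta> \<odot> h c = (c \<oplus> \<alpha> \<odot> h c) \<oplus> (\<beta> - \<alpha>) \<odot> h c"
      by (rule lincomb_eqI[of "[c, h c]"], (rule lincomb_intros)+)
        (use c hc in \<open>simp_all add: algebra_simps\<close>)
    then have "nrm (c \<oplus> \<beta> \<odot> h c) \<le> nrm (c \<oplus> \<alpha> \<odot> h c) + dist \<beta> \<alpha> * nrm (h c)"
      using nrm_add[of "c \<oplus> \<alpha> \<odot> h c" "(\<beta> - \<alpha>) \<odot> h c"] c hc by (simp add: nrm_scale dist_norm)
    moreover have "dist \<beta> \<alpha> * nrm (h c) \<le> r \<beta> * ((s + 1) * nrm c)"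
    proof (rule mult_mono)
      show "nrm (h c) \<le> (s + 1) * nrm c"
        using hs[OF c] nrm_nonneg[OF c] by (simp add: algebra_simps)
      show "0 \<le> r \<beta>" using \<beta> zero_le_dist[of \<beta> \<alpha>] by linarith
    qed (use \<beta> hc in auto)
    moreover have "r \<beta> * ((s + 1) * nrm c) = M \<beta> / 2 * nrm c"
      using s by (simp add: r_def field_simps)
    moreover have "M \<beta> * nrm c \<le> nrm (c \<oplus> \<beta> \<odot> h c)" using M(2) \<beta>(1) C(1) c by blast
    ultimately have "M \<beta> / 2 * nrm c \<le> nrm (c \<oplus> \<alpha> \<odot> h c)" by simp
    moreover have "m \<le> M \<beta> / 2" using C(2) \<beta>(1) by (simp add: m_def)
    ultimately show ?thesis
      using mult_right_mono[of m "M \<beta> / 2" "nrm c"] c by simp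
  qed
  ultimately show ?thesis by (rule that)
qed

text \<open>
  When \<open>\<alpha>qH\<close> is small, \<open>(1 + \<alpha>qH)\<^sup>-\<^sup>1\<close> is close to the identity, and by \<open>shifts\<close> so is
  \<open>(1 + \<alpha>H)\<^sup>-\<^sup>1\<close>; then \<open>\<alpha>H\<close> itself cannot be large.
\<close>

lemma bound_of_shifts:
  assumes H: "linear_map V V H" and bound: "\<And>c. c \<in> carrier V \<Longrightarrow> \<rho> * q * nrm (H c) \<le> nrm c / 8"
    and shifts: "shifts H \<rho> q (1/8)" and "0 < \<rho>" "0 < q" and c: "c \<in> carrier V"
  shows "\<rho> * nrm (H c) \<le> nrm c"
proof -
  note HD = semilinearD[OF H]
  \<comment> \<open>Any non-real number of modulus \<open>\<rho>\<close> would do.\<close>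
  define \<alpha> where "\<alpha> = \<i> * of_real \<rho>"
  have \<alpha>: "cmod \<alpha> = \<rho>" "Im \<alpha> \<noteq> 0" using \<open>0 < \<rho>\<close> by (auto simp: \<alpha>_def norm_mult)
  define b where "b = c \<oplus> \<alpha> \<odot> H c"
  obtain g where g: "g \<in> carrier V" and ge: "g \<oplus> (\<alpha> * of_real q) \<odot> H g = b"
    and gn: "nrm (c \<ominus> g) \<le> 1/8 * nrm b"
    using shifts[unfolded shifts_def, rule_format, OF \<alpha> c] by (auto simp: b_def)
  have cl: "H c \<in> carrier V" "H g \<in> carrier V" "b \<in> carrier V"
    using c g HD by (simp_all add: b_def)
  have small: "nrm ((\<alpha> * of_real q) \<odot> H g) \<le> nrm g / 8"
    using bound[OF g] \<alpha> cl \<open>0 < q\<close> by (simp add: nrm_scale norm_mult)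
  have 1: "nrm g - nrm g / 8 \<le> nrm b"
    using nrm_add_ge[of g "(\<alpha> * of_real q) \<odot> H g"] small g cl unfolding ge by simp
  have "\<alpha> \<odot> H c = (\<alpha> * of_real q) \<odot> H g \<oplus> \<ominus> (c \<ominus> g)"
  proof -
    have "\<alpha> \<odot> H c = b \<ominus> c"
      unfolding b_def by (rule lincomb_eqI[of "[c, H c]"], (rule lincomb_intros)+) (use c cl in simp_all)
    also have "\<dots> = (\<alpha> * of_real q) \<odot> H g \<oplus> \<ominus> (c \<ominus> g)"
      unfolding ge[symmetric]
      by (rule lincomb_eqI[of "[c, g, H g]"], (rule lincomb_intros)+) (use c g cl in simp_all)
    finally show ?thesis .
  qed
  then have 2: "nrm (\<alpha> \<odot> H c) \<le> nrm g / 8 + nrm b / 8"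
    using nrm_add[of "(\<alpha> * of_real q) \<odot> H g" "\<ominus> (c \<ominus> g)"] small gn c g cl
    by (simp add: nrm_minus)
  have 3: "nrm b \<le> nrm c + nrm (\<alpha> \<odot> H c)" using nrm_add[of c "\<alpha> \<odot> H c"] c cl by (simp add: b_def)
  have "nrm (\<alpha> \<odot> H c) = \<rho> * nrm (H c)" using \<alpha> cl by (simp add: nrm_scale)
  then show ?thesis using 1 2 3 nrm_nonneg[OF c] nrm_nonneg[of "\<alpha> \<odot> H c"] cl by simp
qed

text \<open>
  A form of the spectral radius formula.  Let \<open>s\<close> be the norm of \<open>h\<close> and suppose \<open>\<tau> < s\<close>.  For \<open>r\<close>
  slightly below and \<open>r0\<close> slightly above \<open>s\<close> the resolvents at the radii \<open>r\<close> and \<open>r0\<close> are close;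
  they stay close for the powers \<open>h\<^sup>N\<close>, \<open>N = 2\<^sup>k\<close>, while \<open>(h/r0)\<^sup>N\<close> tends to \<open>0\<close>.  Hence
  \<open>\<parallel>h\<^sup>N\<parallel> \<le> r\<^sup>N\<close> for some such \<open>N\<close>, and the assumption \<open>square\<close>, which self-adjoint operators satisfy
  by the \<open>C\<^sup>*\<close>-identity, carries this down to \<open>\<parallel>h\<parallel> \<le> r < s\<close>.

  The assumption \<open>below\<close> says that no point of modulus greater than \<open>\<tau>\<close> is an approximate eigenvalue
  of \<open>h\<close>; by compactness this bounds the resolvents uniformly on an annulus around radius \<open>s\<close>.
\<close>

lemma operator_bound_of_resolvent:
  assumes h: "linear_map V V h" and hC: "\<And>c. c \<in> carrier V \<Longrightarrow> nrm (h c) \<le> C * nrm c"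
    and \<tau>: "0 \<le> \<tau>"
    and surj: "\<And>\<alpha> b. \<lbrakk>Im \<alpha> \<noteq> 0; b \<in> carrier V\<rbrakk> \<Longrightarrow> \<exists>g\<in>carrier V. g \<oplus> \<alpha> \<odot> h g = b"
    and below: "\<And>\<alpha>. \<lbrakk>cmod \<alpha> * \<tau> < 1; \<alpha> \<noteq> 0\<rbrakk>
                 \<Longrightarrow> \<exists>m>0. \<forall>c\<in>carrier V. m * nrm c \<le> nrm (c \<oplus> \<alpha> \<odot> h c)"
    and square: "\<And>n c. c \<in> carrier V
                 \<Longrightarrow> (nrm ((h ^^ n) c))\<^sup>2 \<le> nrm c * nrm ((h ^^ (2 * n)) c)"
    and c: "c \<in> carrier V"
  shows "nrm (h c) \<le> \<tau> * nrm c"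
proof -
  note hD = semilinearD[OF h]
  define S where "S = {C. 0 \<le> C \<and> (\<forall>c\<in>carrier V. nrm (h c) \<le> C * nrm c)}"
  define s where "s = Inf S"
  have CS: "max C 0 \<in> S"
  proof -
    have "nrm (h c) \<le> max C 0 * nrm c" if "c \<in> carrier V" for c
      using hC[OF that] mult_right_mono[of C "max C 0" "nrm c"] that by simp
    then show ?thesis by (simp add: S_def)
  qed
  then have ne: "S \<noteq> {}" by blast
  have bdd: "bdd_below S" by (rule bdd_belowI[of _ 0]) (simp add: S_def)
  have s0: "0 \<le> s" unfolding s_def by (rule cInf_greatest[OF ne]) (simp add: S_def)
  have hs: "nrm (h c) \<le> s * nrm c" if c: "c \<in> carrier V" for c
  proof (cases "nrm c = 0")
    case True
    then show ?thesis using hC[OF c] by simp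
  next
    case False
    then have pos: "0 < nrm c" using nrm_nonneg[OF c] by simp
    have "nrm (h c) / nrm c \<le> s" unfolding s_def
      by (rule cInf_greatest[OF ne]) (use pos c in \<open>auto simp: S_def field_simps\<close>)
    then show ?thesis using pos by (simp add: field_simps)
  qed
  have "s \<le> \<tau>"
  proof (rule ccontr)
    assume "\<not> s \<le> \<tau>"
    then have s\<tau>: "\<tau> < s" by simp
    define \<tau>' where "\<tau>' = (s + \<tau>) / 2"
    have \<tau>': "\<tau> < \<tau>'" "\<tau>' < s" "0 < \<tau>'" using s\<tau> \<tau> by (auto simp: \<tau>'_def)
    define K where "K = cball (0::complex) (1/\<tau>') - ball 0 (1/(s+1))"
    have K: "compact K" unfolding K_def by (intro compact_diff) auto
    have "\<exists>m>0. \<forall>c\<in>carrier V. m * nrm c \<le> nrm (c \<oplus> \<alpha> \<odot> h c)" if "\<alpha> \<in> K" for \<alpha>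
    proof (rule below)
      have "0 < 1/(s+1)" using s0 by simp
      then show "\<alpha> \<noteq> 0" using that by (auto simp: K_def)
      have "cmod \<alpha> * \<tau> \<le> 1/\<tau>' * \<tau>" using that \<tau> by (intro mult_right_mono) (auto simp: K_def)
      also have "\<dots> < 1" using \<tau>' by simp
      finally show "cmod \<alpha> * \<tau> < 1" .
    qed
    then obtain m where m: "0 < m"
      "\<And>\<alpha> c. \<lbrakk>\<alpha> \<in> K; c \<in> carrier V\<rbrakk> \<Longrightarrow> m * nrm c \<le> nrm (c \<oplus> \<alpha> \<odot> h c)"
      using uniformly_bounded_below[OF h hs s0 K] by blast
    \<comment> \<open>The third bound makes the constant of \<open>shifts_of_bounded_below\<close> at most \<open>1/8\<close>; the other
      two keep the radii \<open>r\<close> and \<open>r0\<close> between \<open>\<tau>'\<close> and \<open>s + 1\<close>.\<close>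
    define \<delta> where "\<delta> = min 1 (min (s - \<tau>') (\<tau>' * m\<^sup>2 / 16))"
    have "0 < \<delta>" "\<delta> \<le> 1" "\<delta> \<le> s - \<tau>'" using \<tau>' m by (simp_all add: \<delta>_def)
    moreover have "\<delta> \<le> \<tau>' * m\<^sup>2 / 16"
      unfolding \<delta>_def by (rule order.trans[OF min.cobounded2 min.cobounded2])
    ultimately have \<delta>: "0 < \<delta>" "\<delta> \<le> 1" "\<delta> \<le> s - \<tau>'" "\<delta> \<le> \<tau>' * m\<^sup>2 / 16"
      by blast+
    define r where "r = s - \<delta>"
    define r0 where "r0 = s + \<delta>"
    define \<rho> where "\<rho> = 1 / r"
    define q where "q = r / r0"
    have r: "\<tau>' \<le> r" "0 < r" "r < s" "s < r0" "r0 \<le> s + 1" "0 < r0"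
      using \<delta> \<tau>' s0 by (auto simp: r_def r0_def)
    have q: "0 < q" "q \<le> 1" "0 < \<rho>" "\<rho> * q = 1 / r0" using r by (auto simp: q_def \<rho>_def)
    have inK: "\<alpha> \<in> K" if "cmod \<alpha> = \<rho> \<or> cmod \<alpha> = \<rho> * q" for \<alpha>
    proof -
      have "1/(s+1) \<le> 1/r0" "1/r0 \<le> 1/r" "1/r \<le> 1/\<tau>'"
        using r \<tau>' by (auto intro!: divide_left_mono)
      then show ?thesis using that unfolding q(4) by (auto simp: K_def \<rho>_def)
    qed
    have sh: "shifts h \<rho> q ((1 - q) * \<rho> * s / m\<^sup>2)"
      by (rule shifts_of_bounded_below[OF h hs q(1,2) m(1) s0 surj]) (use m(2) inK in auto)
    have "(1 - q) * \<rho> * s / m\<^sup>2 = (2 * \<delta> / m\<^sup>2) * (s / r0) * (1 / r)"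
      using r m by (simp add: q_def \<rho>_def r_def r0_def field_simps)
    also have "\<dots> \<le> (2 * \<delta> / m\<^sup>2) * 1 * (1 / \<tau>')"
      using r \<tau>' \<delta> s0 by (intro mult_mono) (auto simp: divide_le_eq intro!: divide_left_mono)
    also have "\<dots> \<le> 1/8" using \<delta>(4) m(1) \<tau>' by (simp add: field_simps)
    finally have small: "(1 - q) * \<rho> * s / m\<^sup>2 \<le> 1/8" .
    have sh: "shifts h \<rho> q (1/8)"
      unfolding shifts_def
    proof (intro allI impI ballI)
      fix \<alpha> c assume \<alpha>: "cmod \<alpha> = \<rho>" "Im \<alpha> \<noteq> 0" and c: "c \<in> carrier V"
      then have "c \<oplus> \<alpha> \<odot> h c \<in> carrier V" using hD by simp
      then have "(1 - q) * \<rho> * s / m\<^sup>2 * nrm (c \<oplus> \<alpha> \<odot> h c) \<le> 1/8 * nrm (c \<oplus> \<alpha> \<odot> h c)"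
        by (intro mult_right_mono[OF small]) simp
      then show "\<exists>g\<in>carrier V. g \<oplus> (\<alpha> * of_real q) \<odot> h g = c \<oplus> \<alpha> \<odot> h c \<and>
          nrm (c \<ominus> g) \<le> 1/8 * nrm (c \<oplus> \<alpha> \<odot> h c)"
        using sh[unfolded shifts_def, rule_format, OF \<alpha> c] by (meson order_trans)
    qed
    have pow: "nrm ((h ^^ n) c) \<le> s ^ n * nrm c" if "c \<in> carrier V" for n c
    proof (induction n)
      case (Suc n)
      have "(h ^^ n) c \<in> carrier V" using semilinearD(1)[OF linear_map_funpow[OF h] that] .
      then have "nrm ((h ^^ Suc n) c) \<le> s * nrm ((h ^^ n) c)" using hs by simp
      also have "\<dots> \<le> s * (s ^ n * nrm c)" by (intro mult_left_mono Suc s0)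
      finally show ?case by simp
    qed simp
    have "s / r0 < 1" "0 \<le> s / r0" using r s0 by auto
    then have "(\<lambda>n. (s / r0) ^ n) \<longlonglongrightarrow> 0" by (intro LIMSEQ_power_zero) simp
    then have "\<forall>\<^sub>F n in sequentially. (s / r0) ^ n < 1/8"
      by (rule order_tendstoD) simp
    then obtain k where k: "\<And>n. n \<ge> k \<Longrightarrow> (s / r0) ^ n < 1/8"
      by (auto simp: eventually_sequentially)
    define N :: nat where "N = 2 ^ k"
    have "k \<le> N" unfolding N_def by (rule less_imp_le[OF less_exp])
    have HN: "nrm ((h ^^ N) c) \<le> r ^ N * nrm c" if c: "c \<in> carrier V" for c
    proof -
      have b: "\<rho> ^ N * q ^ N * nrm ((h ^^ N) c) \<le> nrm c / 8" if c: "c \<in> carrier V" for c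
      proof -
        have "\<rho> ^ N * q ^ N * nrm ((h ^^ N) c) \<le> (1 / r0) ^ N * (s ^ N * nrm c)"
          unfolding power_mult_distrib[symmetric] q(4)
          by (intro mult_left_mono pow[OF c]) (use r in simp)
        also have "\<dots> = (s / r0) ^ N * nrm c" by (simp add: power_divide)
        also have "\<dots> \<le> 1/8 * nrm c"
          using k[OF \<open>k \<le> N\<close>] c by (intro mult_right_mono) auto
        finally show ?thesis by simp
      qed
      have "\<rho> ^ N * nrm ((h ^^ N) c) \<le> nrm c"
        by (rule bound_of_shifts[OF linear_map_funpow[OF h] b _ _ _ c])
          (use shifts_power[OF h sh, of k] q in \<open>auto simp: N_def\<close>)
      then show ?thesis using r by (simp add: \<rho>_def power_divide field_simps)
    qed
    have "\<forall>c\<in>carrier V. nrm ((h ^^ (2 ^ j)) c) \<le> r ^ (2 ^ j) * nrm c" if "j \<le> k" for j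
      using that
    proof (induction rule: inc_induct)
      case base
      then show ?case using HN by (simp add: N_def)
    next
      case (step j)
      show ?case
      proof
        fix c assume c: "c \<in> carrier V"
        have "(nrm ((h ^^ (2 ^ j)) c))\<^sup>2 \<le> nrm c * nrm ((h ^^ (2 ^ Suc j)) c)"
          using square[OF c, of "2 ^ j"] by simp
        also have "\<dots> \<le> nrm c * (r ^ (2 ^ Suc j) * nrm c)"
          using step.IH c by (intro mult_left_mono) auto
        also have "\<dots> = (r ^ (2 ^ j) * nrm c)\<^sup>2"
          by (simp add: power2_eq_square power_add[symmetric] mult_2 algebra_simps)
        finally show "nrm ((h ^^ (2 ^ j)) c) \<le> r ^ (2 ^ j) * nrm c"
          by (rule power2_le_imp_le) (use r c in simp)
      qed
    qed
    from this[of 0] have "r \<in> S" using r by (simp add: S_def)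
    then have "s \<le> r" unfolding s_def by (rule cInf_lower[OF _ bdd])
    then show False using r by simp
  qed
  then show ?thesis using hs[OF c] mult_right_mono[of s \<tau> "nrm c"] c by simp
qed

end

section \<open>Arrows of a \<open>C\<^sup>*\<close>-category\<close>

context cstar_category
begin

lemma hom_normed_space:
  assumes "x \<in> Ob A" "y \<in> Ob A"
  shows "normed_complex_space (Hom A x y) (hnorm A x y)"
  using hom_banach[OF assms]
  by (intro normed_complex_space.intro complex_space.intro normed_complex_space_axioms.intro)
    (auto simp: complex_banach_space_def)

lemma hom_complex_space:
  "\<lbrakk>x \<in> Ob A; y \<in> Ob A\<rbrakk> \<Longrightarrow> complex_space (Hom A x y)"
  by (rule normed_complex_space.axioms(1)[OF hom_normed_space])

lemma hom_vector_space: "\<lbrakk>x \<in> Ob A; y \<in> Ob A\<rbrakk> \<Longrightarrow> complex_vector_space (Hom A x y)"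
  by (rule complex_space.vector_space[OF hom_complex_space])

lemmas hom_add_closed [simp] = complex_space.add_closed[OF hom_complex_space]
lemmas hom_scale_closed [simp] = complex_space.scale_closed[OF hom_complex_space]

lemma cmp_closed [simp]:
  "\<lbrakk>x \<in> Ob A; y \<in> Ob A; z \<in> Ob A; f \<in> carrier (Hom A y z); g \<in> carrier (Hom A x y)\<rbrakk>
   \<Longrightarrow> cmp A x y z f g \<in> carrier (Hom A x z)"
  using semilinearD(1)[OF cmp_linear_right] .

lemma star_closed [simp]:
  "\<lbrakk>x \<in> Ob A; y \<in> Ob A; f \<in> carrier (Hom A x y)\<rbrakk> \<Longrightarrow> star A x y f \<in> carrier (Hom A y x)"
  using semilinearD(1)[OF star_conj_linear] .

lemmas cmp_add_right = semilinearD(2)[OF cmp_linear_right]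
lemmas cmp_scale_right = semilinearD(3)[OF cmp_linear_right]
lemmas cmp_add_left = semilinearD(2)[OF cmp_linear_left]
lemmas cmp_scale_left = semilinearD(3)[OF cmp_linear_left]
lemmas star_add = semilinearD(2)[OF star_conj_linear]
lemmas star_scale = semilinearD(3)[OF star_conj_linear]

lemma star_norm:
  assumes "x \<in> Ob A" "y \<in> Ob A" "a \<in> carrier (Hom A x y)"
  shows "hnorm A y x (star A x y a) = hnorm A x y a"
proof -
  have le: "hnorm A x y a \<le> hnorm A y x (star A x y a)"
    if xy: "x \<in> Ob A" "y \<in> Ob A" and a: "a \<in> carrier (Hom A x y)" for x y a
  proof -
    interpret xy: normed_complex_space "Hom A x y" "hnorm A x y" by (rule hom_normed_space[OF xy])
    interpret yx: normed_complex_space "Hom A y x" "hnorm A y x"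
      by (rule hom_normed_space[OF xy(2,1)])
    have "hnorm A x y a * hnorm A x y a \<le> hnorm A y x (star A x y a) * hnorm A x y a"
      using cstar_identity[OF xy a] cmp_norm[of x y x "star A x y a" a] xy a
      by (simp add: power2_eq_square)
    then show ?thesis
      using xy.nrm_nonneg[OF a] yx.nrm_nonneg[of "star A x y a"] a xy
      by (cases "hnorm A x y a = 0") (auto simp: mult_le_cancel_right)
  qed
  show ?thesis
    using le[OF assms] le[of y x "star A x y a"] assms star_star[OF assms] by simp
qed

lemma star_self_eq_zero:
  assumes "x \<in> Ob A" "y \<in> Ob A" "a \<in> carrier (Hom A x y)"
    and "cmp A x y x (star A x y a) a = \<zero>\<^bsub>Hom A x x\<^esub>"
  shows "a = \<zero>\<^bsub>Hom A x y\<^esub>"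
proof -
  interpret xx: normed_complex_space "Hom A x x" "hnorm A x x" by (rule hom_normed_space) fact+
  interpret xy: normed_complex_space "Hom A x y" "hnorm A x y" by (rule hom_normed_space) fact+
  show ?thesis
    using cstar_identity[OF assms(1-3)] assms(4) xx.nrm_eq_zero[of "\<zero>\<^bsub>Hom A x x\<^esub>"]
      xy.nrm_eq_zero[OF assms(3)] by simp
qed

lemma positive_star_self:
  assumes "x \<in> Ob A" "y \<in> Ob A" "a \<in> carrier (Hom A x y)"
  shows "positive_arrow A x (cmp A x y x (star A x y a) a)"
  using assms star_self_spectrum[OF assms]
  by (simp add: positive_arrow_def star_cmp star_star)

end

section \<open>Resolvents in the minimal unitization\<close>

context cstar_category
begin

context
  fixes x assumes x: "x \<in> Ob A"
begin

interpretation B: normed_complex_space "Hom A x x" "hnorm A x x"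
  by (rule hom_normed_space[OF x x])

private abbreviation (input) "B \<equiv> Hom A x x"
private abbreviation (input) "U \<equiv> min_unitization A x"
private abbreviation (input) "mul \<equiv> cmp A x x x"
private abbreviation (input) "N \<equiv> hnorm A x x"

text \<open>
  Test against \<open>b = c\<^sup>*\<close> and use the \<open>C\<^sup>*\<close>-identity.
\<close>

lemma left_zero:
  assumes c: "c \<in> carrier B" and zero: "\<And>b. b \<in> carrier B \<Longrightarrow> mul c b = \<zero>\<^bsub>B\<^esub>"
  shows "c = \<zero>\<^bsub>B\<^esub>"
proof -
  have "star A x x c = \<zero>\<^bsub>B\<^esub>"
    by (rule star_self_eq_zero) (use c x zero star_star[OF x x c] in simp_all)
  then show ?thesis
    using star_star[OF x x c] semilinear_zero[OF star_conj_linear[OF x x]] B.vector_space by simp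
qed

text \<open>
  The unitization acts on the algebra by left multiplication.  Its product becomes composition and
  its unit the identity, whether or not the algebra is unital, so spectral statements about it can
  be read off from this action without distinguishing the two cases.
\<close>

private definition uact :: "'a \<times> complex \<Rightarrow> 'a \<Rightarrow> 'a" where
  "uact w b = mul (fst w) b \<oplus>\<^bsub>B\<^esub> snd w \<odot>\<^bsub>B\<^esub> b"

private lemma U_carrier_fst: "w \<in> carrier U \<Longrightarrow> fst w \<in> carrier B"
  by (auto simp: min_unitization_def Let_def split: if_splits)

private lemma uact_closed: "\<lbrakk>w \<in> carrier U; b \<in> carrier B\<rbrakk> \<Longrightarrow> uact w b \<in> carrier B"
  using U_carrier_fst x by (simp add: uact_def)

private lemma uact_mult:
  assumes "w \<in> carrier U" "v \<in> carrier U" "b \<in> carrier B"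
  shows "uact (w \<otimes>\<^bsub>U\<^esub> v) b = uact w (uact v b)"
proof -
  obtain a s where w: "w = (a, s)" by fastforce
  obtain c t where v: "v = (c, t)" by fastforce
  have cl: "a \<in> carrier B" "c \<in> carrier B" "b \<in> carrier B"
    using assms U_carrier_fst[of w] U_carrier_fst[of v] by (simp_all add: w v)
  have "uact (w \<otimes>\<^bsub>U\<^esub> v) b =
      (mul a (mul c b) \<oplus>\<^bsub>B\<^esub> (s \<odot>\<^bsub>B\<^esub> mul c b \<oplus>\<^bsub>B\<^esub> t \<odot>\<^bsub>B\<^esub> mul a b)) \<oplus>\<^bsub>B\<^esub> (s * t) \<odot>\<^bsub>B\<^esub> b"
    using cl x by (simp add: uact_def w v min_unitization_def Let_def cmp_add_left cmp_scale_left cmp_assoc)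
  also have "\<dots> = (mul a (mul c b) \<oplus>\<^bsub>B\<^esub> t \<odot>\<^bsub>B\<^esub> mul a b) \<oplus>\<^bsub>B\<^esub> s \<odot>\<^bsub>B\<^esub> (mul c b \<oplus>\<^bsub>B\<^esub> t \<odot>\<^bsub>B\<^esub> b)"
    by (rule B.lincomb_eqI[of "[mul a (mul c b), mul c b, mul a b, b]"], (rule B.lincomb_intros)+)
      (use cl x in simp_all)
  also have "\<dots> = uact w (uact v b)"
    using cl x by (simp add: uact_def w v cmp_add_right cmp_scale_right)
  finally show ?thesis .
qed

private lemma one_U: "\<one>\<^bsub>U\<^esub> \<in> carrier U"
  and uact_one: "b \<in> carrier B \<Longrightarrow> uact \<one>\<^bsub>U\<^esub> b = b"
proof -
  have "\<one>\<^bsub>U\<^esub> \<in> carrier U \<and> (\<forall>b\<in>carrier B. uact \<one>\<^bsub>U\<^esub> b = b)"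
  proof (cases "\<exists>u. is_unit_of A x u")
    case True
    then obtain u where u: "is_unit_of A x u" by blast
    have "(THE u. is_unit_of A x u) = u"
      using u by (rule the_equality) (use u in \<open>unfold is_unit_of_def, metis\<close>)
    then have "\<one>\<^bsub>U\<^esub> = (u, 0)" using True by (simp add: min_unitization_def Let_def)
    then show ?thesis
      using u True by (auto simp: min_unitization_def Let_def is_unit_of_def uact_def)
  next
    case False
    have z: "mul \<zero>\<^bsub>B\<^esub> b = \<zero>\<^bsub>B\<^esub>" if "b \<in> carrier B" for b
      using semilinear_zero[OF cmp_linear_left[OF x x x that]] B.vector_space by simp
    show ?thesis
      using False by (auto simp: min_unitization_def Let_def uact_def z)
  qed
  then show "\<one>\<^bsub>U\<^esub> \<in> carrier U" "b \<in> carrier B \<Longrightarrow> uact \<one>\<^bsub>U\<^esub> b = b" by auto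
qed

private lemma uact_shift:
  fixes \<zeta> :: complex
  assumes a: "a \<in> carrier B"
  defines "w \<equiv> (a, 0) \<ominus>\<^bsub>U\<^esub> (\<zeta> \<odot>\<^bsub>U\<^esub> \<one>\<^bsub>U\<^esub>)"
  shows "w \<in> carrier U"
    and "b \<in> carrier B \<Longrightarrow> uact w b = mul a b \<oplus>\<^bsub>B\<^esub> (- \<zeta>) \<odot>\<^bsub>B\<^esub> b"
proof -
  obtain u t where ut: "\<one>\<^bsub>U\<^esub> = (u, t)" by fastforce
  have u: "u \<in> carrier B" using U_carrier_fst[OF one_U] by (simp add: ut)
  have smult: "\<zeta> \<odot>\<^bsub>U\<^esub> \<one>\<^bsub>U\<^esub> = (\<zeta> \<odot>\<^bsub>B\<^esub> u, \<zeta> * t)"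
    unfolding ut by (simp add: min_unitization_def Let_def)
  have inv: "\<ominus>\<^bsub>U\<^esub> (\<zeta> \<odot>\<^bsub>B\<^esub> u, \<zeta> * t) = ((- \<zeta>) \<odot>\<^bsub>B\<^esub> u, - \<zeta> * t)"
    unfolding a_inv_def m_inv_def
  proof (rule the_equality)
    have "\<zeta> \<odot>\<^bsub>B\<^esub> u \<oplus>\<^bsub>B\<^esub> (- \<zeta>) \<odot>\<^bsub>B\<^esub> u = \<zero>\<^bsub>B\<^esub>" "(- \<zeta>) \<odot>\<^bsub>B\<^esub> u \<oplus>\<^bsub>B\<^esub> \<zeta> \<odot>\<^bsub>B\<^esub> u = \<zero>\<^bsub>B\<^esub>"
      using B.scale_add_left[OF u, of \<zeta> "- \<zeta>"] B.scale_add_left[OF u, of "- \<zeta>" \<zeta>] u by simp_all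
    then show "((- \<zeta>) \<odot>\<^bsub>B\<^esub> u, - \<zeta> * t) \<in> carrier (add_monoid U) \<and>
        (\<zeta> \<odot>\<^bsub>B\<^esub> u, \<zeta> * t) \<otimes>\<^bsub>add_monoid U\<^esub> ((- \<zeta>) \<odot>\<^bsub>B\<^esub> u, - \<zeta> * t) = \<one>\<^bsub>add_monoid U\<^esub> \<and>
        ((- \<zeta>) \<odot>\<^bsub>B\<^esub> u, - \<zeta> * t) \<otimes>\<^bsub>add_monoid U\<^esub> (\<zeta> \<odot>\<^bsub>B\<^esub> u, \<zeta> * t) = \<one>\<^bsub>add_monoid U\<^esub>"
      using one_U u unfolding ut by (auto simp: min_unitization_def Let_def split: if_splits)
  next
    fix v assume v: "v \<in> carrier (add_monoid U) \<and>
        (\<zeta> \<odot>\<^bsub>B\<^esub> u, \<zeta> * t) \<otimes>\<^bsub>add_monoid U\<^esub> v = \<one>\<^bsub>add_monoid U\<^esub> \<and>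
        v \<otimes>\<^bsub>add_monoid U\<^esub> (\<zeta> \<odot>\<^bsub>B\<^esub> u, \<zeta> * t) = \<one>\<^bsub>add_monoid U\<^esub>"
    obtain c s where cs: "v = (c, s)" by fastforce
    have c: "c \<in> carrier B" "c \<oplus>\<^bsub>B\<^esub> \<zeta> \<odot>\<^bsub>B\<^esub> u = \<zero>\<^bsub>B\<^esub>" "\<zeta> * t + s = 0"
      using v by (auto simp: cs min_unitization_def Let_def split: if_splits)
    then have "c = \<ominus>\<^bsub>B\<^esub> (\<zeta> \<odot>\<^bsub>B\<^esub> u)"
      using B.add_group.minus_equality[of c "\<zeta> \<odot>\<^bsub>B\<^esub> u"] u by simp
    also have "\<dots> = (- \<zeta>) \<odot>\<^bsub>B\<^esub> u" using u by (simp add: B.minus_eq_scale B.scale_scale)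
    finally show "v = ((- \<zeta>) \<odot>\<^bsub>B\<^esub> u, - \<zeta> * t)" using c(3) by (simp add: cs add_eq_0_iff)
  qed
  have w: "w = (a \<oplus>\<^bsub>B\<^esub> (- \<zeta>) \<odot>\<^bsub>B\<^esub> u, - \<zeta> * t)"
    unfolding w_def a_minus_def smult inv by (simp add: min_unitization_def Let_def)
  show "w \<in> carrier U"
    using one_U u a unfolding w ut by (auto simp: min_unitization_def Let_def split: if_splits)
  show "uact w b = mul a b \<oplus>\<^bsub>B\<^esub> (- \<zeta>) \<odot>\<^bsub>B\<^esub> b" if b: "b \<in> carrier B"
  proof -
    have "uact w b = (mul a b \<oplus>\<^bsub>B\<^esub> (- \<zeta>) \<odot>\<^bsub>B\<^esub> mul u b) \<oplus>\<^bsub>B\<^esub> (- \<zeta> * t) \<odot>\<^bsub>B\<^esub> b"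
      using u a b x by (simp add: w uact_def cmp_add_left cmp_scale_left)
    also have "\<dots> = mul a b \<oplus>\<^bsub>B\<^esub> (- \<zeta>) \<odot>\<^bsub>B\<^esub> (mul u b \<oplus>\<^bsub>B\<^esub> t \<odot>\<^bsub>B\<^esub> b)"
      by (rule B.lincomb_eqI[of "[mul a b, mul u b, b]"], (rule B.lincomb_intros)+)
        (use a u b x in simp_all)
    also have "mul u b \<oplus>\<^bsub>B\<^esub> t \<odot>\<^bsub>B\<^esub> b = b" using uact_one[OF b] by (simp add: ut uact_def)
    finally show ?thesis .
  qed
qed

lemma resolvent_arrow:
  assumes a: "a \<in> carrier B" and \<zeta>: "\<zeta> \<notin> endo_spectrum A x a"
  obtains d s where "d \<in> carrier B"
    and "\<And>b k. \<lbrakk>b \<in> carrier B; k = mul d b \<oplus>\<^bsub>B\<^esub> s \<odot>\<^bsub>B\<^esub> b\<rbrakk>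
          \<Longrightarrow> mul a k \<oplus>\<^bsub>B\<^esub> (- \<zeta>) \<odot>\<^bsub>B\<^esub> k = b"
    and "\<And>b k. \<lbrakk>b \<in> carrier B; k = mul a b \<oplus>\<^bsub>B\<^esub> (- \<zeta>) \<odot>\<^bsub>B\<^esub> b\<rbrakk>
          \<Longrightarrow> mul d k \<oplus>\<^bsub>B\<^esub> s \<odot>\<^bsub>B\<^esub> k = b"
proof -
  define w where "w = (a, 0) \<ominus>\<^bsub>U\<^esub> (\<zeta> \<odot>\<^bsub>U\<^esub> \<one>\<^bsub>U\<^esub>)"
  have w: "w \<in> carrier U" using uact_shift(1)[OF a] by (simp add: w_def)
  have "w \<in> Units U" using \<zeta> by (simp add: endo_spectrum_def alg_spectrum_def w_def)
  then obtain v where v: "v \<in> carrier U" "v \<otimes>\<^bsub>U\<^esub> w = \<one>\<^bsub>U\<^esub>" "w \<otimes>\<^bsub>U\<^esub> v = \<one>\<^bsub>U\<^esub>"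
    by (auto simp: Units_def)
  show ?thesis
  proof (rule that[of "fst v" "snd v"])
    show "fst v \<in> carrier B" using U_carrier_fst[OF v(1)] .
    show "mul a k \<oplus>\<^bsub>B\<^esub> (- \<zeta>) \<odot>\<^bsub>B\<^esub> k = b"
      if b: "b \<in> carrier B" and k: "k = mul (fst v) b \<oplus>\<^bsub>B\<^esub> snd v \<odot>\<^bsub>B\<^esub> b" for b k
    proof -
      have k: "k = uact v b" using k by (simp add: uact_def)
      have "uact w k = b"
        unfolding k uact_mult[OF w v(1) b, symmetric] v(3) by (rule uact_one[OF b])
      then show ?thesis
        using uact_shift(2)[OF a uact_closed[OF v(1) b], of \<zeta>] by (simp add: w_def k)
    qed
    show "mul (fst v) k \<oplus>\<^bsub>B\<^esub> snd v \<odot>\<^bsub>B\<^esub> k = b"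
      if b: "b \<in> carrier B" and k: "k = mul a b \<oplus>\<^bsub>B\<^esub> (- \<zeta>) \<odot>\<^bsub>B\<^esub> b" for b k
    proof -
      have k: "k = uact w b" using k uact_shift(2)[OF a b, of \<zeta>] by (simp add: w_def)
      have "uact v k = b"
        unfolding k uact_mult[OF v(1) w b, symmetric] v(2) by (rule uact_one[OF b])
      then show ?thesis by (simp add: uact_def)
    qed
  qed
qed

section \<open>Norm estimates for positive arrows\<close>

text \<open>
  The operator \<open>h = \<alpha> + \<beta>a\<close> has real spectrum contained in \<open>{\<alpha> + \<beta>\<zeta> | \<zeta> \<ge> 0}\<close>, so its norm is at
  most \<open>\<tau>\<close> once the points of this half-line outside \<open>[-\<tau>, \<tau>]\<close> are seen not to be approximate
  eigenvalues.  In the proof \<open>1 + \<kappa>h\<close> is rewritten as \<open>\<kappa>\<beta>(a - \<zeta>)\<close>.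
\<close>

lemma positive_operator_bound:
  fixes \<alpha> \<beta> \<tau> :: real
  assumes a: "positive_arrow A x a" and "\<beta> \<noteq> 0" and "0 \<le> \<tau>"
    and below: "\<And>\<zeta>. \<lbrakk>0 \<le> \<zeta>; \<tau> < \<bar>\<alpha> + \<beta> * \<zeta>\<bar>\<rbrakk> \<Longrightarrow>
        \<exists>m>0. \<forall>b\<in>carrier B. m * N b \<le> N (mul a b \<oplus>\<^bsub>B\<^esub> (- of_real \<zeta>) \<odot>\<^bsub>B\<^esub> b)"
    and b: "b \<in> carrier B"
  shows "N (of_real \<alpha> \<odot>\<^bsub>B\<^esub> b \<oplus>\<^bsub>B\<^esub> of_real \<beta> \<odot>\<^bsub>B\<^esub> mul a b) \<le> \<tau> * N b"
proof -
  define h where "h b = of_real \<alpha> \<odot>\<^bsub>B\<^esub> b \<oplus>\<^bsub>B\<^esub> of_real \<beta> \<odot>\<^bsub>B\<^esub> mul a b" for b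
  have aB: "a \<in> carrier B" "star A x x a = a"
    and spec: "\<And>\<zeta>. \<zeta> \<notin> of_real ` {0..} \<Longrightarrow> \<zeta> \<notin> endo_spectrum A x a"
    using a by (auto simp: positive_arrow_def)
  have h_closed: "h b \<in> carrier B" if "b \<in> carrier B" for b
    using that aB x by (simp add: h_def)
  have h: "linear_map B B h"
    unfolding semilinear_def
  proof (intro conjI ballI allI)
    show "h \<in> carrier B \<rightarrow> carrier B" using h_closed by blast
    fix u v c assume u: "u \<in> carrier B"
    then show "h (c \<odot>\<^bsub>B\<^esub> u) = c \<odot>\<^bsub>B\<^esub> h u"
      using aB x by (simp add: h_def cmp_scale_right B.scale_scale B.scale_add_right mult.commute)
    assume v: "v \<in> carrier B"
    have "h (u \<oplus>\<^bsub>B\<^esub> v) = of_real \<alpha> \<odot>\<^bsub>B\<^esub> (u \<oplus>\<^bsub>B\<^esub> v) \<oplus>\<^bsub>B\<^esub> of_real \<beta> \<odot>\<^bsub>B\<^esub> (mul a u \<oplus>\<^bsub>B\<^esub> mul a v)"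
      using aB x u v by (simp add: h_def cmp_add_right)
    also have "\<dots> = h u \<oplus>\<^bsub>B\<^esub> h v"
      unfolding h_def
      by (rule B.lincomb_eqI[of "[u, v, mul a u, mul a v]"], (rule B.lincomb_intros)+)
        (use u v aB x in simp_all)
    finally show "h (u \<oplus>\<^bsub>B\<^esub> v) = h u \<oplus>\<^bsub>B\<^esub> h v" .
  qed
  have hC: "N (h c) \<le> (\<bar>\<alpha>\<bar> + \<bar>\<beta>\<bar> * N a) * N c" if c: "c \<in> carrier B" for c
  proof -
    have "N (h c) \<le> \<bar>\<alpha>\<bar> * N c + \<bar>\<beta>\<bar> * N (mul a c)"
      using B.nrm_add[of "of_real \<alpha> \<odot>\<^bsub>B\<^esub> c" "of_real \<beta> \<odot>\<^bsub>B\<^esub> mul a c"] c aB x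
      by (simp add: h_def B.nrm_scale)
    also have "\<dots> \<le> \<bar>\<alpha>\<bar> * N c + \<bar>\<beta>\<bar> * (N a * N c)"
      by (intro add_left_mono mult_left_mono cmp_norm) (use c aB x in auto)
    finally show ?thesis by (simp add: algebra_simps)
  qed
  have shift: "g \<oplus>\<^bsub>B\<^esub> \<kappa> \<odot>\<^bsub>B\<^esub> h g = (\<kappa> * of_real \<beta>) \<odot>\<^bsub>B\<^esub> (mul a g \<oplus>\<^bsub>B\<^esub> (- \<zeta>) \<odot>\<^bsub>B\<^esub> g)"
    if g: "g \<in> carrier B" and "\<kappa> \<noteq> 0" and \<zeta>: "\<zeta> = - (1 / \<kappa> + of_real \<alpha>) / of_real \<beta>" for g \<kappa> \<zeta>
  proof -
    have key: "1 + \<kappa> * of_real \<alpha> = - (\<kappa> * of_real \<beta> * \<zeta>)"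
      using \<open>\<kappa> \<noteq> 0\<close> \<open>\<beta> \<noteq> 0\<close> unfolding \<zeta> by (simp add: right_diff_distrib)
    show ?thesis
      unfolding h_def
      by (rule B.lincomb_eqI[of "[g, mul a g]"], (rule B.lincomb_intros)+)
        (use g aB x key in simp_all)
  qed
  have "N (h b) \<le> \<tau> * N b"
  proof (rule B.operator_bound_of_resolvent[OF h hC \<open>0 \<le> \<tau>\<close>])
    fix \<kappa> b assume \<kappa>: "Im \<kappa> \<noteq> 0" and b: "b \<in> carrier B"
    then have \<kappa>0: "\<kappa> \<noteq> 0" by auto
    define \<zeta> where "\<zeta> = - (1 / \<kappa> + of_real \<alpha>) / of_real \<beta>"
    have "Im \<zeta> \<noteq> 0"
      using \<kappa> \<kappa>0 \<open>\<beta> \<noteq> 0\<close> by (simp add: \<zeta>_def Im_divide power2_eq_square complex_eq_iff)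
    then obtain d s where d: "d \<in> carrier B"
      and res: "\<And>b k. \<lbrakk>b \<in> carrier B; k = mul d b \<oplus>\<^bsub>B\<^esub> s \<odot>\<^bsub>B\<^esub> b\<rbrakk>
          \<Longrightarrow> mul a k \<oplus>\<^bsub>B\<^esub> (- \<zeta>) \<odot>\<^bsub>B\<^esub> k = b"
      using resolvent_arrow[OF aB(1) spec, of \<zeta>] by (metis Im_complex_of_real imageE)
    define b' where "b' = (1 / (\<kappa> * of_real \<beta>)) \<odot>\<^bsub>B\<^esub> b"
    define g where "g = mul d b' \<oplus>\<^bsub>B\<^esub> s \<odot>\<^bsub>B\<^esub> b'"
    have b': "b' \<in> carrier B" using b by (simp add: b'_def)
    then have g: "g \<in> carrier B" using d x by (simp add: g_def)
    have "g \<oplus>\<^bsub>B\<^esub> \<kappa> \<odot>\<^bsub>B\<^esub> h g = (\<kappa> * of_real \<beta>) \<odot>\<^bsub>B\<^esub> b'"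
      using shift[OF g \<kappa>0 \<zeta>_def] res[OF b' g_def] by simp
    also have "\<dots> = b" using b \<kappa>0 \<open>\<beta> \<noteq> 0\<close> by (simp add: b'_def B.scale_scale)
    finally show "\<exists>g\<in>carrier B. g \<oplus>\<^bsub>B\<^esub> \<kappa> \<odot>\<^bsub>B\<^esub> h g = b" using g by blast
  next
    fix \<kappa> assume \<kappa>: "cmod \<kappa> * \<tau> < 1" and \<kappa>0: "\<kappa> \<noteq> 0"
    define \<zeta> where "\<zeta> = - (1 / \<kappa> + of_real \<alpha>) / of_real \<beta>"
    have "\<exists>m>0. \<forall>b\<in>carrier B. m * N b \<le> N (mul a b \<oplus>\<^bsub>B\<^esub> (- \<zeta>) \<odot>\<^bsub>B\<^esub> b)"
    proof (cases "\<zeta> \<in> of_real ` {0..}")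
      case True
      then obtain r where r: "0 \<le> r" "\<zeta> = of_real r" by auto
      have "of_real \<alpha> + of_real \<beta> * \<zeta> = - 1 / \<kappa>" using \<open>\<beta> \<noteq> 0\<close> by (simp add: \<zeta>_def field_simps)
      then have "cmod (of_real (\<alpha> + \<beta> * r)) = 1 / cmod \<kappa>" using r by (simp add: norm_divide)
      then have "cmod \<kappa> * \<bar>\<alpha> + \<beta> * r\<bar> = 1"
        using \<kappa>0 by (simp add: norm_of_real field_simps del: of_real_add of_real_mult)
      then have "cmod \<kappa> * \<tau> < cmod \<kappa> * \<bar>\<alpha> + \<beta> * r\<bar>" using \<kappa> by simp
      then have "\<tau> < \<bar>\<alpha> + \<beta> * r\<bar>" by (rule mult_left_less_imp_less) simp
      then show ?thesis using below[of r] r by simp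
    next
      case False
      obtain d s where d: "d \<in> carrier B"
        and res: "\<And>b k. \<lbrakk>b \<in> carrier B; k = mul a b \<oplus>\<^bsub>B\<^esub> (- \<zeta>) \<odot>\<^bsub>B\<^esub> b\<rbrakk>
          \<Longrightarrow> mul d k \<oplus>\<^bsub>B\<^esub> s \<odot>\<^bsub>B\<^esub> k = b"
        using resolvent_arrow[OF aB(1) spec[OF False]] by metis
      define M where "M = N d + cmod s + 1"
      have M: "0 < M" using B.nrm_nonneg[OF d] by (simp add: M_def add_nonneg_pos)
      have "1 / M * N b \<le> N (mul a b \<oplus>\<^bsub>B\<^esub> (- \<zeta>) \<odot>\<^bsub>B\<^esub> b)" if b: "b \<in> carrier B" for b
      proof -
        define k where "k = mul a b \<oplus>\<^bsub>B\<^esub> (- \<zeta>) \<odot>\<^bsub>B\<^esub> b"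
        have k: "k \<in> carrier B" using b aB x by (simp add: k_def)
        have "N b \<le> N (mul d k) + cmod s * N k"
          using B.nrm_add[of "mul d k" "s \<odot>\<^bsub>B\<^esub> k"] res[OF b k_def] d k x
          by (simp add: B.nrm_scale)
        also have "\<dots> \<le> N d * N k + cmod s * N k"
          using cmp_norm[of x x x d k] d k x by simp
        also have "\<dots> \<le> M * N k" using k by (simp add: M_def algebra_simps)
        finally show ?thesis using M by (simp add: k_def field_simps)
      qed
      then show ?thesis using M by (intro exI[of _ "1/M"]) simp
    qed
    then obtain m where m: "0 < m" "\<And>b. b \<in> carrier B \<Longrightarrow> m * N b \<le> N (mul a b \<oplus>\<^bsub>B\<^esub> (- \<zeta>) \<odot>\<^bsub>B\<^esub> b)"
      by blast
    have "cmod \<kappa> * \<bar>\<beta>\<bar> * m * N c \<le> N (c \<oplus>\<^bsub>B\<^esub> \<kappa> \<odot>\<^bsub>B\<^esub> h c)" if c: "c \<in> carrier B" for c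
      unfolding shift[OF c \<kappa>0 \<zeta>_def]
      using mult_left_mono[OF m(2)[OF c], of "cmod \<kappa> * \<bar>\<beta>\<bar>"] c aB x
      by (simp add: B.nrm_scale norm_mult mult_ac)
    moreover have "0 < cmod \<kappa> * \<bar>\<beta>\<bar> * m" using m \<kappa>0 \<open>\<beta> \<noteq> 0\<close> by simp
    ultimately show "\<exists>m>0. \<forall>c\<in>carrier B. m * N c \<le> N (c \<oplus>\<^bsub>B\<^esub> \<kappa> \<odot>\<^bsub>B\<^esub> h c)" by blast
  next
    fix n c assume c: "c \<in> carrier B"
    have sym: "mul (star A x x (h u)) v = mul (star A x x u) (h v)"
      if "u \<in> carrier B" "v \<in> carrier B" for u v
      using that aB x
      by (simp add: h_def star_add star_scale star_cmp cmp_add_left cmp_add_right cmp_scale_left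
          cmp_scale_right cmp_assoc)
    have cl: "(h ^^ n) u \<in> carrier B" if "u \<in> carrier B" for n u
      using semilinearD(1)[OF B.linear_map_funpow[OF h] that] .
    have symn: "mul (star A x x ((h ^^ n) u)) v = mul (star A x x u) ((h ^^ n) v)"
      if "u \<in> carrier B" "v \<in> carrier B" for u v n
      using that
    proof (induction n arbitrary: v)
      case (Suc n)
      then have "mul (star A x x (h ((h ^^ n) u))) v = mul (star A x x u) ((h ^^ n) (h v))"
        using sym cl h_closed by simp
      then show ?case using funpow_swap1[of h n v] by simp
    qed simp
    have "(N ((h ^^ n) c))\<^sup>2 = N (mul (star A x x c) ((h ^^ n) ((h ^^ n) c)))"
      using cstar_identity[OF x x cl[OF c, of n]] symn[OF c cl[OF c], of n n] by simp
    also have "(h ^^ n) ((h ^^ n) c) = (h ^^ (2 * n)) c" by (simp add: mult_2 funpow_add)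
    also have "N (mul (star A x x c) ((h ^^ (2 * n)) c)) \<le> N c * N ((h ^^ (2 * n)) c)"
      using cmp_norm[of x x x "star A x x c" "(h ^^ (2 * n)) c"] c cl x by (simp add: star_norm)
    finally show "(N ((h ^^ n) c))\<^sup>2 \<le> N c * N ((h ^^ (2 * n)) c)" .
  qed (simp_all add: b)
  then show ?thesis by (simp add: h_def)
qed

text \<open>
  Positivity in terms of norms: \<open>\<parallel>t - q\<parallel> \<le> t\<close> for all large \<open>t\<close>, the norm being that of left
  multiplication.  Unlike the condition on the spectrum, this one is visibly preserved by sums.
\<close>

definition accretive :: "'a \<Rightarrow> bool" where
  "accretive q \<longleftrightarrow> q \<in> carrier B \<and> (\<exists>t0\<ge>0. \<forall>t\<ge>t0. \<forall>b\<in>carrier B.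
     N (of_real t \<odot>\<^bsub>B\<^esub> b \<oplus>\<^bsub>B\<^esub> (- 1) \<odot>\<^bsub>B\<^esub> mul q b) \<le> t * N b)"

lemma accretive_closed: "accretive q \<Longrightarrow> q \<in> carrier B"
  by (simp add: accretive_def)

text \<open>
  For \<open>t \<ge> \<parallel>a\<parallel>\<close>, a point \<open>\<zeta> \<ge> 0\<close> with \<open>t < \<bar>t - \<zeta>\<bar>\<close> exceeds \<open>\<parallel>a\<parallel>\<close> and is no approximate eigenvalue
  of \<open>a\<close>.
\<close>

lemma accretive_positive:
  assumes a: "positive_arrow A x a"
  shows "accretive a"
proof -
  have aB: "a \<in> carrier B" using a by (simp add: positive_arrow_def)
  have "N (of_real t \<odot>\<^bsub>B\<^esub> b \<oplus>\<^bsub>B\<^esub> of_real (- 1) \<odot>\<^bsub>B\<^esub> mul a b) \<le> t * N b"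
    if t: "N a \<le> t" and b: "b \<in> carrier B" for t b
  proof (rule positive_operator_bound[OF a _ _ _ b])
    have t0: "0 \<le> t" using t B.nrm_nonneg[OF aB] by linarith
    then show "0 \<le> t" .
    fix \<zeta> :: real assume \<zeta>: "0 \<le> \<zeta>" "t < \<bar>t + - 1 * \<zeta>\<bar>"
    then have "N a < \<zeta>" using t t0 by linarith
    moreover have "(\<zeta> - N a) * N b \<le> N (mul a b \<oplus>\<^bsub>B\<^esub> (- of_real \<zeta>) \<odot>\<^bsub>B\<^esub> b)"
      if b: "b \<in> carrier B" for b
    proof -
      have "N ((- of_real \<zeta>) \<odot>\<^bsub>B\<^esub> b) - N (mul a b) \<le> N (mul a b \<oplus>\<^bsub>B\<^esub> (- of_real \<zeta>) \<odot>\<^bsub>B\<^esub> b)"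
        using B.nrm_add_ge[of "(- of_real \<zeta>) \<odot>\<^bsub>B\<^esub> b" "mul a b"] b aB x
        by (simp add: B.add_group.a_comm)
      moreover have "N ((- of_real \<zeta>) \<odot>\<^bsub>B\<^esub> b) = \<zeta> * N b" using b \<zeta> by (simp add: B.nrm_scale)
      moreover have "N (mul a b) \<le> N a * N b" using cmp_norm aB b x by simp
      ultimately show ?thesis by (simp add: algebra_simps)
    qed
    ultimately show "\<exists>m>0. \<forall>b\<in>carrier B. m * N b \<le> N (mul a b \<oplus>\<^bsub>B\<^esub> (- of_real \<zeta>) \<odot>\<^bsub>B\<^esub> b)"
      by (intro exI[of _ "\<zeta> - N a"]) simp
  qed simp
  then show ?thesis
    using aB unfolding accretive_def by (intro conjI exI[of _ "N a"]) auto
qed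

lemma accretive_zero: "accretive \<zero>\<^bsub>B\<^esub>"
proof -
  have "mul \<zero>\<^bsub>B\<^esub> b = \<zero>\<^bsub>B\<^esub>" if "b \<in> carrier B" for b
    using semilinear_zero[OF cmp_linear_left[OF x x x that]] B.vector_space by simp
  then show ?thesis by (auto simp: accretive_def B.nrm_scale intro!: exI[of _ 0])
qed

lemma accretive_add:
  assumes "accretive p" "accretive q"
  shows "accretive (p \<oplus>\<^bsub>B\<^esub> q)"
proof -
  obtain s where s: "0 \<le> s" "\<And>t b. \<lbrakk>s \<le> t; b \<in> carrier B\<rbrakk>
      \<Longrightarrow> N (of_real t \<odot>\<^bsub>B\<^esub> b \<oplus>\<^bsub>B\<^esub> (- 1) \<odot>\<^bsub>B\<^esub> mul p b) \<le> t * N b"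
    using assms(1) by (auto simp: accretive_def)
  obtain r where r: "0 \<le> r" "\<And>t b. \<lbrakk>r \<le> t; b \<in> carrier B\<rbrakk>
      \<Longrightarrow> N (of_real t \<odot>\<^bsub>B\<^esub> b \<oplus>\<^bsub>B\<^esub> (- 1) \<odot>\<^bsub>B\<^esub> mul q b) \<le> t * N b"
    using assms(2) by (auto simp: accretive_def)
  have pq: "p \<in> carrier B" "q \<in> carrier B" using assms by (auto simp: accretive_def)
  have "N (of_real t \<odot>\<^bsub>B\<^esub> b \<oplus>\<^bsub>B\<^esub> (- 1) \<odot>\<^bsub>B\<^esub> mul (p \<oplus>\<^bsub>B\<^esub> q) b) \<le> t * N b"
    if t: "s + r \<le> t" and b: "b \<in> carrier B" for t b
  proof -
    have "of_real t \<odot>\<^bsub>B\<^esub> b \<oplus>\<^bsub>B\<^esub> (- 1) \<odot>\<^bsub>B\<^esub> mul (p \<oplus>\<^bsub>B\<^esub> q) b =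
        of_real t \<odot>\<^bsub>B\<^esub> b \<oplus>\<^bsub>B\<^esub> (- 1) \<odot>\<^bsub>B\<^esub> (mul p b \<oplus>\<^bsub>B\<^esub> mul q b)"
      using pq b x by (simp add: cmp_add_left)
    also have "\<dots> = (of_real s \<odot>\<^bsub>B\<^esub> b \<oplus>\<^bsub>B\<^esub> (- 1) \<odot>\<^bsub>B\<^esub> mul p b) \<oplus>\<^bsub>B\<^esub>
        (of_real (t - s) \<odot>\<^bsub>B\<^esub> b \<oplus>\<^bsub>B\<^esub> (- 1) \<odot>\<^bsub>B\<^esub> mul q b)"
      by (rule B.lincomb_eqI[of "[b, mul p b, mul q b]"], (rule B.lincomb_intros)+)
        (use pq b x in simp_all)
    finally have "N (of_real t \<odot>\<^bsub>B\<^esub> b \<oplus>\<^bsub>B\<^esub> (- 1) \<odot>\<^bsub>B\<^esub> mul (p \<oplus>\<^bsub>B\<^esub> q) b) \<le>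
        N (of_real s \<odot>\<^bsub>B\<^esub> b \<oplus>\<^bsub>B\<^esub> (- 1) \<odot>\<^bsub>B\<^esub> mul p b) +
        N (of_real (t - s) \<odot>\<^bsub>B\<^esub> b \<oplus>\<^bsub>B\<^esub> (- 1) \<odot>\<^bsub>B\<^esub> mul q b)"
      using B.nrm_add pq b x by simp
    also have "\<dots> \<le> s * N b + (t - s) * N b"
      using s(2)[OF order.refl b] r(2)[OF _ b, of "t - s"] t by (intro add_mono) simp_all
    finally show ?thesis by (simp add: algebra_simps)
  qed
  then show ?thesis
    using pq s r unfolding accretive_def by (intro conjI exI[of _ "s + r"]) auto
qed

lemma accretive_scale:
  assumes q: "accretive q" and c: "0 \<le> c"
  shows "accretive (of_real c \<odot>\<^bsub>B\<^esub> q)"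
proof (cases "c = 0")
  case True
  then show ?thesis using accretive_zero accretive_closed[OF q] by simp
next
  case False
  then have c: "0 < c" using c by simp
  have qB: "q \<in> carrier B" using accretive_closed[OF q] .
  obtain r where r: "0 \<le> r" "\<And>t b. \<lbrakk>r \<le> t; b \<in> carrier B\<rbrakk>
      \<Longrightarrow> N (of_real t \<odot>\<^bsub>B\<^esub> b \<oplus>\<^bsub>B\<^esub> (- 1) \<odot>\<^bsub>B\<^esub> mul q b) \<le> t * N b"
    using q by (auto simp: accretive_def)
  have "N (of_real t \<odot>\<^bsub>B\<^esub> b \<oplus>\<^bsub>B\<^esub> (- 1) \<odot>\<^bsub>B\<^esub> mul (of_real c \<odot>\<^bsub>B\<^esub> q) b) \<le> t * N b"
    if t: "c * r \<le> t" and b: "b \<in> carrier B" for t b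
  proof -
    have "of_real t \<odot>\<^bsub>B\<^esub> b \<oplus>\<^bsub>B\<^esub> (- 1) \<odot>\<^bsub>B\<^esub> mul (of_real c \<odot>\<^bsub>B\<^esub> q) b =
        of_real t \<odot>\<^bsub>B\<^esub> b \<oplus>\<^bsub>B\<^esub> (- 1) \<odot>\<^bsub>B\<^esub> (of_real c \<odot>\<^bsub>B\<^esub> mul q b)"
      using qB b x by (simp add: cmp_scale_left)
    also have "\<dots> = of_real c \<odot>\<^bsub>B\<^esub> (of_real (t / c) \<odot>\<^bsub>B\<^esub> b \<oplus>\<^bsub>B\<^esub> (- 1) \<odot>\<^bsub>B\<^esub> mul q b)"
      by (rule B.lincomb_eqI[of "[b, mul q b]"], (rule B.lincomb_intros)+)
        (use qB b x c in simp_all)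
    finally have "N (of_real t \<odot>\<^bsub>B\<^esub> b \<oplus>\<^bsub>B\<^esub> (- 1) \<odot>\<^bsub>B\<^esub> mul (of_real c \<odot>\<^bsub>B\<^esub> q) b) =
        c * N (of_real (t / c) \<odot>\<^bsub>B\<^esub> b \<oplus>\<^bsub>B\<^esub> (- 1) \<odot>\<^bsub>B\<^esub> mul q b)"
      using qB b x c by (simp add: B.nrm_scale)
    also have "\<dots> \<le> c * (t / c * N b)"
      using r(2)[OF _ b, of "t / c"] t c by (intro mult_left_mono) (auto simp: field_simps)
    finally show ?thesis using c by simp
  qed
  then show ?thesis
    using qB c r unfolding accretive_def by (intro conjI exI[of _ "c * r"]) auto
qed

lemma accretive_finsum:
  "(\<And>i. i < (n::nat) \<Longrightarrow> accretive (q i)) \<Longrightarrow> accretive (finsum B q {..<n})"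
proof (induction n)
  case (Suc n)
  then have "q \<in> {..<n} \<rightarrow> carrier B" "q n \<in> carrier B"
    using accretive_closed by (auto simp: Pi_def)
  then show ?case
    using Suc by (simp add: lessThan_Suc B.add_group.finsum_insert accretive_add)
qed (simp add: accretive_zero)

text \<open>
  The monotonicity of the norm.  With \<open>\<sigma> = \<parallel>p + q\<parallel>\<close>, accretivity of \<open>q\<close> gives \<open>\<parallel>t + p\<parallel> \<le> t + \<sigma>\<close> for
  some \<open>t\<close>, so that no \<open>\<zeta> > \<sigma>\<close> is an approximate eigenvalue of \<open>p\<close>.  The spectral radius formula
  yields \<open>\<parallel>p\<^sup>2\<parallel> \<le> \<sigma>\<parallel>p\<parallel>\<close>, which is \<open>\<parallel>p\<parallel> \<le> \<sigma>\<close> by the \<open>C\<^sup>*\<close>-identity.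
\<close>

lemma norm_positive_le:
  assumes p: "positive_arrow A x p" and q: "accretive q"
  shows "N p \<le> N (p \<oplus>\<^bsub>B\<^esub> q)"
proof -
  have cl: "p \<in> carrier B" "q \<in> carrier B"
    using p q by (auto simp: positive_arrow_def accretive_def)
  obtain t where t: "0 \<le> t" "\<And>b. b \<in> carrier B
      \<Longrightarrow> N (of_real t \<odot>\<^bsub>B\<^esub> b \<oplus>\<^bsub>B\<^esub> (- 1) \<odot>\<^bsub>B\<^esub> mul q b) \<le> t * N b"
    using q by (auto simp: accretive_def)
  have tri: "N (u \<oplus>\<^bsub>B\<^esub> (v \<oplus>\<^bsub>B\<^esub> w)) \<le> N u + (N v + N w)"
    if "u \<in> carrier B" "v \<in> carrier B" "w \<in> carrier B" for u v w
    using B.nrm_add[of u "v \<oplus>\<^bsub>B\<^esub> w"] B.nrm_add[of v w] that by simp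
  define \<sigma> where "\<sigma> = N (p \<oplus>\<^bsub>B\<^esub> q)"
  have "N (of_real 0 \<odot>\<^bsub>B\<^esub> p \<oplus>\<^bsub>B\<^esub> of_real 1 \<odot>\<^bsub>B\<^esub> mul p p) \<le> \<sigma> * N p"
  proof (rule positive_operator_bound[OF p _ _ _ cl(1)])
    show "0 \<le> \<sigma>" using cl by (simp add: \<sigma>_def)
    fix \<zeta> :: real assume \<zeta>: "0 \<le> \<zeta>" "\<sigma> < \<bar>0 + 1 * \<zeta>\<bar>"
    have "(\<zeta> - \<sigma>) * N b \<le> N (mul p b \<oplus>\<^bsub>B\<^esub> (- of_real \<zeta>) \<odot>\<^bsub>B\<^esub> b)" if b: "b \<in> carrier B" for b
    proof -
      have "of_real (\<zeta> + t) \<odot>\<^bsub>B\<^esub> b =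
          (of_real t \<odot>\<^bsub>B\<^esub> b \<oplus>\<^bsub>B\<^esub> (- 1) \<odot>\<^bsub>B\<^esub> mul q b) \<oplus>\<^bsub>B\<^esub> ((mul p b \<oplus>\<^bsub>B\<^esub> mul q b) \<oplus>\<^bsub>B\<^esub>
          (- 1) \<odot>\<^bsub>B\<^esub> (mul p b \<oplus>\<^bsub>B\<^esub> (- of_real \<zeta>) \<odot>\<^bsub>B\<^esub> b))"
        by (rule B.lincomb_eqI[of "[b, mul q b, mul p b]"], (rule B.lincomb_intros)+)
          (use cl b x in simp_all)
      then have "N (of_real (\<zeta> + t) \<odot>\<^bsub>B\<^esub> b) \<le>
          N (of_real t \<odot>\<^bsub>B\<^esub> b \<oplus>\<^bsub>B\<^esub> (- 1) \<odot>\<^bsub>B\<^esub> mul q b) + (N (mul p b \<oplus>\<^bsub>B\<^esub> mul q b) +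
          N ((- 1) \<odot>\<^bsub>B\<^esub> (mul p b \<oplus>\<^bsub>B\<^esub> (- of_real \<zeta>) \<odot>\<^bsub>B\<^esub> b)))"
        using tri cl b x by simp
      moreover have "N (of_real (\<zeta> + t) \<odot>\<^bsub>B\<^esub> b) = (\<zeta> + t) * N b"
        using \<zeta> t b by (simp add: B.nrm_scale del: of_real_add)
      moreover have "N (mul p b \<oplus>\<^bsub>B\<^esub> mul q b) \<le> \<sigma> * N b"
        using cmp_norm[of x x x "p \<oplus>\<^bsub>B\<^esub> q" b] cl b x by (simp add: \<sigma>_def cmp_add_left)
      moreover have "N ((- 1) \<odot>\<^bsub>B\<^esub> (mul p b \<oplus>\<^bsub>B\<^esub> (- of_real \<zeta>) \<odot>\<^bsub>B\<^esub> b)) =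
          N (mul p b \<oplus>\<^bsub>B\<^esub> (- of_real \<zeta>) \<odot>\<^bsub>B\<^esub> b)"
        using cl b x by (subst B.nrm_scale) simp_all
      ultimately show ?thesis using t(2)[OF b] by (simp add: algebra_simps)
    qed
    then show "\<exists>m>0. \<forall>b\<in>carrier B. m * N b \<le> N (mul p b \<oplus>\<^bsub>B\<^esub> (- of_real \<zeta>) \<odot>\<^bsub>B\<^esub> b)"
      using \<zeta> by (intro exI[of _ "\<zeta> - \<sigma>"]) simp
  qed simp
  then have "N (mul p p) \<le> \<sigma> * N p" using cl x by simp
  moreover have "N (mul p p) = N p * N p"
    using cstar_identity[OF x x cl(1)] p by (simp add: positive_arrow_def power2_eq_square)
  ultimately show ?thesis
    using B.nrm_nonneg[OF cl(1)] B.nrm_nonneg[of "p \<oplus>\<^bsub>B\<^esub> q"] cl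
    by (cases "N p = 0") (auto simp: \<sigma>_def mult_le_cancel_right)
qed

end

end

section \<open>Hilbert modules\<close>

context hilbert_module
begin

lemma fib_complex_space: "x \<in> Ob A \<Longrightarrow> complex_space (Fib E x)"
  by (rule complex_space.intro[OF fib_vector_space])

lemmas fib_add_closed [simp] = complex_space.add_closed[OF fib_complex_space]
lemmas fib_scale_closed [simp] = complex_space.scale_closed[OF fib_complex_space]

lemma act_closed [simp]:
  "\<lbrakk>x \<in> Ob A; y \<in> Ob A; e \<in> carrier (Fib E x); a \<in> carrier (Hom A y x)\<rbrakk>
   \<Longrightarrow> act E x y e a \<in> carrier (Fib E y)"
  using semilinearD(1)[OF act_linear_left] .

lemma ip_closed [simp]:
  "\<lbrakk>x \<in> Ob A; y \<in> Ob A; e \<in> carrier (Fib E y); f \<in> carrier (Fib E x)\<rbrakk>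
   \<Longrightarrow> ip E y x e f \<in> carrier (Hom A x y)"
  using semilinearD(1)[OF ip_linear_right] .

lemmas act_add_left = semilinearD(2)[OF act_linear_left]
lemmas act_scale_left = semilinearD(3)[OF act_linear_left]
lemmas act_add_right = semilinearD(2)[OF act_linear_right]
lemmas act_scale_right = semilinearD(3)[OF act_linear_right]
lemmas ip_add_right = semilinearD(2)[OF ip_linear_right]
lemmas ip_scale_right = semilinearD(3)[OF ip_linear_right]
lemmas ip_add_left = semilinearD(2)[OF ip_conj_linear_left]
lemmas ip_scale_left = semilinearD(3)[OF ip_conj_linear_left]

lemma ip_diff_right:
  assumes "x \<in> Ob A" "y \<in> Ob A" "e \<in> carrier (Fib E y)"
    "u \<in> carrier (Fib E x)" "v \<in> carrier (Fib E x)"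
  shows "ip E y x e (u \<ominus>\<^bsub>Fib E x\<^esub> v) = ip E y x e u \<ominus>\<^bsub>Hom A x y\<^esub> ip E y x e v"
  using semilinear_diff[OF ip_linear_right] hom_vector_space fib_vector_space assms by simp

lemma ip_act_left:
  assumes "x \<in> Ob A" "y \<in> Ob A" "z \<in> Ob A"
    "e \<in> carrier (Fib E y)" "f \<in> carrier (Fib E x)" "g \<in> carrier (Hom A z y)"
  shows "ip E z x (act E y z e g) f = cmp A x y z (star A z y g) (ip E y x e f)"
proof -
  have "ip E z x (act E y z e g) f = star A z x (ip E x z f (act E y z e g))"
    using assms ip_star[of x z "act E y z e g" f] by simp
  also have "\<dots> = star A z x (cmp A z y x (ip E x y f e) g)"
    using assms by (simp add: ip_act)
  also have "\<dots> = cmp A x y z (star A z y g) (star A y x (ip E x y f e))"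
    using assms by (simp add: star_cmp)
  also have "star A y x (ip E x y f e) = ip E y x e f"
    using assms ip_star[of x y e f] by simp
  finally show ?thesis .
qed

lemma fib_eqI:
  assumes "x \<in> Ob A" "u \<in> carrier (Fib E x)" "v \<in> carrier (Fib E x)"
    and eq: "\<And>f. f \<in> carrier (Fib E x) \<Longrightarrow> ip E x x f u = ip E x x f v"
  shows "u = v"
proof -
  interpret F: complex_space "Fib E x" by (rule fib_complex_space) fact
  interpret H: complex_space "Hom A x x" by (rule hom_complex_space) fact+
  have "u \<ominus>\<^bsub>Fib E x\<^esub> v = \<zero>\<^bsub>Fib E x\<^esub>"
  proof (rule ip_definite)
    show "ip E x x (u \<ominus>\<^bsub>Fib E x\<^esub> v) (u \<ominus>\<^bsub>Fib E x\<^esub> v) = \<zero>\<^bsub>Hom A x x\<^esub>"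
      using assms eq[of "u \<ominus>\<^bsub>Fib E x\<^esub> v"]
      by (simp add: ip_diff_right H.diff_self)
  qed (use assms in simp_all)
  then show ?thesis using F.eq_if_diff_zero assms by simp
qed

lemma positive_ip: "\<lbrakk>x \<in> Ob A; e \<in> carrier (Fib E x)\<rbrakk> \<Longrightarrow> accretive x (ip E x x e e)"
  by (rule accretive_positive[OF _ ip_positive])

lemma mnorm_square:
  assumes "x \<in> Ob A" "e \<in> carrier (Fib E x)"
  shows "(mnorm A E x e)\<^sup>2 = hnorm A x x (ip E x x e e)" "0 \<le> mnorm A E x e"
  using normed_complex_space.nrm_nonneg[OF hom_normed_space, of x x "ip E x x e e"] assms
  by (simp_all add: mnorm_def)

lemma mnorm_minus:
  assumes "x \<in> Ob A" "e \<in> carrier (Fib E x)"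
  shows "mnorm A E x (\<ominus>\<^bsub>Fib E x\<^esub> e) = mnorm A E x e"
proof -
  interpret F: complex_space "Fib E x" by (rule fib_complex_space) fact
  interpret H: complex_space "Hom A x x" by (rule hom_complex_space) fact+
  show ?thesis
    using assms by (simp add: mnorm_def F.minus_eq_scale ip_scale_left ip_scale_right H.scale_scale)
qed

section \<open>Adjoint pairs\<close>

definition adjoint_pair :: "('o \<Rightarrow> 'm \<Rightarrow> 'm) \<Rightarrow> ('o \<Rightarrow> 'm \<Rightarrow> 'm) \<Rightarrow> bool" where
  "adjoint_pair T S \<longleftrightarrow>
     (\<forall>x\<in>Ob A. T x \<in> carrier (Fib E x) \<rightarrow> carrier (Fib E x) \<and>
        S x \<in> carrier (Fib E x) \<rightarrow> carrier (Fib E x)) \<and>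
     (\<forall>x\<in>Ob A. \<forall>y\<in>Ob A. \<forall>e\<in>carrier (Fib E y). \<forall>f\<in>carrier (Fib E x).
        ip E y x (T y e) f = ip E y x e (S x f))"

lemma adjoint_pairD:
  assumes "adjoint_pair T S" "x \<in> Ob A"
  shows "e \<in> carrier (Fib E x) \<Longrightarrow> T x e \<in> carrier (Fib E x)"
    and "e \<in> carrier (Fib E x) \<Longrightarrow> S x e \<in> carrier (Fib E x)"
    and "\<lbrakk>y \<in> Ob A; e \<in> carrier (Fib E y); f \<in> carrier (Fib E x)\<rbrakk>
      \<Longrightarrow> ip E y x (T y e) f = ip E y x e (S x f)"
  using assms by (auto simp: adjoint_pair_def)

lemma adjoint_pair_commute:
  assumes "adjoint_pair T S"
  shows "adjoint_pair S T"
  unfolding adjoint_pair_def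
proof (intro conjI ballI)
  fix x y e f assume xy: "x \<in> Ob A" "y \<in> Ob A" and ef: "e \<in> carrier (Fib E y)" "f \<in> carrier (Fib E x)"
  have cl: "S y e \<in> carrier (Fib E y)" "T x f \<in> carrier (Fib E x)"
    using adjoint_pairD[OF assms] xy ef by simp_all
  have "ip E y x (S y e) f = star A y x (ip E x y f (S y e))"
    using ip_star[of x y "S y e" f] xy ef cl by simp
  also have "\<dots> = star A y x (ip E x y (T x f) e)"
    using adjoint_pairD(3)[OF assms, of y x f e] xy ef by simp
  also have "\<dots> = ip E y x e (T x f)" using ip_star[of x y e "T x f"] xy ef cl by simp
  finally show "ip E y x (S y e) f = ip E y x e (T x f)" .
qed (use adjoint_pairD[OF assms] in auto)

lemma adjoint_pair_compose:
  assumes T: "adjoint_pair T S" and T': "adjoint_pair T' S'"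
  shows "adjoint_pair (\<lambda>x e. T x (T' x e)) (\<lambda>x e. S' x (S x e))"
  unfolding adjoint_pair_def
  using adjoint_pairD[OF T] adjoint_pairD[OF T'] by simp

lemma adjoint_pair_id: "adjoint_pair (\<lambda>x e. e) (\<lambda>x e. e)"
  by (simp add: adjoint_pair_def)

text \<open>
  Definiteness of the inner product makes an adjoint linear and natural, so that checking the
  adjointness relation suffices for the operators below.
\<close>

lemma adjoint_pair_natural:
  assumes "adjoint_pair S T"
  shows "natural_transformation A E E T"
  unfolding natural_transformation_def semilinear_def
proof (intro conjI ballI allI)
  fix x assume x: "x \<in> Ob A"
  interpret F: complex_space "Fib E x" by (rule fib_complex_space[OF x])
  note D = adjoint_pairD[OF assms]
  show "T x \<in> carrier (Fib E x) \<rightarrow> carrier (Fib E x)" using D x by simp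
  fix u assume u: "u \<in> carrier (Fib E x)"
  show "T x (u \<oplus>\<^bsub>Fib E x\<^esub> v) = T x u \<oplus>\<^bsub>Fib E x\<^esub> T x v" if v: "v \<in> carrier (Fib E x)" for v
  proof (rule fib_eqI[OF x])
    fix f assume f: "f \<in> carrier (Fib E x)"
    show "ip E x x f (T x (u \<oplus>\<^bsub>Fib E x\<^esub> v)) = ip E x x f (T x u \<oplus>\<^bsub>Fib E x\<^esub> T x v)"
      using D x u v f by (simp add: ip_add_right D(3)[symmetric])
  qed (use D x u v in simp_all)
  show "T x (c \<odot>\<^bsub>Fib E x\<^esub> u) = c \<odot>\<^bsub>Fib E x\<^esub> T x u" for c
  proof (rule fib_eqI[OF x])
    fix f assume f: "f \<in> carrier (Fib E x)"
    show "ip E x x f (T x (c \<odot>\<^bsub>Fib E x\<^esub> u)) = ip E x x f (c \<odot>\<^bsub>Fib E x\<^esub> T x u)"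
      using D x u f by (simp add: ip_scale_right D(3)[symmetric])
  qed (use D x u in simp_all)
  fix y a assume y: "y \<in> Ob A" and a: "a \<in> carrier (Hom A y x)"
  show "T y (act E x y u a) = act E x y (T x u) a"
  proof (rule fib_eqI[OF y])
    fix f assume f: "f \<in> carrier (Fib E y)"
    show "ip E y y f (T y (act E x y u a)) = ip E y y f (act E x y (T x u) a)"
      using D[of x] D[of y] x y u a f by (simp add: ip_act[symmetric] D(3)[symmetric])
  qed (use D[of x] D[of y] x y u a in simp_all)
qed

lemma adjoint_pairD':
  assumes "adjoint_pair S T" "x \<in> Ob A" "u \<in> carrier (Fib E x)"
  shows "v \<in> carrier (Fib E x) \<Longrightarrow> T x (u \<oplus>\<^bsub>Fib E x\<^esub> v) = T x u \<oplus>\<^bsub>Fib E x\<^esub> T x v"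
    and "\<lbrakk>y \<in> Ob A; a \<in> carrier (Hom A y x)\<rbrakk> \<Longrightarrow> T y (act E x y u a) = act E x y (T x u) a"
  using adjoint_pair_natural[OF assms(1)] assms(2,3)
  by (auto simp: natural_transformation_def semilinear_def)

section \<open>The Cayley reflection of a vector\<close>

text \<open>
  Writing \<open>\<theta> = e\<langle>e, \<cdot>\<rangle>\<close>, this says that \<open>e\<close> lies in the range of \<open>1 + \<theta>\<close>.  Since \<open>\<theta>(e\<cdot>c) = e\<cdot>(bc)\<close> for
  \<open>b = \<langle>e, e\<rangle>\<close>, the solution is \<open>\<eta> = e\<cdot>(1 + b)\<^sup>-\<^sup>1\<close>, and \<open>1 + b\<close> is invertible in the unitization because
  \<open>b\<close> is positive.  The identity is verified by showing that the error \<open>\<delta>\<close>, a combination of \<open>e\<close> and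
  vectors \<open>e\<cdot>c\<close>, is orthogonal to \<open>e\<close> and hence to itself.
\<close>

lemma resolvent_vector:
  assumes x: "x \<in> Ob A" and e: "e \<in> carrier (Fib E x)"
  obtains \<eta> where "\<eta> \<in> carrier (Fib E x)" "\<eta> \<oplus>\<^bsub>Fib E x\<^esub> act E x x e (ip E x x e \<eta>) = e"
proof -
  interpret F: complex_space "Fib E x" by (rule fib_complex_space[OF x])
  interpret H: complex_space "Hom A x x" by (rule hom_complex_space[OF x x])
  let ?F = "Fib E x" and ?B = "Hom A x x" and ?mul = "cmp A x x x"
  define b where "b = ip E x x e e"
  have b: "b \<in> carrier ?B" using x e by (simp add: b_def)
  have "- 1 \<notin> endo_spectrum A x b"
  proof
    assume "- 1 \<in> endo_spectrum A x b"
    then have "- 1 \<in> complex_of_real ` {0..}"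
      using ip_positive[OF x e] by (auto simp: positive_arrow_def b_def)
    then obtain r :: real where "- 1 = complex_of_real r" "0 \<le> r" by auto
    then have "r = - 1" by (metis of_real_1 of_real_eq_iff of_real_minus)
    then show False using \<open>0 \<le> r\<close> by simp
  qed
  then obtain d s where d: "d \<in> carrier ?B"
    and inv: "\<And>c k. \<lbrakk>c \<in> carrier ?B; k = ?mul d c \<oplus>\<^bsub>?B\<^esub> s \<odot>\<^bsub>?B\<^esub> c\<rbrakk>
      \<Longrightarrow> ?mul b k \<oplus>\<^bsub>?B\<^esub> (- (- 1)) \<odot>\<^bsub>?B\<^esub> k = c"
    using resolvent_arrow[OF x b] by metis
  define \<eta> where "\<eta> = act E x x e d \<oplus>\<^bsub>?F\<^esub> s \<odot>\<^bsub>?F\<^esub> e"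
  define k where "k = ip E x x e \<eta>"
  define \<delta> where "\<delta> = (\<eta> \<oplus>\<^bsub>?F\<^esub> act E x x e k) \<oplus>\<^bsub>?F\<^esub> (- 1) \<odot>\<^bsub>?F\<^esub> e"
  have \<eta>: "\<eta> \<in> carrier ?F" using x e d by (simp add: \<eta>_def)
  have k: "k \<in> carrier ?B" using x e \<eta> by (simp add: k_def)
  have \<delta>: "\<delta> \<in> carrier ?F" using x e \<eta> k by (simp add: \<delta>_def)
  have k_eq: "k = ?mul b d \<oplus>\<^bsub>?B\<^esub> s \<odot>\<^bsub>?B\<^esub> b"
    using x e d by (simp add: k_def \<eta>_def b_def ip_add_right ip_scale_right ip_act)
  have e\<delta>: "ip E x x e \<delta> = (k \<oplus>\<^bsub>?B\<^esub> ?mul b k) \<oplus>\<^bsub>?B\<^esub> (- 1) \<odot>\<^bsub>?B\<^esub> b"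
    using x e \<eta> k by (simp add: \<delta>_def k_def b_def ip_add_right ip_scale_right ip_act)
  have zero: "ip E x x e \<delta> = \<zero>\<^bsub>?B\<^esub>"
  proof (rule left_zero[OF x])
    show "ip E x x e \<delta> \<in> carrier ?B" using x e \<delta> by simp
    fix c assume c: "c \<in> carrier ?B"
    obtain w where w_def: "w = ?mul d c \<oplus>\<^bsub>?B\<^esub> s \<odot>\<^bsub>?B\<^esub> c" by blast
    have w: "w \<in> carrier ?B" using x d c by (simp add: w_def)
    have kc: "?mul k c = ?mul b w"
      unfolding k_eq w_def using x b c d
      by (simp add: cmp_add_left cmp_scale_left cmp_add_right cmp_scale_right cmp_assoc)
    have bc: "?mul b c = ?mul b (?mul b w) \<oplus>\<^bsub>?B\<^esub> ?mul b w"
      using inv[OF c w_def] x b w by (simp flip: cmp_add_right)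
    have "?mul (ip E x x e \<delta>) c =
        (?mul b w \<oplus>\<^bsub>?B\<^esub> ?mul b (?mul b w)) \<oplus>\<^bsub>?B\<^esub> (- 1) \<odot>\<^bsub>?B\<^esub> ?mul b c"
      unfolding e\<delta> using x b k c
      by (simp add: cmp_add_left cmp_scale_left cmp_assoc kc)
    also have "\<dots> = \<zero>\<^bsub>?B\<^esub>"
      unfolding bc
      by (rule H.lincomb_eqI[of "[?mul b w, ?mul b (?mul b w)]"], (rule H.lincomb_intros)+)
        (use x b w in simp_all)
    finally show "?mul (ip E x x e \<delta>) c = \<zero>\<^bsub>?B\<^esub>" .
  qed
  have \<delta>e: "ip E x x \<delta> e = \<zero>\<^bsub>?B\<^esub>"
    using ip_star[OF x x \<delta> e] zero semilinear_zero[OF star_conj_linear[OF x x]] H.vector_space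
    by simp
  have z: "?mul \<zero>\<^bsub>?B\<^esub> c = \<zero>\<^bsub>?B\<^esub>" if "c \<in> carrier ?B" for c
    using semilinear_zero[OF cmp_linear_left[OF x x x that]] H.vector_space by simp
  have \<delta>act: "ip E x x \<delta> (act E x x e c) = \<zero>\<^bsub>?B\<^esub>" if "c \<in> carrier ?B" for c
    using ip_act[OF x x x \<delta> e that] \<delta>e z[OF that] by simp
  have "ip E x x \<delta> \<eta> = \<zero>\<^bsub>?B\<^esub>"
    unfolding \<eta>_def using x \<delta> e d by (simp add: ip_add_right ip_scale_right \<delta>act \<delta>e)
  moreover have "ip E x x \<delta> \<delta> = (ip E x x \<delta> \<eta> \<oplus>\<^bsub>?B\<^esub> ip E x x \<delta> (act E x x e k)) \<oplus>\<^bsub>?B\<^esub>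
      (- 1) \<odot>\<^bsub>?B\<^esub> ip E x x \<delta> e"
    by (subst (2) \<delta>_def) (use x \<delta> e \<eta> k in \<open>simp add: ip_add_right ip_scale_right\<close>)
  ultimately have "ip E x x \<delta> \<delta> = \<zero>\<^bsub>?B\<^esub>" using \<delta>act[OF k] \<delta>e by simp
  then have \<delta>0: "\<delta> = \<zero>\<^bsub>?F\<^esub>" by (rule ip_definite[OF x \<delta>])
  have "\<eta> \<oplus>\<^bsub>?F\<^esub> act E x x e k = \<delta> \<oplus>\<^bsub>?F\<^esub> e"
    unfolding \<delta>_def
    by (rule F.lincomb_eqI[of "[\<eta>, act E x x e k, e]"], (rule F.lincomb_intros)+)
      (use x e \<eta> k in simp_all)
  also have "\<dots> = e" using \<delta>0 e by simp
  finally show ?thesis using that[OF \<eta>] by (simp add: k_def)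
qed

end

text \<open>
  The reflection \<open>W\<close> is the Cayley transform \<open>(1 - \<theta>)(1 + \<theta>)\<^sup>-\<^sup>1 = 1 - 2\<theta>(1 + \<theta>)\<^sup>-\<^sup>1\<close> of \<open>\<theta> = e\<langle>e, \<cdot>\<rangle>\<close>.
  What singles it out among the functions of \<open>\<theta>\<close> is that \<open>1 - W\<^sup>2 = 4\<theta>(1 + \<theta>)\<^sup>-\<^sup>2\<close> is the rank one
  operator \<open>\<psi>\<langle>\<psi>, \<cdot>\<rangle>\<close> of the vector \<open>\<psi> = 2\<eta>\<close>; no square root of an arrow has to be taken.  The arrow
  \<open>G\<close> is \<open>b(1 + b)\<^sup>-\<^sup>1\<close> with \<open>b = \<langle>e, e\<rangle>\<close>.
\<close>

locale cayley_reflection = hilbert_module A E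
  for A :: "('o, 'a) star_category" and E :: "('o, 'a, 'm) hilbert_module_data" +
  fixes x :: 'o and e \<eta> :: 'm
  assumes x: "x \<in> Ob A" and e: "e \<in> carrier (Fib E x)" and \<eta>: "\<eta> \<in> carrier (Fib E x)"
    and resolvent: "\<eta> \<oplus>\<^bsub>Fib E x\<^esub> act E x x e (ip E x x e \<eta>) = e"
begin

definition G :: 'a where "G = ip E x x e \<eta>"

definition W :: "'o \<Rightarrow> 'm \<Rightarrow> 'm" where
  "W z f = f \<oplus>\<^bsub>Fib E z\<^esub> (- 2) \<odot>\<^bsub>Fib E z\<^esub> act E x z e (ip E x z \<eta> f)"

lemma G_closed [simp]: "G \<in> carrier (Hom A x x)"
  using x e \<eta> by (simp add: G_def)

lemma e_decomp: "e = \<eta> \<oplus>\<^bsub>Fib E x\<^esub> act E x x e G"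
  using resolvent by (simp add: G_def)

text \<open>
  Pairing \<open>e = \<eta> + e\<cdot>G\<close> with \<open>\<eta>\<close> gives \<open>G = \<langle>\<eta>, \<eta>\<rangle> + G\<^sup>*G\<close>, whose right-hand side is self-adjoint.
\<close>

lemma star_G: "star A x x G = G"
  and ip_\<eta>_\<eta>: "G = ip E x x \<eta> \<eta> \<oplus>\<^bsub>Hom A x x\<^esub> cmp A x x x G G"
proof -
  have 1: "G = ip E x x \<eta> \<eta> \<oplus>\<^bsub>Hom A x x\<^esub> cmp A x x x (star A x x G) G"
  proof -
    have "ip E x x e \<eta> = ip E x x (\<eta> \<oplus>\<^bsub>Fib E x\<^esub> act E x x e G) \<eta>" using e_decomp by simp
    also have "\<dots> = ip E x x \<eta> \<eta> \<oplus>\<^bsub>Hom A x x\<^esub> cmp A x x x (star A x x G) (ip E x x e \<eta>)"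
      using x e \<eta> by (simp add: ip_add_left ip_act_left)
    finally show ?thesis by (simp add: G_def)
  qed
  have "star A x x G = star A x x (ip E x x \<eta> \<eta> \<oplus>\<^bsub>Hom A x x\<^esub> cmp A x x x (star A x x G) G)"
    using 1 by simp
  also have "\<dots> = ip E x x \<eta> \<eta> \<oplus>\<^bsub>Hom A x x\<^esub> cmp A x x x (star A x x G) G"
    using x e \<eta> ip_star[OF x x \<eta> \<eta>] by (simp add: star_add star_cmp star_star)
  also have "\<dots> = G" using 1 by simp
  finally show "star A x x G = G" .
  with 1 show "G = ip E x x \<eta> \<eta> \<oplus>\<^bsub>Hom A x x\<^esub> cmp A x x x G G" by simp
qed

lemma ip_\<eta>_e: "ip E x x \<eta> e = G"
  using ip_star[OF x x \<eta> e] star_G by (simp add: G_def)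

text \<open>
  Both sides are \<open>\<theta>(1 + \<theta>)\<^sup>-\<^sup>1f\<close>, once read as \<open>\<eta>\<langle>e, f\<rangle>\<close> and once as \<open>e\<langle>\<eta>, f\<rangle>\<close>.  They agree because
  inserting \<open>e = \<eta> + e\<cdot>G\<close> into either factor of \<open>e\<langle>e, f\<rangle>\<close> leaves the same remainder \<open>e\<cdot>(G\<langle>e, f\<rangle>)\<close>.
\<close>

lemma act_swap:
  assumes z: "z \<in> Ob A" and f: "f \<in> carrier (Fib E z)"
  shows "act E x z \<eta> (ip E x z e f) = act E x z e (ip E x z \<eta> f)"
proof -
  interpret F: complex_space "Fib E z" by (rule fib_complex_space[OF z])
  let ?a = "ip E x z e f" and ?r = "act E x z e (cmp A z x x G (ip E x z e f))"
  have a: "?a \<in> carrier (Hom A z x)" using x z e f by simp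
  have "ip E x z e f = ip E x z (\<eta> \<oplus>\<^bsub>Fib E x\<^esub> act E x x e G) f" using e_decomp by simp
  also have "\<dots> = ip E x z \<eta> f \<oplus>\<^bsub>Hom A z x\<^esub> cmp A z x x G ?a"
    using x z e f \<eta> by (simp add: ip_add_left ip_act_left star_G)
  finally have "act E x z e ?a = act E x z e (ip E x z \<eta> f \<oplus>\<^bsub>Hom A z x\<^esub> cmp A z x x G ?a)"
    by simp
  also have "\<dots> = act E x z e (ip E x z \<eta> f) \<oplus>\<^bsub>Fib E z\<^esub> ?r"
    using x z e f \<eta> by (simp add: act_add_right)
  finally have 1: "act E x z e ?a = act E x z e (ip E x z \<eta> f) \<oplus>\<^bsub>Fib E z\<^esub> ?r" .
  have "act E x z e ?a = act E x z (\<eta> \<oplus>\<^bsub>Fib E x\<^esub> act E x x e G) ?a" using e_decomp by simp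
  also have "\<dots> = act E x z \<eta> ?a \<oplus>\<^bsub>Fib E z\<^esub> ?r"
    using x z e f \<eta> by (simp add: act_add_left act_cmp)
  finally show ?thesis
    using 1 x z e f \<eta> by simp
qed

lemma W_closed [simp]: "\<lbrakk>z \<in> Ob A; f \<in> carrier (Fib E z)\<rbrakk> \<Longrightarrow> W z f \<in> carrier (Fib E z)"
  using x e \<eta> by (simp add: W_def)

lemma ip_\<eta>_W:
  assumes z: "z \<in> Ob A" and f: "f \<in> carrier (Fib E z)"
  shows "ip E x z \<eta> (W z f) =
    ip E x z \<eta> f \<oplus>\<^bsub>Hom A z x\<^esub> (- 2) \<odot>\<^bsub>Hom A z x\<^esub> cmp A z x x G (ip E x z \<eta> f)"
proof -
  interpret F: complex_space "Fib E z" by (rule fib_complex_space[OF z])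
  show ?thesis
    using x z e f \<eta> ip_act[of x x z \<eta> e "ip E x z \<eta> f"]
    by (simp add: W_def ip_add_right ip_scale_right ip_\<eta>_e)
qed

lemma W_square:
  assumes z: "z \<in> Ob A" and f: "f \<in> carrier (Fib E z)"
  shows "W z (W z f) \<oplus>\<^bsub>Fib E z\<^esub> 4 \<odot>\<^bsub>Fib E z\<^esub> act E x z \<eta> (ip E x z \<eta> f) = f"
proof -
  interpret F: complex_space "Fib E z" by (rule fib_complex_space[OF z])
  let ?F = "Fib E z"
  define g where "g = ip E x z \<eta> f"
  define u v where "u = act E x z \<eta> g" and "v = act E x z e (cmp A z x x G g)"
  have g: "g \<in> carrier (Hom A z x)" using x z \<eta> f by (simp add: g_def)
  have cl: "u \<in> carrier ?F" "v \<in> carrier ?F" using x z \<eta> e g by (simp_all add: u_def v_def)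
  have eg: "act E x z e g = u \<oplus>\<^bsub>?F\<^esub> v"
  proof -
    have "act E x z e g = act E x z (\<eta> \<oplus>\<^bsub>Fib E x\<^esub> act E x x e G) g" using e_decomp by simp
    then show ?thesis using x z e \<eta> g by (simp add: act_add_left act_cmp u_def v_def)
  qed
  have W: "W z f = f \<oplus>\<^bsub>?F\<^esub> (- 2) \<odot>\<^bsub>?F\<^esub> (u \<oplus>\<^bsub>?F\<^esub> v)" by (simp add: W_def g_def[symmetric] eg)
  have "act E x z e (ip E x z \<eta> (W z f)) = (u \<oplus>\<^bsub>?F\<^esub> v) \<oplus>\<^bsub>?F\<^esub> (- 2) \<odot>\<^bsub>?F\<^esub> v"
    unfolding ip_\<eta>_W[OF z f] g_def[symmetric]
    using x z e g by (simp add: act_add_right act_scale_right eg v_def)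
  then have WW: "W z (W z f) = (f \<oplus>\<^bsub>?F\<^esub> (- 2) \<odot>\<^bsub>?F\<^esub> (u \<oplus>\<^bsub>?F\<^esub> v)) \<oplus>\<^bsub>?F\<^esub>
      (- 2) \<odot>\<^bsub>?F\<^esub> ((u \<oplus>\<^bsub>?F\<^esub> v) \<oplus>\<^bsub>?F\<^esub> (- 2) \<odot>\<^bsub>?F\<^esub> v)"
    unfolding W_def[of z "W z f"] by (simp only: W)
  show ?thesis
    unfolding WW g_def[symmetric] u_def[symmetric]
    by (rule F.lincomb_eqI[of "[f, u, v]"], (rule F.lincomb_intros)+) (use f cl in simp_all)
qed

lemma W_self_adjoint: "adjoint_pair W W"
  unfolding adjoint_pair_def
proof (intro conjI ballI)
  fix z y f f' assume z: "z \<in> Ob A" "y \<in> Ob A" and f: "f \<in> carrier (Fib E y)" "f' \<in> carrier (Fib E z)"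
  interpret Fy: complex_space "Fib E y" by (rule fib_complex_space[OF z(2)])
  interpret Fz: complex_space "Fib E z" by (rule fib_complex_space[OF z(1)])
  have "ip E y z (W y f) f' = ip E y z f f' \<oplus>\<^bsub>Hom A z y\<^esub>
      (- 2) \<odot>\<^bsub>Hom A z y\<^esub> cmp A z x y (ip E y x f \<eta>) (ip E x z e f')"
    using x z e \<eta> f ip_star[of x y f \<eta>]
    by (simp add: W_def ip_add_left ip_scale_left ip_act_left)
  also have "cmp A z x y (ip E y x f \<eta>) (ip E x z e f') = ip E y z f (act E x z e (ip E x z \<eta> f'))"
    using x z e \<eta> f act_swap[OF z(1) f(2)] by (simp add: ip_act)
  finally show "ip E y z (W y f) f' = ip E y z f (W z f')"
    using x z e \<eta> f by (simp add: W_def ip_add_right ip_scale_right)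
qed (use W_closed in auto)

lemma ip_W_W:
  assumes z: "z \<in> Ob A" and f: "f \<in> carrier (Fib E z)"
  shows "ip E z z f f = ip E z z (W z f) (W z f) \<oplus>\<^bsub>Hom A z z\<^esub>
    4 \<odot>\<^bsub>Hom A z z\<^esub> cmp A z x z (star A z x (ip E x z \<eta> f)) (ip E x z \<eta> f)"
proof -
  interpret F: complex_space "Fib E z" by (rule fib_complex_space[OF z])
  have "ip E z z f f =
      ip E z z f (W z (W z f) \<oplus>\<^bsub>Fib E z\<^esub> 4 \<odot>\<^bsub>Fib E z\<^esub> act E x z \<eta> (ip E x z \<eta> f))"
    using W_square[OF z f] by simp
  also have "\<dots> = ip E z z f (W z (W z f)) \<oplus>\<^bsub>Hom A z z\<^esub>
      4 \<odot>\<^bsub>Hom A z z\<^esub> cmp A z x z (ip E z x f \<eta>) (ip E x z \<eta> f)"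
    using x z f \<eta> by (simp add: ip_add_right ip_scale_right ip_act)
  also have "ip E z z f (W z (W z f)) = ip E z z (W z f) (W z f)"
    using adjoint_pairD(3)[OF W_self_adjoint z z f, of "W z f"] z f by simp
  also have "ip E z x f \<eta> = star A z x (ip E x z \<eta> f)" using ip_star[of x z f \<eta>] x z f \<eta> by simp
  finally show ?thesis .
qed

lemma W_contraction:
  assumes z: "z \<in> Ob A" and f: "f \<in> carrier (Fib E z)"
  shows "mnorm A E z (W z f) \<le> mnorm A E z f"
proof -
  have "accretive z (of_real 4 \<odot>\<^bsub>Hom A z z\<^esub> cmp A z x z (star A z x (ip E x z \<eta> f)) (ip E x z \<eta> f))"
    using x z f \<eta> by (intro accretive_scale accretive_positive positive_star_self) simp_all
  then have "hnorm A z z (ip E z z (W z f) (W z f)) \<le> hnorm A z z (ip E z z f f)"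
    unfolding ip_W_W[OF z f] using z f by (intro norm_positive_le ip_positive) simp_all
  then show ?thesis by (simp add: mnorm_def)
qed

lemma W_power_closed: "\<lbrakk>z \<in> Ob A; f \<in> carrier (Fib E z)\<rbrakk> \<Longrightarrow> (W z ^^ n) f \<in> carrier (Fib E z)"
  by (induction n) simp_all

text \<open>
  With \<open>f\<^sub>m = W\<^sup>me\<close> and \<open>g\<^sub>m = \<langle>\<eta>, f\<^sub>m\<rangle>\<close>, the identity \<open>1 - W\<^sup>2 = 4\<eta>\<langle>\<eta>, \<cdot>\<rangle>\<close> telescopes to
  \<open>\<langle>e, e\<rangle> = \<langle>f\<^sub>m, f\<^sub>m\<rangle> + 4 (g\<^sub>0\<^sup>*g\<^sub>0 + \<dots> + g\<^sub>n\<^sup>*g\<^sub>n)\<close> with \<open>n = m - 1\<close>.  The summands decrease: from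
  \<open>g\<^bsub>m+1\<^esub> = (1 - 2G) g\<^sub>m\<close> and \<open>G - G\<^sup>2 = \<langle>\<eta>, \<eta>\<rangle>\<close> one gets
  \<open>g\<^sub>m\<^sup>*g\<^sub>m - g\<^bsub>m+1\<^esub>\<^sup>*g\<^bsub>m+1\<^esub> = 4\<langle>\<eta>\<cdot>g\<^sub>m, \<eta>\<cdot>g\<^sub>m\<rangle>\<close>.  So all of them may be replaced by \<open>g\<^sub>m\<^sup>*g\<^sub>m\<close> at the cost of
  an accretive remainder.
\<close>

lemma decay_sum:
  "\<exists>r. accretive x r \<and>
     ip E x x e e = (ip E x x ((W x ^^ m) e) ((W x ^^ m) e) \<oplus>\<^bsub>Hom A x x\<^esub> r) \<oplus>\<^bsub>Hom A x x\<^esub>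
       of_real (4 * real m) \<odot>\<^bsub>Hom A x x\<^esub>
       cmp A x x x (star A x x (ip E x x \<eta> ((W x ^^ m) e))) (ip E x x \<eta> ((W x ^^ m) e))"
proof -
  interpret B: complex_space "Hom A x x" by (rule hom_complex_space[OF x x])
  let ?B = "Hom A x x" and ?mul = "cmp A x x x"
  define f where "f m = (W x ^^ m) e" for m
  define g where "g m = ip E x x \<eta> (f m)" for m
  define sq where "sq m = ?mul (star A x x (g m)) (g m)" for m
  have f: "f m \<in> carrier (Fib E x)" for m using W_power_closed x e by (simp add: f_def)
  have g: "g m \<in> carrier ?B" for m using x \<eta> f by (simp add: g_def)
  have sq: "sq m \<in> carrier ?B" for m using x g by (simp add: sq_def)
  have "\<exists>r. accretive x r \<and> ip E x x e e =
      (ip E x x (f m) (f m) \<oplus>\<^bsub>?B\<^esub> r) \<oplus>\<^bsub>?B\<^esub> of_real (4 * real m) \<odot>\<^bsub>?B\<^esub> sq m"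
  proof (induction m)
    case 0
    have "f 0 = e" by (simp add: f_def)
    then show ?case
      using x e sq[of 0] accretive_zero[OF x] by (intro exI[of _ "\<zero>\<^bsub>?B\<^esub>"]) simp
  next
    case (Suc m)
    then obtain r where r: "accretive x r" and eq: "ip E x x e e =
      (ip E x x (f m) (f m) \<oplus>\<^bsub>?B\<^esub> r) \<oplus>\<^bsub>?B\<^esub> of_real (4 * real m) \<odot>\<^bsub>?B\<^esub> sq m" by blast
    have rB: "r \<in> carrier ?B" using accretive_closed[OF x r] .
    define P where "P = ip E x x \<eta> \<eta>"
    define p where "p = ip E x x (act E x x \<eta> (g m)) (act E x x \<eta> (g m))"
    have cl: "P \<in> carrier ?B" "p \<in> carrier ?B" using x \<eta> g by (simp_all add: P_def p_def)
    have p_eq: "p = ?mul (star A x x (g m)) (?mul P (g m))"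
      using x \<eta> g cl by (simp add: p_def P_def ip_act_left ip_act[symmetric] cmp_assoc)
    have fS: "f (Suc m) = W x (f m)" by (simp add: f_def)
    have gS: "g (Suc m) = g m \<oplus>\<^bsub>?B\<^esub> (- 2) \<odot>\<^bsub>?B\<^esub> ?mul G (g m)"
      unfolding g_def fS using ip_\<eta>_W[OF x f] by simp
    define q where "q = ?mul (star A x x (g m)) (?mul G (?mul G (g m)))"
    have q: "q \<in> carrier ?B" using x g by (simp add: q_def)
    have Gg: "?mul (star A x x (g m)) (?mul G (g m)) = p \<oplus>\<^bsub>?B\<^esub> q"
      by (subst ip_\<eta>_\<eta>)
        (use x g cl \<eta> in \<open>simp add: cmp_add_left cmp_add_right cmp_assoc p_eq q_def P_def\<close>)
    have "sq (Suc m) = (sq m \<oplus>\<^bsub>?B\<^esub> (- 2) \<odot>\<^bsub>?B\<^esub> (p \<oplus>\<^bsub>?B\<^esub> q)) \<oplus>\<^bsub>?B\<^esub>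
        (- 2) \<odot>\<^bsub>?B\<^esub> ((p \<oplus>\<^bsub>?B\<^esub> q) \<oplus>\<^bsub>?B\<^esub> (- 2) \<odot>\<^bsub>?B\<^esub> q)"
      unfolding sq_def gS
      using x g cl q
      by (simp add: star_add star_scale star_cmp star_G cmp_add_left cmp_add_right cmp_scale_left
          cmp_scale_right cmp_assoc Gg q_def[symmetric])
    also have "\<dots> = sq m \<oplus>\<^bsub>?B\<^esub> (- 4) \<odot>\<^bsub>?B\<^esub> p"
      by (rule B.lincomb_eqI[of "[sq m, p, q]"], (rule B.lincomb_intros)+) (use sq cl q in simp_all)
    finally have sqS: "sq (Suc m) = sq m \<oplus>\<^bsub>?B\<^esub> (- 4) \<odot>\<^bsub>?B\<^esub> p" .
    have dS: "ip E x x (f m) (f m) = ip E x x (f (Suc m)) (f (Suc m)) \<oplus>\<^bsub>?B\<^esub> 4 \<odot>\<^bsub>?B\<^esub> sq m"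
      unfolding fS sq_def g_def by (rule ip_W_W[OF x f])
    \<comment> \<open>Passing from \<open>sq m\<close> to \<open>sq (Suc m)\<close> frees \<open>4p\<close> in each of the \<open>4 (m + 1)\<close> copies.\<close>
    define r' where "r' = r \<oplus>\<^bsub>?B\<^esub> of_real (16 * (real m + 1)) \<odot>\<^bsub>?B\<^esub> p"
    have "accretive x r'"
      unfolding r'_def p_def using x \<eta> g r
      by (intro accretive_add accretive_scale positive_ip) simp_all
    moreover have "ip E x x e e = (ip E x x (f (Suc m)) (f (Suc m)) \<oplus>\<^bsub>?B\<^esub> r') \<oplus>\<^bsub>?B\<^esub>
        of_real (4 * real (Suc m)) \<odot>\<^bsub>?B\<^esub> sq (Suc m)"
      unfolding eq dS sqS r'_def
      by (rule B.lincomb_eqI[of "[ip E x x (f (Suc m)) (f (Suc m)), sq m, r, p]"],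
          (rule B.lincomb_intros)+)
        (use x f sq rB cl in \<open>simp_all add: algebra_simps\<close>)
    ultimately show ?case by blast
  qed
  then show ?thesis by (simp add: f_def g_def sq_def)
qed

lemma decay_estimate:
  "4 * real m * (hnorm A x x (ip E x x \<eta> ((W x ^^ m) e)))\<^sup>2 \<le> hnorm A x x (ip E x x e e)"
proof -
  interpret B: normed_complex_space "Hom A x x" "hnorm A x x" by (rule hom_normed_space[OF x x])
  let ?B = "Hom A x x"
  define f where "f = (W x ^^ m) e"
  define g where "g = ip E x x \<eta> f"
  \<comment> \<open>Then \<open>4m g\<^sup>*g\<close> is the positive arrow \<open>(c g)\<^sup>*(c g)\<close>.\<close>
  define c where "c = 2 * sqrt (real m)"
  have cl: "f \<in> carrier (Fib E x)" "g \<in> carrier ?B"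
    using W_power_closed x e \<eta> by (simp_all add: f_def g_def)
  have c2: "c * c = 4 * real m" by (simp add: c_def)
  obtain r where r: "accretive x r" and eq: "ip E x x e e = (ip E x x f f \<oplus>\<^bsub>?B\<^esub> r) \<oplus>\<^bsub>?B\<^esub>
       of_real (c * c) \<odot>\<^bsub>?B\<^esub> cmp A x x x (star A x x g) g"
    using decay_sum[of m] unfolding c2 f_def g_def by blast
  have rB: "r \<in> carrier ?B" using accretive_closed[OF x r] .
  let ?p = "cmp A x x x (star A x x (of_real c \<odot>\<^bsub>?B\<^esub> g)) (of_real c \<odot>\<^bsub>?B\<^esub> g)"
  have "?p = of_real (c * c) \<odot>\<^bsub>?B\<^esub> cmp A x x x (star A x x g) g"
    using x cl by (simp add: star_scale cmp_scale_left cmp_scale_right B.scale_scale)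
  then have eq': "ip E x x e e = ?p \<oplus>\<^bsub>?B\<^esub> (ip E x x f f \<oplus>\<^bsub>?B\<^esub> r)"
    using eq x cl rB B.add_group.a_comm by simp
  have "hnorm A x x ?p \<le> hnorm A x x (ip E x x e e)"
    unfolding eq' using x cl r
    by (intro norm_positive_le positive_star_self accretive_add positive_ip) simp_all
  moreover have "hnorm A x x ?p = (c * hnorm A x x g)\<^sup>2"
    using cstar_identity[OF x x, of "of_real c \<odot>\<^bsub>?B\<^esub> g"] cl
    by (simp add: B.nrm_scale c_def)
  moreover have "(c * hnorm A x x g)\<^sup>2 = 4 * real m * (hnorm A x x g)\<^sup>2"
    unfolding c2[symmetric] by (simp add: power2_eq_square)
  ultimately show ?thesis by (simp add: g_def f_def)
qed

text \<open>
  This is \<open>e = \<eta>\<cdot>(1 + b)\<close> with \<open>b = \<langle>e, e\<rangle>\<close>, paired with \<open>f\<close>.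
\<close>

lemma ip_e_eq:
  assumes z: "z \<in> Ob A" and f: "f \<in> carrier (Fib E z)"
  shows "ip E x z e f = ip E x z \<eta> f \<oplus>\<^bsub>Hom A z x\<^esub> cmp A z x x (ip E x x e e) (ip E x z \<eta> f)"
proof -
  have "act E x x e G = act E x x \<eta> (ip E x x e e)"
    using act_swap[OF x e] ip_\<eta>_e by simp
  then have "e = \<eta> \<oplus>\<^bsub>Fib E x\<^esub> act E x x \<eta> (ip E x x e e)" using e_decomp by simp
  then have "ip E x z e f = ip E x z (\<eta> \<oplus>\<^bsub>Fib E x\<^esub> act E x x \<eta> (ip E x x e e)) f" by simp
  then show ?thesis
    using x z e f \<eta> ip_star[OF x x e e] by (simp add: ip_add_left ip_act_left)
qed

text \<open>
  As \<open>W\<close> is self-adjoint, \<open>\<langle>W\<^sup>me, W\<^sup>me\<rangle> = \<langle>e, W\<^bsup>2m\<^esup>e\<rangle> = (1 + b)\<langle>\<eta>, W\<^bsup>2m\<^esup>e\<rangle>\<close>, and the last factor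
  tends to \<open>0\<close> by the decay estimate.
\<close>

lemma W_power_tendsto_zero:
  assumes "0 < \<epsilon>"
  shows "\<exists>m. mnorm A E x ((W x ^^ m) e) \<le> \<epsilon>"
proof -
  interpret B: normed_complex_space "Hom A x x" "hnorm A x x" by (rule hom_normed_space[OF x x])
  let ?N = "hnorm A x x"
  define b where "b = ?N (ip E x x e e)"
  have b: "0 \<le> b" using x e by (simp add: b_def)
  define \<delta> where "\<delta> = \<epsilon>\<^sup>2 / (1 + b)"
  have \<delta>: "0 < \<delta>" using assms b by (simp add: \<delta>_def)
  \<comment> \<open>The decay estimate at \<open>2m\<close> reads \<open>8m \<parallel>g\<parallel>\<^sup>2 \<le> b\<close>.\<close>
  obtain m :: nat where m: "b / (8 * \<delta>\<^sup>2) < real m" using reals_Archimedean2 by blast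
  have m0: "0 < real m" using m b by (smt (verit) divide_nonneg_nonneg zero_le_power2)
  define f where "f n = (W x ^^ n) e" for n
  have f: "f n \<in> carrier (Fib E x)" for n using W_power_closed x e by (simp add: f_def)
  define g where "g = ip E x x \<eta> (f (2 * m))"
  have g: "g \<in> carrier (Hom A x x)" using x \<eta> f by (simp add: g_def)
  have "8 * real m * (?N g)\<^sup>2 \<le> b"
    using decay_estimate[of "2 * m"] by (simp add: g_def f_def b_def)
  also have "b \<le> 8 * real m * \<delta>\<^sup>2" using m \<delta> by (simp add: field_simps)
  finally have "(?N g)\<^sup>2 \<le> \<delta>\<^sup>2" using m0 by simp
  then have Ng: "?N g \<le> \<delta>" by (rule power2_le_imp_le) (use \<delta> in simp)
  have move: "ip E x x ((W x ^^ n) u) v = ip E x x u ((W x ^^ n) v)"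
    if "u \<in> carrier (Fib E x)" "v \<in> carrier (Fib E x)" for n u v
    using that
  proof (induction n arbitrary: v)
    case (Suc n)
    then have "ip E x x (W x ((W x ^^ n) u)) v = ip E x x u ((W x ^^ n) (W x v))"
      using adjoint_pairD(3)[OF W_self_adjoint x x, of "(W x ^^ n) u" v] W_power_closed x by simp
    then show ?case using funpow_swap1[of "W x" n v] by simp
  qed simp
  have "ip E x x (f m) (f m) = ip E x x e (f (2 * m))"
    using move[OF e f, of m m] by (simp add: f_def mult_2 funpow_add)
  also have "?N \<dots> \<le> ?N g + ?N (cmp A x x x (ip E x x e e) g)"
    unfolding ip_e_eq[OF x f] g_def[symmetric] using x e g by (intro B.nrm_add) simp_all
  also have "\<dots> \<le> ?N g + b * ?N g"
    using cmp_norm[of x x x "ip E x x e e" g] x e g by (simp add: b_def)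
  also have "\<dots> = (1 + b) * ?N g" by (simp add: algebra_simps)
  also have "\<dots> \<le> (1 + b) * \<delta>" using Ng b by (intro mult_left_mono) simp_all
  also have "\<dots> = \<epsilon>\<^sup>2" using b by (simp add: \<delta>_def)
  finally have "(mnorm A E x (f m))\<^sup>2 \<le> \<epsilon>\<^sup>2" using mnorm_square(1)[OF x f] by simp
  then have "mnorm A E x (f m) \<le> \<epsilon>" by (rule power2_le_imp_le) (use assms in simp)
  then show ?thesis by (auto simp: f_def)
qed

end

section \<open>Approximating vectors by finite frames\<close>

context hilbert_module
begin

definition frame_sum :: "('o \<times> 'm) list \<Rightarrow> 'o \<Rightarrow> 'm \<Rightarrow> 'm" where
  "frame_sum \<Psi> z f = finsum (Fib E z)
     (\<lambda>i. act E (fst (\<Psi> ! i)) z (snd (\<Psi> ! i)) (ip E (fst (\<Psi> ! i)) z (snd (\<Psi> ! i)) f))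
     {..<length \<Psi>}"

definition vectors :: "('o \<times> 'm) set" where
  "vectors = (SIGMA x : Ob A. carrier (Fib E x))"

lemma vectors_nth:
  assumes "set \<Psi> \<subseteq> vectors" "i < length \<Psi>"
  shows "fst (\<Psi> ! i) \<in> Ob A" "snd (\<Psi> ! i) \<in> carrier (Fib E (fst (\<Psi> ! i)))"
proof -
  have "\<Psi> ! i \<in> vectors" using assms nth_mem by blast
  then show "fst (\<Psi> ! i) \<in> Ob A" "snd (\<Psi> ! i) \<in> carrier (Fib E (fst (\<Psi> ! i)))"
    by (auto simp: vectors_def)
qed

lemma frame_sum_closed:
  assumes "set \<Psi> \<subseteq> vectors" "z \<in> Ob A" "f \<in> carrier (Fib E z)"
  shows "frame_sum \<Psi> z f \<in> carrier (Fib E z)"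
proof -
  interpret F: complex_space "Fib E z" by (rule fib_complex_space) fact
  show ?thesis
    unfolding frame_sum_def using assms vectors_nth[OF assms(1)]
    by (intro F.add_group.finsum_closed) auto
qed

lemma frame_sum_snoc:
  assumes "set \<Psi> \<subseteq> vectors" "x \<in> Ob A" "\<psi> \<in> carrier (Fib E x)"
    "z \<in> Ob A" "f \<in> carrier (Fib E z)"
  shows "frame_sum (\<Psi> @ [(x, \<psi>)]) z f = act E x z \<psi> (ip E x z \<psi> f) \<oplus>\<^bsub>Fib E z\<^esub> frame_sum \<Psi> z f"
proof -
  interpret F: complex_space "Fib E z" by (rule fib_complex_space) fact
  let ?t = "\<lambda>\<Psi> i. act E (fst (\<Psi> ! i)) z (snd (\<Psi> ! i)) (ip E (fst (\<Psi> ! i)) z (snd (\<Psi> ! i)) f)"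
  let ?\<Psi>' = "\<Psi> @ [(x, \<psi>)]"
  have cl: "?t \<Psi> i \<in> carrier (Fib E z)" if "i < length \<Psi>" for i
    using vectors_nth[OF assms(1) that] assms by simp
  have "finsum (Fib E z) (?t ?\<Psi>') {..<length \<Psi>} = finsum (Fib E z) (?t \<Psi>) {..<length \<Psi>}"
    by (rule F.add_group.finsum_cong') (use cl in \<open>auto simp: nth_append\<close>)
  moreover have "finsum (Fib E z) (?t ?\<Psi>') (insert (length \<Psi>) {..<length \<Psi>}) =
      ?t ?\<Psi>' (length \<Psi>) \<oplus>\<^bsub>Fib E z\<^esub> finsum (Fib E z) (?t ?\<Psi>') {..<length \<Psi>}"
    by (rule F.add_group.finsum_insert) (use cl assms in \<open>auto simp: nth_append\<close>)
  ultimately show ?thesis by (simp add: frame_sum_def lessThan_Suc)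
qed

text \<open>
  The operator \<open>\<psi>\<^sub>1\<langle>\<psi>\<^sub>1, \<cdot>\<rangle> + \<dots> + \<psi>\<^sub>n\<langle>\<psi>\<^sub>n, \<cdot>\<rangle>\<close> of a list of vectors is \<open>1 - v\<^sup>*v\<close>, with a contraction
  \<open>v\<^sup>*\<close>.  Thus it moves a vector \<open>e\<close> by at most \<open>\<parallel>v e\<parallel>\<close>.
\<close>

definition complement_factor ::
    "('o \<Rightarrow> 'm \<Rightarrow> 'm) \<Rightarrow> ('o \<Rightarrow> 'm \<Rightarrow> 'm) \<Rightarrow> ('o \<times> 'm) list \<Rightarrow> bool" where
  "complement_factor v v' \<Psi> \<longleftrightarrow>
     adjoint_pair v v' \<and> set \<Psi> \<subseteq> vectors \<and>
     (\<forall>z\<in>Ob A. \<forall>f\<in>carrier (Fib E z).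
        mnorm A E z (v' z f) \<le> mnorm A E z f \<and>
        v' z (v z f) \<oplus>\<^bsub>Fib E z\<^esub> frame_sum \<Psi> z f = f)"

lemma complement_factor_id: "complement_factor (\<lambda>z f. f) (\<lambda>z f. f) []"
proof -
  have "f \<oplus>\<^bsub>Fib E z\<^esub> frame_sum [] z f = f" if "z \<in> Ob A" "f \<in> carrier (Fib E z)" for z f
  proof -
    interpret F: complex_space "Fib E z" by (rule fib_complex_space) fact
    show ?thesis using that by (simp add: frame_sum_def)
  qed
  then show ?thesis by (simp add: complement_factor_def adjoint_pair_id)
qed

text \<open>
  As \<open>1 - W\<^sup>2 = \<psi>\<langle>\<psi>, \<cdot>\<rangle>\<close> for \<open>\<psi> = 2\<eta>\<close>, replacing \<open>v\<close> by \<open>Wv\<close> subtracts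
  \<open>v\<^sup>*\<psi>\<langle>\<psi>, v \<cdot>\<rangle> = v\<^sup>*\<psi>\<langle>v\<^sup>*\<psi>, \<cdot>\<rangle>\<close> from \<open>v\<^sup>*v\<close>: the list grows by one vector.
\<close>

lemma complement_factor_reflect:
  assumes v: "complement_factor v v' \<Psi>" and "cayley_reflection A E x e \<eta>"
  defines "W \<equiv> cayley_reflection.W E x e \<eta>"
  shows "complement_factor (\<lambda>z f. W z (v z f)) (\<lambda>z f. v' z (W z f))
    (\<Psi> @ [(x, v' x (2 \<odot>\<^bsub>Fib E x\<^esub> \<eta>))])"
proof -
  interpret W: cayley_reflection A E x e \<eta> by fact
  have W_eq: "W = W.W" by (simp add: W_def)
  have pair: "adjoint_pair v v'" and \<Psi>: "set \<Psi> \<subseteq> vectors"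
    using v by (auto simp: complement_factor_def)
  note D = adjoint_pairD[OF pair] and D' = adjoint_pairD'[OF pair]
  note D2 = adjoint_pairD[OF adjoint_pair_commute[OF pair]]
  define \<psi> where "\<psi> = 2 \<odot>\<^bsub>Fib E x\<^esub> \<eta>"
  have \<psi>: "\<psi> \<in> carrier (Fib E x)" "v' x \<psi> \<in> carrier (Fib E x)"
    using W.x W.\<eta> D by (simp_all add: \<psi>_def)
  show ?thesis
    unfolding complement_factor_def \<psi>_def[symmetric]
  proof (intro conjI ballI)
    show "adjoint_pair (\<lambda>z f. W z (v z f)) (\<lambda>z f. v' z (W z f))"
      unfolding W_eq by (rule adjoint_pair_compose[OF W.W_self_adjoint pair])
    show "set (\<Psi> @ [(x, v' x \<psi>)]) \<subseteq> vectors" using \<Psi> W.x \<psi> by (simp add: vectors_def)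
    fix z f assume z: "z \<in> Ob A" and f: "f \<in> carrier (Fib E z)"
    interpret F: complex_space "Fib E z" by (rule fib_complex_space[OF z])
    show "mnorm A E z (v' z (W z f)) \<le> mnorm A E z f"
    proof (rule order_trans)
      show "mnorm A E z (v' z (W z f)) \<le> mnorm A E z (W z f)"
        using v z f by (simp add: complement_factor_def W_eq)
      show "mnorm A E z (W z f) \<le> mnorm A E z f" unfolding W_eq using z f by (rule W.W_contraction)
    qed
    define g where "g = v z f"
    have g: "g \<in> carrier (Fib E z)" using D z f by (simp add: g_def)
    have WW: "W z (W z g) \<in> carrier (Fib E z)" using W.W_closed z g by (simp add: W_eq)
    define a where "a = ip E x z \<psi> g"
    have a: "a \<in> carrier (Hom A z x)" using W.x z g \<psi> by (simp add: a_def)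
    have a_eq: "a = ip E x z (v' x \<psi>) f"
      unfolding a_def g_def using D2(3)[OF z W.x \<psi>(1) f] by simp
    have "act E x z \<psi> a = 4 \<odot>\<^bsub>Fib E z\<^esub> act E x z \<eta> (ip E x z \<eta> g)"
      using W.x W.\<eta> z g
      by (simp add: a_def \<psi>_def ip_scale_left act_scale_left act_scale_right F.scale_scale)
    then have "g = W z (W z g) \<oplus>\<^bsub>Fib E z\<^esub> act E x z \<psi> a"
      using W.W_square[OF z g] by (simp add: W_eq)
    then have "v' z g = v' z (W z (W z g) \<oplus>\<^bsub>Fib E z\<^esub> act E x z \<psi> a)" by simp
    also have "\<dots> = v' z (W z (W z g)) \<oplus>\<^bsub>Fib E z\<^esub> act E x z (v' x \<psi>) a"
      using D'(1)[OF z WW] D'(2)[OF W.x \<psi>(1) z a] W.x z \<psi> a by simp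
    finally have "v' z g = v' z (W z (W z g)) \<oplus>\<^bsub>Fib E z\<^esub> act E x z (v' x \<psi>) a" .
    moreover have "v' z g \<oplus>\<^bsub>Fib E z\<^esub> frame_sum \<Psi> z f = f"
      using v z f by (simp add: complement_factor_def g_def)
    ultimately show "v' z (W z (W z (v z f))) \<oplus>\<^bsub>Fib E z\<^esub> frame_sum (\<Psi> @ [(x, v' x \<psi>)]) z f = f"
      using frame_sum_closed[OF \<Psi> z f] W.x z \<psi> a D(2)[OF z WW]
      by (simp add: frame_sum_snoc[OF \<Psi> W.x \<psi>(2) z f] a_eq[symmetric] g_def[symmetric]
          F.add_group.a_assoc)
  qed
qed

lemma complement_factor_reflect_power:
  assumes "complement_factor v v' \<Psi>" and "cayley_reflection A E x e \<eta>"
  shows "\<exists>v'' \<Psi>'. complement_factor (\<lambda>z f. (cayley_reflection.W E x e \<eta> z ^^ m) (v z f)) v'' \<Psi>'"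
proof (induction m)
  case 0
  then show ?case using assms(1) by auto
next
  case (Suc m)
  then obtain v'' \<Psi>' where
    "complement_factor (\<lambda>z f. (cayley_reflection.W E x e \<eta> z ^^ m) (v z f)) v'' \<Psi>'" by blast
  from complement_factor_reflect[OF this assms(2)] show ?case by auto
qed

text \<open>
  The vectors are treated one after the other.  A further vector \<open>e\<close> is made small by a power of
  the Cayley reflection of \<open>v e\<close>, a contraction, under which the images of the vectors treated
  before remain small.
\<close>

lemma complement_factor_small:
  assumes "set F \<subseteq> vectors" and "0 < \<epsilon>"
  shows "\<exists>v v' \<Psi>. complement_factor v v' \<Psi> \<and> (\<forall>(x, e)\<in>set F. mnorm A E x (v x e) \<le> \<epsilon>)"
  using assms(1)
proof (induction F)
  case Nil
  then show ?case using complement_factor_id by auto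
next
  case (Cons p F)
  obtain x e where p: "p = (x, e)" by fastforce
  have x: "x \<in> Ob A" and e: "e \<in> carrier (Fib E x)" using Cons.prems by (auto simp: p vectors_def)
  have "set F \<subseteq> vectors" using Cons.prems by simp
  then obtain v v' \<Psi> where v: "complement_factor v v' \<Psi>"
    and small: "\<And>y f. (y, f) \<in> set F \<Longrightarrow> mnorm A E y (v y f) \<le> \<epsilon>"
    using Cons.IH by fast
  have pair: "adjoint_pair v v'" using v by (simp add: complement_factor_def)
  have ve: "v x e \<in> carrier (Fib E x)" using adjoint_pairD[OF pair x] e by simp
  obtain \<eta> where \<eta>: "\<eta> \<in> carrier (Fib E x)"
      "\<eta> \<oplus>\<^bsub>Fib E x\<^esub> act E x x (v x e) (ip E x x (v x e) \<eta>) = v x e"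
    using resolvent_vector[OF x ve] by blast
  interpret W: cayley_reflection A E x "v x e" \<eta>
    using x ve \<eta> by unfold_locales
  obtain m where m: "mnorm A E x ((W.W x ^^ m) (v x e)) \<le> \<epsilon>"
    using W.W_power_tendsto_zero[OF assms(2)] by blast
  obtain v'' \<Psi>' where v'': "complement_factor (\<lambda>z f. (W.W z ^^ m) (v z f)) v'' \<Psi>'"
    using complement_factor_reflect_power[OF v W.cayley_reflection_axioms] by blast
  have contr: "mnorm A E z ((W.W z ^^ n) f) \<le> mnorm A E z f"
    if "z \<in> Ob A" "f \<in> carrier (Fib E z)" for z f n
  proof (induction n)
    case (Suc n)
    then show ?case using W.W_contraction[OF that(1) W.W_power_closed[OF that], of n] by simp
  qed simp
  have "mnorm A E y ((W.W y ^^ m) (v y f)) \<le> \<epsilon>" if yf: "(y, f) \<in> set F" for y f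
  proof -
    have y: "y \<in> Ob A" "f \<in> carrier (Fib E y)" using Cons.prems yf by (auto simp: vectors_def)
    then show ?thesis
      using contr[OF y(1), of "v y f" m] adjoint_pairD(1)[OF pair y] small[OF yf] by linarith
  qed
  then have "\<forall>(y, f)\<in>set (p # F). mnorm A E y ((W.W y ^^ m) (v y f)) \<le> \<epsilon>"
    using m by (auto simp: p)
  then show ?case using v'' by blast
qed

lemma approximate_frame:
  assumes "finite F" "F \<subseteq> vectors" and "0 < \<epsilon>"
  shows "\<exists>\<Psi>. set \<Psi> \<subseteq> vectors \<and>
    (\<forall>(x, e)\<in>F. mnorm A E x (frame_sum \<Psi> x e \<ominus>\<^bsub>Fib E x\<^esub> e) \<le> \<epsilon>)"
proof -
  obtain L where L: "set L = F" using finite_list[OF assms(1)] by blast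
  obtain v v' \<Psi> where v: "complement_factor v v' \<Psi>"
    and small: "\<And>x e. (x, e) \<in> F \<Longrightarrow> mnorm A E x (v x e) \<le> \<epsilon>"
    using complement_factor_small[of L, OF _ assms(3)] assms(2) unfolding L by fast
  have pair: "adjoint_pair v v'" and \<Psi>: "set \<Psi> \<subseteq> vectors"
    using v by (auto simp: complement_factor_def)
  have "mnorm A E x (frame_sum \<Psi> x e \<ominus>\<^bsub>Fib E x\<^esub> e) \<le> \<epsilon>" if xe: "(x, e) \<in> F" for x e
  proof -
    have x: "x \<in> Ob A" and e: "e \<in> carrier (Fib E x)" using assms(2) xe by (auto simp: vectors_def)
    interpret F: complex_space "Fib E x" by (rule fib_complex_space[OF x])
    define u where "u = v' x (v x e)"
    have ve: "v x e \<in> carrier (Fib E x)" using adjoint_pairD[OF pair x] e by simp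
    have u: "u \<in> carrier (Fib E x)" using adjoint_pairD[OF pair x] ve by (simp add: u_def)
    have s: "frame_sum \<Psi> x e \<in> carrier (Fib E x)" by (rule frame_sum_closed[OF \<Psi> x e])
    have eq: "u \<oplus>\<^bsub>Fib E x\<^esub> frame_sum \<Psi> x e = e"
      using v x e by (simp add: complement_factor_def u_def)
    have "frame_sum \<Psi> x e \<ominus>\<^bsub>Fib E x\<^esub> (u \<oplus>\<^bsub>Fib E x\<^esub> frame_sum \<Psi> x e) = \<ominus>\<^bsub>Fib E x\<^esub> u"
      by (rule F.lincomb_eqI[of "[u, frame_sum \<Psi> x e]"], (rule F.lincomb_intros)+)
        (use u s in simp_all)
    then have "mnorm A E x (frame_sum \<Psi> x e \<ominus>\<^bsub>Fib E x\<^esub> e) = mnorm A E x u"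
      unfolding eq using mnorm_minus[OF x u] by simp
    also have "\<dots> \<le> mnorm A E x (v x e)"
      using v x ve by (simp add: complement_factor_def u_def)
    also have "\<dots> \<le> \<epsilon>" by (rule small[OF xe])
    finally show ?thesis .
  qed
  then show ?thesis using \<Psi> by blast
qed

section \<open>Operators from finite sums of representable modules\<close>

definition synthesis :: "('o \<times> 'm) list \<Rightarrow> 'o \<Rightarrow> 'a list \<Rightarrow> 'm" where
  "synthesis \<Psi> z as = finsum (Fib E z)
     (\<lambda>i. act E (fst (\<Psi> ! i)) z (snd (\<Psi> ! i)) (as ! i)) {..<length \<Psi>}"

definition analysis :: "('o \<times> 'm) list \<Rightarrow> 'o \<Rightarrow> 'm \<Rightarrow> 'a list" where
  "analysis \<Psi> z f = map (\<lambda>i. ip E (fst (\<Psi> ! i)) z (snd (\<Psi> ! i)) f) [0..<length \<Psi>]"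

definition representable_sum :: "'o list \<Rightarrow> ('o, 'a, 'a list) hilbert_module_data" where
  "representable_sum S = direct_sum A (map (representable A) S)"

lemma representable_sum_simps:
  "as \<in> carrier (Fib (representable_sum S) z) \<longleftrightarrow>
     length as = length S \<and> (\<forall>i<length S. as ! i \<in> carrier (Hom A z (S ! i)))"
  "as \<oplus>\<^bsub>Fib (representable_sum S) z\<^esub> bs =
     map (\<lambda>i. as ! i \<oplus>\<^bsub>Hom A z (S ! i)\<^esub> bs ! i) [0..<length S]"
  "c \<odot>\<^bsub>Fib (representable_sum S) z\<^esub> as =
     map (\<lambda>i. c \<odot>\<^bsub>Hom A z (S ! i)\<^esub> as ! i) [0..<length S]"
  "act (representable_sum S) z y as a = map (\<lambda>i. cmp A y z (S ! i) (as ! i) a) [0..<length S]"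
  by (auto simp: representable_sum_def direct_sum_def Let_def representable_def)

lemma representable_sum_ip:
  assumes "y \<in> Ob A" "z \<in> Ob A" "set S \<subseteq> Ob A"
    "as \<in> carrier (Fib (representable_sum S) y)" "bs \<in> carrier (Fib (representable_sum S) z)"
  shows "ip (representable_sum S) y z as bs =
     finsum (Hom A z y) (\<lambda>i. cmp A z (S ! i) y (star A y (S ! i) (as ! i)) (bs ! i)) {..<length S}"
proof -
  interpret H: complex_space "Hom A z y" by (rule hom_complex_space) fact+
  have "finsum (Hom A z y) (\<lambda>i. ip (map (representable A) S ! i) y z (as ! i) (bs ! i)) {..<length S} =
     finsum (Hom A z y) (\<lambda>i. cmp A z (S ! i) y (star A y (S ! i) (as ! i)) (bs ! i)) {..<length S}"
  proof (rule H.add_group.finsum_cong')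
    have "S ! i \<in> Ob A" if "i < length S" for i using assms(3) nth_mem[OF that] by blast
    then show "(\<lambda>i. cmp A z (S ! i) y (star A y (S ! i) (as ! i)) (bs ! i))
        \<in> {..<length S} \<rightarrow> carrier (Hom A z y)"
      using assms by (auto simp: representable_sum_simps)
  qed (auto simp: representable_def)
  then show ?thesis by (simp add: representable_sum_def direct_sum_def Let_def)
qed

context
  fixes \<Psi> :: "('o \<times> 'm) list"
  assumes \<Psi>: "set \<Psi> \<subseteq> vectors"
begin

private abbreviation (input) "S \<equiv> map fst \<Psi>"
private abbreviation (input) "D \<equiv> representable_sum S"

private lemma S_Ob: "i < length \<Psi> \<Longrightarrow> fst (\<Psi> ! i) \<in> Ob A" "set S \<subseteq> Ob A"
  using \<Psi> vectors_nth[OF \<Psi>] by (auto simp: vectors_def)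

private lemma \<Psi>_nth [simp]:
  "i < length \<Psi> \<Longrightarrow> fst (\<Psi> ! i) \<in> Ob A"
  "i < length \<Psi> \<Longrightarrow> snd (\<Psi> ! i) \<in> carrier (Fib E (fst (\<Psi> ! i)))"
  using vectors_nth[OF \<Psi>] by auto

private lemma carrier_D:
  "as \<in> carrier (Fib D z) \<longleftrightarrow>
     length as = length \<Psi> \<and> (\<forall>i<length \<Psi>. as ! i \<in> carrier (Hom A z (fst (\<Psi> ! i))))"
  by (auto simp: representable_sum_simps)

private lemma D_ip:
  assumes "y \<in> Ob A" "z \<in> Ob A" "as \<in> carrier (Fib D y)" "bs \<in> carrier (Fib D z)"
  shows "ip D y z as bs = finsum (Hom A z y)
    (\<lambda>i. cmp A z (fst (\<Psi> ! i)) y (star A y (fst (\<Psi> ! i)) (as ! i)) (bs ! i)) {..<length \<Psi>}"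
proof -
  interpret H: complex_space "Hom A z y" by (rule hom_complex_space) fact+
  show ?thesis
    unfolding representable_sum_ip[OF assms(1,2) S_Ob(2) assms(3,4)]
    by (rule H.add_group.finsum_cong') (use assms in \<open>auto simp: carrier_D\<close>)
qed

private lemma synthesis_terms:
  "\<lbrakk>z \<in> Ob A; as \<in> carrier (Fib D z); i < length \<Psi>\<rbrakk>
   \<Longrightarrow> act E (fst (\<Psi> ! i)) z (snd (\<Psi> ! i)) (as ! i) \<in> carrier (Fib E z)"
  by (simp add: carrier_D)

lemma synthesis_closed:
  assumes "z \<in> Ob A" "as \<in> carrier (Fib D z)"
  shows "synthesis \<Psi> z as \<in> carrier (Fib E z)"
proof -
  interpret F: complex_space "Fib E z" by (rule fib_complex_space) fact
  show ?thesis
    unfolding synthesis_def by (rule F.add_group.finsum_closed) (use synthesis_terms assms in auto)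
qed

lemma analysis_closed: "\<lbrakk>z \<in> Ob A; f \<in> carrier (Fib E z)\<rbrakk> \<Longrightarrow> analysis \<Psi> z f \<in> carrier (Fib D z)"
  by (simp add: carrier_D analysis_def)

lemma ip_synthesis:
  assumes z: "z \<in> Ob A" and y: "y \<in> Ob A" and as: "as \<in> carrier (Fib D y)" and f: "f \<in> carrier (Fib E z)"
  shows "ip E y z (synthesis \<Psi> y as) f = ip D y z as (analysis \<Psi> z f)"
proof -
  interpret H: complex_space "Hom A z y" by (rule hom_complex_space[OF z y])
  have "ip E y z (synthesis \<Psi> y as) f = finsum (Hom A z y)
      (\<lambda>i. ip E y z (act E (fst (\<Psi> ! i)) y (snd (\<Psi> ! i)) (as ! i)) f) {..<length \<Psi>}"
    unfolding synthesis_def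
    by (rule semilinear_finsum[OF ip_conj_linear_left[OF z y f]])
      (use z y as synthesis_terms fib_vector_space hom_vector_space in auto)
  also have "\<dots> = finsum (Hom A z y)
      (\<lambda>i. cmp A z (fst (\<Psi> ! i)) y (star A y (fst (\<Psi> ! i)) (as ! i)) (analysis \<Psi> z f ! i))
      {..<length \<Psi>}"
    by (rule H.add_group.finsum_cong')
      (use z y as f in \<open>auto simp: carrier_D analysis_def ip_act_left\<close>)
  also have "\<dots> = ip D y z as (analysis \<Psi> z f)"
    using D_ip[OF y z as analysis_closed[OF z f]] by simp
  finally show ?thesis .
qed

lemma synthesis_natural: "natural_transformation A D E (synthesis \<Psi>)"
  unfolding natural_transformation_def semilinear_def
proof (intro conjI ballI allI)
  fix z assume z: "z \<in> Ob A"
  interpret F: complex_space "Fib E z" by (rule fib_complex_space[OF z])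
  show "synthesis \<Psi> z \<in> carrier (Fib D z) \<rightarrow> carrier (Fib E z)" using synthesis_closed z by blast
  fix as assume as: "as \<in> carrier (Fib D z)"
  note t = synthesis_terms[OF z]
  show "synthesis \<Psi> z (as \<oplus>\<^bsub>Fib D z\<^esub> bs) = synthesis \<Psi> z as \<oplus>\<^bsub>Fib E z\<^esub> synthesis \<Psi> z bs"
    if bs: "bs \<in> carrier (Fib D z)" for bs
  proof -
    have "synthesis \<Psi> z (as \<oplus>\<^bsub>Fib D z\<^esub> bs) = finsum (Fib E z)
        (\<lambda>i. act E (fst (\<Psi> ! i)) z (snd (\<Psi> ! i)) (as ! i) \<oplus>\<^bsub>Fib E z\<^esub>
             act E (fst (\<Psi> ! i)) z (snd (\<Psi> ! i)) (bs ! i)) {..<length \<Psi>}"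
      unfolding synthesis_def
      by (rule F.add_group.finsum_cong')
        (use z as bs t in \<open>auto simp: carrier_D representable_sum_simps act_add_right\<close>)
    also have "\<dots> = synthesis \<Psi> z as \<oplus>\<^bsub>Fib E z\<^esub> synthesis \<Psi> z bs"
      unfolding synthesis_def by (rule F.add_group.finsum_addf) (use as bs t in auto)
    finally show ?thesis .
  qed
  show "synthesis \<Psi> z (c \<odot>\<^bsub>Fib D z\<^esub> as) = c \<odot>\<^bsub>Fib E z\<^esub> synthesis \<Psi> z as" for c
  proof -
    have sl: "linear_map (Fib E z) (Fib E z) (\<lambda>u. c \<odot>\<^bsub>Fib E z\<^esub> u)"
      by (auto simp: semilinear_def F.scale_add_right F.scale_scale mult.commute)
    have "synthesis \<Psi> z (c \<odot>\<^bsub>Fib D z\<^esub> as) = finsum (Fib E z)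
        (\<lambda>i. c \<odot>\<^bsub>Fib E z\<^esub> act E (fst (\<Psi> ! i)) z (snd (\<Psi> ! i)) (as ! i)) {..<length \<Psi>}"
      unfolding synthesis_def
      by (rule F.add_group.finsum_cong')
        (use z as t in \<open>auto simp: carrier_D representable_sum_simps act_scale_right\<close>)
    also have "\<dots> = c \<odot>\<^bsub>Fib E z\<^esub> synthesis \<Psi> z as"
      unfolding synthesis_def
      by (rule semilinear_finsum[OF sl, symmetric]) (use as t F.vector_space in auto)
    finally show ?thesis .
  qed
  fix y a assume y: "y \<in> Ob A" and a: "a \<in> carrier (Hom A y z)"
  interpret Fy: complex_space "Fib E y" by (rule fib_complex_space[OF y])
  have "act E z y (synthesis \<Psi> z as) a = finsum (Fib E y)
      (\<lambda>i. act E z y (act E (fst (\<Psi> ! i)) z (snd (\<Psi> ! i)) (as ! i)) a) {..<length \<Psi>}"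
    unfolding synthesis_def
    by (rule semilinear_finsum[OF act_linear_left[OF z y a]])
      (use z y as t fib_vector_space in auto)
  also have "\<dots> = synthesis \<Psi> y (act D z y as a)"
    unfolding synthesis_def
    by (rule Fy.add_group.finsum_cong')
      (use z y as a t in \<open>auto simp: carrier_D representable_sum_simps act_cmp\<close>)
  finally show "synthesis \<Psi> y (act D z y as a) = act E z y (synthesis \<Psi> z as) a" by simp
qed

lemma analysis_adjoint: "is_adjoint A D E (synthesis \<Psi>) (analysis \<Psi>)"
  unfolding is_adjoint_def
proof (intro conjI ballI)
  show "natural_transformation A E D (analysis \<Psi>)"
    unfolding natural_transformation_def semilinear_def
    using analysis_closed
    by (auto simp: representable_sum_simps analysis_def ip_add_right ip_scale_right ip_act)
qed (rule ip_synthesis)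

text \<open>
  The remaining summands of \<open>\<langle>a, a\<rangle> = a\<^sub>1\<^sup>*a\<^sub>1 + \<dots> + a\<^sub>n\<^sup>*a\<^sub>n\<close> form an accretive arrow.
\<close>

lemma component_le_norm:
  assumes z: "z \<in> Ob A" and as: "as \<in> carrier (Fib D z)" and i: "i < length \<Psi>"
  shows "(hnorm A z (fst (\<Psi> ! i)) (as ! i))\<^sup>2 \<le> hnorm A z z (ip D z z as as)"
proof -
  interpret H: complex_space "Hom A z z" by (rule hom_complex_space[OF z z])
  let ?p = "\<lambda>j. cmp A z (fst (\<Psi> ! j)) z (star A z (fst (\<Psi> ! j)) (as ! j)) (as ! j)"
  have p: "positive_arrow A z (?p j)" if "j < length \<Psi>" for j
    using that as z by (intro positive_star_self) (auto simp: carrier_D)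
  have pc: "?p j \<in> carrier (Hom A z z)" if "j < length \<Psi>" for j
    using p[OF that] by (simp add: positive_arrow_def)
  let ?q = "finsum (Hom A z z) (\<lambda>j. if j = i then \<zero>\<^bsub>Hom A z z\<^esub> else ?p j) {..<length \<Psi>}"
  have "finsum (Hom A z z) ?p {..<length \<Psi>} =
      finsum (Hom A z z) (\<lambda>j. (if j = i then ?p j else \<zero>\<^bsub>Hom A z z\<^esub>) \<oplus>\<^bsub>Hom A z z\<^esub>
        (if j = i then \<zero>\<^bsub>Hom A z z\<^esub> else ?p j)) {..<length \<Psi>}"
    by (rule H.add_group.finsum_cong') (use pc in auto)
  also have "\<dots> = finsum (Hom A z z) (\<lambda>j. if j = i then ?p j else \<zero>\<^bsub>Hom A z z\<^esub>) {..<length \<Psi>} \<oplus>\<^bsub>Hom A z z\<^esub> ?q"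
    by (rule H.add_group.finsum_addf) (use pc in auto)
  also have "finsum (Hom A z z) (\<lambda>j. if j = i then ?p j else \<zero>\<^bsub>Hom A z z\<^esub>) {..<length \<Psi>} = ?p i"
    using H.add_group.finsum_singleton[of i "{..<length \<Psi>}" ?p] i pc by (simp add: eq_commute Pi_def)
  also have "finsum (Hom A z z) ?p {..<length \<Psi>} = ip D z z as as"
    using D_ip[OF z z as as] by simp
  finally have "ip D z z as as = ?p i \<oplus>\<^bsub>Hom A z z\<^esub> ?q" .
  moreover have "accretive z ?q"
    by (rule accretive_finsum[OF z])
      (use accretive_zero[OF z] accretive_positive[OF z p] in auto)
  ultimately have "hnorm A z z (?p i) \<le> hnorm A z z (ip D z z as as)"
    using norm_positive_le[OF z p[OF i]] by simp
  then show ?thesis using cstar_identity[of z "fst (\<Psi> ! i)" "as ! i"] z as i by (simp add: carrier_D)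
qed

text \<open>
  On the unit sphere every component has norm at most \<open>1\<close>, so the square of the operator norm is
  bounded by the sum \<open>K\<close> of the norms of the entries \<open>\<langle>\<psi>\<^sub>i, \<psi>\<^sub>j\<rangle>\<close> of the Gram matrix.
\<close>

lemma synthesis_bounded: "op_norm A D E (synthesis \<Psi>) < \<infinity>"
proof -
  let ?x = "\<lambda>i. fst (\<Psi> ! i)" and ?\<psi> = "\<lambda>i. snd (\<Psi> ! i)" and ?n = "length \<Psi>"
  define K where "K = (\<Sum>i<?n. \<Sum>j<?n. hnorm A (?x j) (?x i) (ip E (?x i) (?x j) (?\<psi> i) (?\<psi> j)))"
  have "mnorm A E z (synthesis \<Psi> z as) \<le> sqrt K"
    if z: "z \<in> Ob A" and as: "as \<in> carrier (Fib D z)" and one: "mnorm A D z as = 1" for z as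
  proof -
    interpret H: normed_complex_space "Hom A z z" "hnorm A z z" by (rule hom_normed_space[OF z z])
    have asi: "as ! i \<in> carrier (Hom A z (?x i))" if "i < ?n" for i using as that by (simp add: carrier_D)
    have "hnorm A z z (ip D z z as as) = 1" using one by (simp add: mnorm_def)
    then have le1: "hnorm A z (?x i) (as ! i) \<le> 1" if "i < ?n" for i
      using component_le_norm[OF z as that] power2_le_imp_le[of _ 1] by simp
    define f where "f = synthesis \<Psi> z as"
    have f: "f \<in> carrier (Fib E z)" using synthesis_closed[OF z as] by (simp add: f_def)
    have comp: "hnorm A z (?x i) (ip E (?x i) z (?\<psi> i) f) \<le>
        (\<Sum>j<?n. hnorm A (?x j) (?x i) (ip E (?x i) (?x j) (?\<psi> i) (?\<psi> j)))" if i: "i < ?n" for i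
    proof -
      interpret Hi: normed_complex_space "Hom A z (?x i)" "hnorm A z (?x i)"
        using hom_normed_space z i by simp
      have "ip E (?x i) z (?\<psi> i) f = finsum (Hom A z (?x i))
          (\<lambda>j. ip E (?x i) z (?\<psi> i) (act E (?x j) z (?\<psi> j) (as ! j))) {..<?n}"
        unfolding f_def synthesis_def
        by (rule semilinear_finsum[OF ip_linear_right])
          (use z i as synthesis_terms fib_vector_space hom_vector_space in auto)
      also have "hnorm A z (?x i) \<dots> \<le>
          (\<Sum>j<?n. hnorm A z (?x i) (ip E (?x i) z (?\<psi> i) (act E (?x j) z (?\<psi> j) (as ! j))))"
        by (rule Hi.nrm_finsum) (use z i asi in simp)
      also have "\<dots> \<le> (\<Sum>j<?n. hnorm A (?x j) (?x i) (ip E (?x i) (?x j) (?\<psi> i) (?\<psi> j)))"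
      proof (rule sum_mono)
        fix j assume "j \<in> {..<?n}"
        then have j: "j < ?n" by simp
        interpret Hij: normed_complex_space "Hom A (?x j) (?x i)" "hnorm A (?x j) (?x i)"
          using hom_normed_space i j by simp
        let ?c = "ip E (?x i) (?x j) (?\<psi> i) (?\<psi> j)"
        have c: "?c \<in> carrier (Hom A (?x j) (?x i))" using i j by simp
        have "hnorm A z (?x i) (ip E (?x i) z (?\<psi> i) (act E (?x j) z (?\<psi> j) (as ! j)))
            = hnorm A z (?x i) (cmp A z (?x j) (?x i) ?c (as ! j))"
          using z i j asi[OF j] by (simp add: ip_act)
        also have "\<dots> \<le> hnorm A (?x j) (?x i) ?c * hnorm A z (?x j) (as ! j)"
          using z i j asi[OF j] c by (intro cmp_norm) simp_all
        also have "\<dots> \<le> hnorm A (?x j) (?x i) ?c * 1"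
          using le1[OF j] c by (intro mult_left_mono) simp_all
        finally show "hnorm A z (?x i) (ip E (?x i) z (?\<psi> i) (act E (?x j) z (?\<psi> j) (as ! j)))
            \<le> hnorm A (?x j) (?x i) ?c" by simp
      qed
      finally show ?thesis .
    qed
    let ?t = "\<lambda>i. cmp A z (?x i) z (star A z (?x i) (as ! i)) (ip E (?x i) z (?\<psi> i) f)"
    have t: "?t i \<in> carrier (Hom A z z)" if "i < ?n" for i using that z f asi by simp
    have "ip E z z f f = ip D z z as (analysis \<Psi> z f)"
      using ip_synthesis[OF z z as f] by (simp add: f_def)
    also have "\<dots> = finsum (Hom A z z) ?t {..<?n}"
      unfolding D_ip[OF z z as analysis_closed[OF z f]]
      using t by (auto intro!: H.add_group.finsum_cong' simp: analysis_def)
    also have "hnorm A z z \<dots> \<le> (\<Sum>i<?n. hnorm A z z (?t i))" by (rule H.nrm_finsum) (rule t)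
    also have "\<dots> \<le> K"
      unfolding K_def
    proof (rule sum_mono)
      fix i assume "i \<in> {..<?n}"
      then have i: "i < ?n" by simp
      interpret Hi: normed_complex_space "Hom A z (?x i)" "hnorm A z (?x i)"
        using hom_normed_space z i by simp
      let ?g = "ip E (?x i) z (?\<psi> i) f"
      have g: "?g \<in> carrier (Hom A z (?x i))" using z i f by simp
      have "hnorm A z z (?t i) \<le> hnorm A (?x i) z (star A z (?x i) (as ! i)) * hnorm A z (?x i) ?g"
        using z i asi[OF i] g by (intro cmp_norm) simp_all
      also have "\<dots> \<le> 1 * hnorm A z (?x i) ?g"
        using z i asi[OF i] g le1[OF i] by (intro mult_right_mono) (simp_all add: star_norm)
      finally show "hnorm A z z (?t i) \<le>
          (\<Sum>j<?n. hnorm A (?x j) (?x i) (ip E (?x i) (?x j) (?\<psi> i) (?\<psi> j)))"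
        using comp[OF i] by simp
    qed
    finally show ?thesis unfolding mnorm_def f_def by (rule real_sqrt_le_mono)
  qed
  then have "op_norm A D E (synthesis \<Psi>) \<le> ennreal (sqrt K)"
    unfolding op_norm_def by (intro SUP_least) (auto intro: ennreal_leI)
  then show ?thesis by (simp add: le_less_trans)
qed

lemma synthesis_bounded_adjointable: "bounded_adjointable A D E (synthesis \<Psi>)"
  unfolding bounded_adjointable_def
  using synthesis_natural synthesis_bounded analysis_adjoint by blast

text \<open>
  Uniqueness of the adjoint: the difference \<open>d\<close> of two candidates at \<open>f\<close> satisfies \<open>\<langle>d, d\<rangle> = 0\<close>, which
  forces each of its components to vanish.
\<close>

lemma adjoint_op_synthesis:
  assumes z: "z \<in> Ob A" and f: "f \<in> carrier (Fib E z)"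
  shows "adjoint_op A D E (synthesis \<Psi>) z f = analysis \<Psi> z f"
proof -
  define T where "T = adjoint_op A D E (synthesis \<Psi>)"
  have T: "is_adjoint A D E (synthesis \<Psi>) T"
    unfolding T_def adjoint_op_def
    by (rule someI[where P = "is_adjoint A D E (synthesis \<Psi>)"]) (rule analysis_adjoint)
  have Tf: "T z f \<in> carrier (Fib D z)"
    using T z f by (auto simp: is_adjoint_def natural_transformation_def semilinear_def)
  have af: "analysis \<Psi> z f \<in> carrier (Fib D z)" using analysis_closed z f .
  define d where "d = map (\<lambda>i. T z f ! i \<ominus>\<^bsub>Hom A z (fst (\<Psi> ! i))\<^esub> analysis \<Psi> z f ! i) [0..<length \<Psi>]"
  have sp: "complex_space (Hom A z (fst (\<Psi> ! i)))" if "i < length \<Psi>" for i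
    using hom_complex_space z that by simp
  have cl: "T z f ! i \<in> carrier (Hom A z (fst (\<Psi> ! i)))"
    "analysis \<Psi> z f ! i \<in> carrier (Hom A z (fst (\<Psi> ! i)))" if "i < length \<Psi>" for i
    using Tf af that by (simp_all add: carrier_D)
  have d: "d \<in> carrier (Fib D z)"
    using cl abelian_group.minus_closed[OF complex_space.abelian_group_space[OF sp]]
    by (auto simp: carrier_D d_def)
  have eq: "ip D z z d (T z f) = ip D z z d (analysis \<Psi> z f)"
    using T analysis_adjoint z f d unfolding is_adjoint_def by (metis (no_types, lifting))
  interpret H: normed_complex_space "Hom A z z" "hnorm A z z" by (rule hom_normed_space[OF z z])
  let ?t = "\<lambda>as i. cmp A z (fst (\<Psi> ! i)) z (star A z (fst (\<Psi> ! i)) (d ! i)) (as ! i)"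
  have t: "?t as i \<in> carrier (Hom A z z)" if "as \<in> carrier (Fib D z)" "i < length \<Psi>" for as i
    using that d z by (simp add: carrier_D)
  have ipD: "ip D z z d as = finsum (Hom A z z) (?t as) {..<length \<Psi>}"
    if "as \<in> carrier (Fib D z)" for as
    by (rule D_ip[OF z z d that])
  have split: "ip D z z d (T z f) = ip D z z d d \<oplus>\<^bsub>Hom A z z\<^esub> ip D z z d (analysis \<Psi> z f)"
  proof -
    have "?t (T z f) i = ?t d i \<oplus>\<^bsub>Hom A z z\<^esub> ?t (analysis \<Psi> z f) i" if i: "i < length \<Psi>" for i
    proof -
      interpret Hi: complex_space "Hom A z (fst (\<Psi> ! i))" by (rule sp[OF i])
      have di: "d ! i \<in> carrier (Hom A z (fst (\<Psi> ! i)))" using d i by (simp add: carrier_D)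
      have "T z f ! i = d ! i \<oplus>\<^bsub>Hom A z (fst (\<Psi> ! i))\<^esub> analysis \<Psi> z f ! i"
      proof -
        have "T z f ! i = (T z f ! i \<ominus>\<^bsub>Hom A z (fst (\<Psi> ! i))\<^esub> analysis \<Psi> z f ! i)
            \<oplus>\<^bsub>Hom A z (fst (\<Psi> ! i))\<^esub> analysis \<Psi> z f ! i"
          by (rule Hi.lincomb_eqI[of "[T z f ! i, analysis \<Psi> z f ! i]"], (rule Hi.lincomb_intros)+)
            (use cl[OF i] in simp_all)
        then show ?thesis using i by (simp add: d_def)
      qed
      then show ?thesis using z i di cl[OF i] by (simp add: cmp_add_right)
    qed
    then have "finsum (Hom A z z) (?t (T z f)) {..<length \<Psi>} =
        finsum (Hom A z z) (\<lambda>i. ?t d i \<oplus>\<^bsub>Hom A z z\<^esub> ?t (analysis \<Psi> z f) i) {..<length \<Psi>}"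
      by (intro H.add_group.finsum_cong') (use t[OF d] t[OF af] in auto)
    also have "\<dots> = finsum (Hom A z z) (?t d) {..<length \<Psi>} \<oplus>\<^bsub>Hom A z z\<^esub>
        finsum (Hom A z z) (?t (analysis \<Psi> z f)) {..<length \<Psi>}"
      by (rule H.add_group.finsum_addf) (use t[OF d] t[OF af] in auto)
    finally show ?thesis by (simp add: ipD Tf d af)
  qed
  have clD: "ip D z z d as \<in> carrier (Hom A z z)" if "as \<in> carrier (Fib D z)" for as
    unfolding ipD[OF that] by (rule H.add_group.finsum_closed) (use t[OF that] in auto)
  have dd: "ip D z z d d = \<zero>\<^bsub>Hom A z z\<^esub>"
    using split clD[OF d] clD[OF af] unfolding eq by simp
  have "T z f ! i = analysis \<Psi> z f ! i" if i: "i < length \<Psi>" for i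
  proof -
    interpret Hi: normed_complex_space "Hom A z (fst (\<Psi> ! i))" "hnorm A z (fst (\<Psi> ! i))"
      using hom_normed_space z i by simp
    have di: "d ! i \<in> carrier (Hom A z (fst (\<Psi> ! i)))" using d i by (simp add: carrier_D)
    have "(hnorm A z (fst (\<Psi> ! i)) (d ! i))\<^sup>2 \<le> 0"
      using component_le_norm[OF z d i] dd H.nrm_eq_zero[of "\<zero>\<^bsub>Hom A z z\<^esub>"] by simp
    then have "d ! i = \<zero>\<^bsub>Hom A z (fst (\<Psi> ! i))\<^esub>" using Hi.nrm_eq_zero[OF di] by simp
    then show ?thesis using Hi.eq_if_diff_zero[OF cl[OF i]] i by (simp add: d_def)
  qed
  then show ?thesis
    using Tf af unfolding T_def[symmetric] by (intro nth_equalityI) (simp_all add: carrier_D)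
qed

lemma synthesis_analysis:
  assumes "z \<in> Ob A" "f \<in> carrier (Fib E z)"
  shows "synthesis \<Psi> z (analysis \<Psi> z f) = frame_sum \<Psi> z f"
proof -
  interpret F: complex_space "Fib E z" by (rule fib_complex_space) fact
  show ?thesis
    unfolding synthesis_def frame_sum_def
    by (rule F.add_group.finsum_cong') (use assms in \<open>auto simp: analysis_def\<close>)
qed

lemma synthesis_adjoint_op:
  "\<lbrakk>z \<in> Ob A; f \<in> carrier (Fib E z)\<rbrakk>
   \<Longrightarrow> synthesis \<Psi> z (adjoint_op A D E (synthesis \<Psi>) z f) = frame_sum \<Psi> z f"
  by (simp add: adjoint_op_synthesis synthesis_analysis)

lemma frame_sum_self_adjoint: "adjoint_pair (frame_sum \<Psi>) (frame_sum \<Psi>)"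
  unfolding adjoint_pair_def
proof (intro conjI ballI)
  fix z y e f assume z: "z \<in> Ob A" "y \<in> Ob A" and ef: "e \<in> carrier (Fib E y)" "f \<in> carrier (Fib E z)"
  interpret H: complex_space "Hom A z y" by (rule hom_complex_space) fact+
  let ?x = "\<lambda>i. fst (\<Psi> ! i)" and ?\<psi> = "\<lambda>i. snd (\<Psi> ! i)"
  have "ip E y z (frame_sum \<Psi> y e) f = finsum (Hom A z y)
      (\<lambda>i. ip E y z (act E (?x i) y (?\<psi> i) (ip E (?x i) y (?\<psi> i) e)) f) {..<length \<Psi>}"
    unfolding frame_sum_def
    by (rule semilinear_finsum[OF ip_conj_linear_left])
      (use z ef fib_vector_space hom_vector_space in auto)
  also have "\<dots> = finsum (Hom A z y)
      (\<lambda>i. ip E y z e (act E (?x i) z (?\<psi> i) (ip E (?x i) z (?\<psi> i) f))) {..<length \<Psi>}"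
  proof (rule H.add_group.finsum_cong')
    fix i assume "i \<in> {..<length \<Psi>}"
    then have i: "i < length \<Psi>" by simp
    then show "ip E y z (act E (?x i) y (?\<psi> i) (ip E (?x i) y (?\<psi> i) e)) f =
        ip E y z e (act E (?x i) z (?\<psi> i) (ip E (?x i) z (?\<psi> i) f))"
      using z ef ip_star[of "?x i" y e "?\<psi> i"] by (simp add: ip_act_left ip_act[symmetric])
  qed (use z ef in auto)
  also have "\<dots> = ip E y z e (frame_sum \<Psi> z f)"
    unfolding frame_sum_def
    by (rule semilinear_finsum[OF ip_linear_right, symmetric])
      (use z ef fib_vector_space hom_vector_space in auto)
  finally show "ip E y z (frame_sum \<Psi> y e) f = ip E y z e (frame_sum \<Psi> z f)" .
qed (use frame_sum_closed[OF \<Psi>] in auto)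

end

lemma adjoint_op_eq:
  assumes "adjoint_pair T S" and T': "\<And>z f. \<lbrakk>z \<in> Ob A; f \<in> carrier (Fib E z)\<rbrakk> \<Longrightarrow> T' z f = T z f"
    and z: "z \<in> Ob A" and f: "f \<in> carrier (Fib E z)"
  shows "adjoint_op A E E T' z f = S z f"
proof -
  have "is_adjoint A E E T' S"
    using adjoint_pair_natural[OF assms(1)] adjoint_pairD(3)[OF assms(1)] T'
    by (simp add: is_adjoint_def)
  then have adj: "is_adjoint A E E T' (adjoint_op A E E T')"
    unfolding adjoint_op_def by (rule someI[where P = "is_adjoint A E E T'"])
  then have cl: "adjoint_op A E E T' z f \<in> carrier (Fib E z)"
    using z f by (auto simp: is_adjoint_def natural_transformation_def semilinear_def)
  show ?thesis
  proof (rule fib_eqI[OF z cl])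
    show "S z f \<in> carrier (Fib E z)" using adjoint_pairD(2)[OF assms(1) z f] .
    fix e assume e: "e \<in> carrier (Fib E z)"
    have "ip E z z e (adjoint_op A E E T' z f) = ip E z z (T' z e) f"
      using adj z e f by (simp add: is_adjoint_def)
    also have "\<dots> = ip E z z e (S z f)"
      using T' adjoint_pairD(3)[OF assms(1) z z e f] z e by simp
    finally show "ip E z z e (adjoint_op A E E T' z f) = ip E z z e (S z f)" .
  qed
qed

text \<open>
  The index \<open>(F, n)\<close> asks for accuracy \<open>1/(n + 1)\<close> on the finite set \<open>F\<close>.  Since every vector belongs
  to \<open>F\<close> from some index on, the net converges at each vector.
\<close>

lemma net_of_frames:
  "\<exists>(I :: (('o \<times> 'm) set \<times> nat) set) r \<Psi>.
    directed_set I r \<and> (\<forall>i\<in>I. set (\<Psi> i) \<subseteq> vectors) \<and>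
    (\<forall>x\<in>Ob A. \<forall>e\<in>carrier (Fib E x).
       net_tends_to_zero I r (\<lambda>i. mnorm A E x (frame_sum (\<Psi> i) x e \<ominus>\<^bsub>Fib E x\<^esub> e)))"
proof -
  define I where "I = {F. finite F \<and> F \<subseteq> vectors} \<times> (UNIV :: nat set)"
  define r where "r = {(p, q). p \<in> I \<and> q \<in> I \<and> fst p \<subseteq> fst q \<and> snd p \<le> snd q}"
  have "\<forall>p\<in>I. \<exists>\<Psi>. set \<Psi> \<subseteq> vectors \<and>
     (\<forall>(x, e)\<in>fst p. mnorm A E x (frame_sum \<Psi> x e \<ominus>\<^bsub>Fib E x\<^esub> e) \<le> 1 / (real (snd p) + 1))"
    using approximate_frame by (auto simp: I_def)
  then obtain \<Psi> where \<Psi>: "\<And>p. p \<in> I \<Longrightarrow> set (\<Psi> p) \<subseteq> vectors"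
    and small: "\<And>p x e. \<lbrakk>p \<in> I; (x, e) \<in> fst p\<rbrakk> \<Longrightarrow>
      mnorm A E x (frame_sum (\<Psi> p) x e \<ominus>\<^bsub>Fib E x\<^esub> e) \<le> 1 / (real (snd p) + 1)"
    by (metis (no_types, lifting) case_prodD)
  have "directed_set I r"
    unfolding directed_set_def
  proof (intro conjI ballI)
    show "I \<noteq> {}" by (auto simp: I_def)
    show "preorder_on I r"
      by (auto simp: preorder_on_def r_def refl_on_def trans_on_def)
    fix p q assume "p \<in> I" "q \<in> I"
    then have "(fst p \<union> fst q, max (snd p) (snd q)) \<in> I" by (auto simp: I_def)
    then show "\<exists>k\<in>I. (p, k) \<in> r \<and> (q, k) \<in> r"
      using \<open>p \<in> I\<close> \<open>q \<in> I\<close> by (intro bexI) (auto simp: r_def)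
  qed
  moreover have "net_tends_to_zero I r (\<lambda>i. mnorm A E x (frame_sum (\<Psi> i) x e \<ominus>\<^bsub>Fib E x\<^esub> e))"
    if x: "x \<in> Ob A" and e: "e \<in> carrier (Fib E x)" for x e
    unfolding net_tends_to_zero_def
  proof (intro allI impI)
    fix \<epsilon> :: real assume "0 < \<epsilon>"
    then obtain n where n: "1 / (real n + 1) < \<epsilon>" using nat_approx_posE by (metis of_nat_Suc add.commute)
    show "\<exists>i\<in>I. \<forall>j\<in>I. (i, j) \<in> r \<longrightarrow> \<bar>mnorm A E x (frame_sum (\<Psi> j) x e \<ominus>\<^bsub>Fib E x\<^esub> e)\<bar> < \<epsilon>"
    proof (intro bexI ballI impI)
      show "({(x, e)}, n) \<in> I" using x e by (simp add: I_def vectors_def)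
      fix j assume j: "j \<in> I" "(({(x, e)}, n), j) \<in> r"
      interpret F: complex_space "Fib E x" by (rule fib_complex_space[OF x])
      have "0 \<le> mnorm A E x (frame_sum (\<Psi> j) x e \<ominus>\<^bsub>Fib E x\<^esub> e)"
        using x e frame_sum_closed[OF \<Psi>[OF j(1)] x e] by (intro mnorm_square) simp_all
      moreover have "mnorm A E x (frame_sum (\<Psi> j) x e \<ominus>\<^bsub>Fib E x\<^esub> e) \<le> 1 / (real (snd j) + 1)"
        using small[OF j(1)] j(2) by (auto simp: r_def)
      moreover have "1 / (real (snd j) + 1) \<le> 1 / (real n + 1)"
        using j(2) by (intro divide_left_mono) (auto simp: r_def)
      ultimately show "\<bar>mnorm A E x (frame_sum (\<Psi> j) x e \<ominus>\<^bsub>Fib E x\<^esub> e)\<bar> < \<epsilon>"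
        using n by linarith
    qed
  qed
  ultimately show ?thesis using \<Psi> by (intro exI[of _ I] exI[of _ r] exI[of _ \<Psi>]) blast
qed

end

theorem theorem3p48:
  fixes A :: "('o, 'a) star_category" and E :: "('o, 'a, 'm) hilbert_module_data"
  assumes "cstar_category A" and "hilbert_module A E"
  shows "\<exists>(I :: (('o \<times> 'm) set \<times> nat) set) r (S :: ('o \<times> 'm) set \<times> nat \<Rightarrow> 'o list) \<phi>.
    directed_set I r \<and>
    (\<forall>i\<in>I. set (S i) \<subseteq> Ob A \<and>
       bounded_adjointable A (direct_sum A (map (representable A) (S i))) E (\<phi> i)) \<and>
    strongly_converges A E E I r
      (\<lambda>i x e. \<phi> i x (adjoint_op A (direct_sum A (map (representable A) (S i))) E (\<phi> i) x e))
      (\<lambda>x e. e)"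
proof -
  interpret hilbert_module A E by fact
  obtain I :: "(('o \<times> 'm) set \<times> nat) set" and r \<Psi> where I: "directed_set I r"
    and \<Psi>: "\<And>i. i \<in> I \<Longrightarrow> set (\<Psi> i) \<subseteq> vectors"
    and lim: "\<And>x e. \<lbrakk>x \<in> Ob A; e \<in> carrier (Fib E x)\<rbrakk> \<Longrightarrow>
       net_tends_to_zero I r (\<lambda>i. mnorm A E x (frame_sum (\<Psi> i) x e \<ominus>\<^bsub>Fib E x\<^esub> e))"
    using net_of_frames by blast
  define S where "S i = map fst (\<Psi> i)" for i
  define T where "T i x e = synthesis (\<Psi> i) x
     (adjoint_op A (representable_sum (S i)) E (synthesis (\<Psi> i)) x e)" for i x e
  have T: "T i x e = frame_sum (\<Psi> i) x e" if "i \<in> I" "x \<in> Ob A" "e \<in> carrier (Fib E x)" for i x e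
    using synthesis_adjoint_op[OF \<Psi>] that by (simp add: T_def S_def)
  have T': "adjoint_op A E E (T i) x e = frame_sum (\<Psi> i) x e"
    if "i \<in> I" "x \<in> Ob A" "e \<in> carrier (Fib E x)" for i x e
    by (rule adjoint_op_eq[OF frame_sum_self_adjoint[OF \<Psi>]]) (use that T in simp_all)
  have id: "adjoint_op A E E (\<lambda>x e. e) x e = e" if "x \<in> Ob A" "e \<in> carrier (Fib E x)" for x e
    by (rule adjoint_op_eq[OF adjoint_pair_id]) (use that in simp_all)
  have cong: "net_tends_to_zero I r t" if "net_tends_to_zero I r s" "\<And>i. i \<in> I \<Longrightarrow> t i = s i" for s t
    using that unfolding net_tends_to_zero_def by (metis (no_types, lifting))
  have "strongly_converges A E E I r T (\<lambda>x e. e)"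
    unfolding strongly_converges_def
    by (intro ballI conjI; rule cong[OF lim]) (simp_all add: T T' id)
  moreover have "\<forall>i\<in>I. set (S i) \<subseteq> Ob A \<and>
      bounded_adjointable A (representable_sum (S i)) E (synthesis (\<Psi> i))"
    using \<Psi> synthesis_bounded_adjointable[OF \<Psi>] by (force simp: S_def vectors_def)
  ultimately show ?thesis
    using I unfolding T_def representable_sum_def
    by (intro exI[of _ I] exI[of _ r] exI[of _ S] exI[of _ "\<lambda>i. synthesis (\<Psi> i)"]) blast
qed

end
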